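(* Consider the initial-boundary value problem $$\left\{\begin{array}{ll} \dot u_1(t,x)=u_1''(t,x), & t\ge0,\ x\in(0,1),\\ \dot u_{\rm del}(t,x)=-u_{\rm del}'(t,x), & t\ge0,\ x\in(0,1),\\ \dot u_2(t,x)=u_2''(t,x), & t\ge0,\ x\in(0,1),\\ u_1'(t,1)=u_{\rm del}(t,0),\quad u_1'(t,1)=u_1(t,1),\quad -u_2'(t,0)=u_{\rm del}(t,1), & t\ge0,\\ u_1'(t,0)=0,\quad u_2'(t,1)=0, & t\ge0, \end{array}\right.$$ with prescribed initial data for $u_1,u_2,u_{\rm del}$ at $t=0$. This problem is governed by a strongly continuous semigroup on $L^2(0,1)\times L^2(0,1)\times L^2(0,1)$; that is, the operator $$\mathcal A(u_1,u_2,u_{\rm del})=(u_1'',u_2'',-u_{\rm del}')$$ with domain consisting of all $(u_1,u_2,u_{\rm del})\in H^2(0,1)\times H^2(0,1)\times H^1(0,1)$ satisfying $$u_1'(1)=u_{\rm del}(0),\quad u_1'(1)=u_1(1),\quad -u_2'(0)=u_{\rm del}(1),\quad u_1'(0)=0,\quad u_2'(1)=0$$ generates a strongly continuous semigroup on $L^2(0,1)^3$. Furthermore, this semigroup is real.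
   Context: Primes denote derivatives in $x$ and dots derivatives in $t$. Function spaces consist of complex-valued functions. A semigroup $(T(t))_{t\ge0}$ on an $L^2$-space is called real if each $T(t)$ maps (a.e.) real-valued functions to real-valued functions. *)

theory Defs
  imports "HOL-Analysis.Analysis"
begin

section \<open>Complex normed spaces\<close>

class scaleC =
  fixes scaleC :: "complex \<Rightarrow> 'a \<Rightarrow> 'a" (infixr \<open>*\<^sub>C\<close> 75)

class complex_normed_vector = scaleC + real_normed_vector +
  assumes scaleC_add_right: "a *\<^sub>C (x + y) = a *\<^sub>C x + a *\<^sub>C y"
    and scaleC_add_left: "(a + b) *\<^sub>C x = a *\<^sub>C x + b *\<^sub>C x"
    and scaleC_scaleC: "a *\<^sub>C (b *\<^sub>C x) = (a * b) *\<^sub>C x"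
    and scaleC_one: "1 *\<^sub>C x = x"
    and scaleR_eq_scaleC: "r *\<^sub>R x = complex_of_real r *\<^sub>C x"
    and norm_scaleC: "norm (a *\<^sub>C x) = cmod a * norm x"

instantiation prod :: (complex_normed_vector, complex_normed_vector) complex_normed_vector
begin

definition scaleC_prod :: "complex \<Rightarrow> 'a \<times> 'b \<Rightarrow> 'a \<times> 'b"
  where "scaleC_prod a x = (a *\<^sub>C fst x, a *\<^sub>C snd x)"

instance
proof
  fix a b :: complex and x y :: "'a \<times> 'b" and r :: real
  show "a *\<^sub>C (x + y) = a *\<^sub>C x + a *\<^sub>C y"
    by (simp add: scaleC_prod_def scaleC_add_right)
  show "(a + b) *\<^sub>C x = a *\<^sub>C x + b *\<^sub>C x"
    by (simp add: scaleC_prod_def scaleC_add_left)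
  show "a *\<^sub>C b *\<^sub>C x = (a * b) *\<^sub>C x"
    by (simp add: scaleC_prod_def scaleC_scaleC)
  show "1 *\<^sub>C x = x"
    by (simp add: scaleC_prod_def scaleC_one)
  show "r *\<^sub>R x = complex_of_real r *\<^sub>C x"
    by (simp add: scaleC_prod_def scaleR_prod_def scaleR_eq_scaleC)
  show "norm (a *\<^sub>C x) = cmod a * norm x"
    by (simp add: scaleC_prod_def norm_prod_def norm_scaleC power_mult_distrib
        flip: distrib_left) (simp add: real_sqrt_mult)
qed

end

definition bounded_clinear :: "('a::complex_normed_vector \<Rightarrow> 'b::complex_normed_vector) \<Rightarrow> bool"
  where "bounded_clinear f \<longleftrightarrow> bounded_linear f \<and> (\<forall>a x. f (a *\<^sub>C x) = a *\<^sub>C f x)"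


section \<open>Strongly continuous semigroups and their generators\<close>

text \<open>Time is a real number; a semigroup \<open>T\<close> is only constrained at times \<open>t \<ge> 0\<close>.\<close>

definition c0_semigroup :: "(real \<Rightarrow> 'a::complex_normed_vector \<Rightarrow> 'a) \<Rightarrow> bool"
  where "c0_semigroup T \<longleftrightarrow>
    (\<forall>t\<ge>0. bounded_clinear (T t)) \<and>
    (\<forall>x. T 0 x = x) \<and>
    (\<forall>s\<ge>0. \<forall>t\<ge>0. \<forall>x. T (s + t) x = T s (T t x)) \<and>
    (\<forall>x. continuous_on {0..} (\<lambda>t. T t x))"

definition generator_domain :: "(real \<Rightarrow> 'a::complex_normed_vector \<Rightarrow> 'a) \<Rightarrow> 'a set"
  where "generator_domain T =
    {x. \<exists>y. ((\<lambda>h. (T h x - x) /\<^sub>R h) \<longlongrightarrow> y) (at_right 0)}"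

definition generator :: "(real \<Rightarrow> 'a::complex_normed_vector \<Rightarrow> 'a) \<Rightarrow> 'a \<Rightarrow> 'a"
  where "generator T x = Lim (at_right 0) (\<lambda>h. (T h x - x) /\<^sub>R h)"

text \<open>The unbounded operator \<open>A\<close> with domain \<open>D\<close> (the values of \<open>A\<close> outside \<open>D\<close> are irrelevant)
  generates the strongly continuous semigroup \<open>T\<close>.\<close>

definition generates ::
    "'a::complex_normed_vector set \<Rightarrow> ('a \<Rightarrow> 'a) \<Rightarrow> (real \<Rightarrow> 'a \<Rightarrow> 'a) \<Rightarrow> bool"
  where "generates D A T \<longleftrightarrow>
    c0_semigroup T \<and> generator_domain T = D \<and> (\<forall>x\<in>D. generator T x = A x)"


section \<open>The complex Hilbert space \<open>L\<^sup>2(0,1)\<close>\<close>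

abbreviation I01 :: "real measure"
  where "I01 \<equiv> lebesgue_on {0<..<1}"

definition square_integrable :: "(real \<Rightarrow> complex) \<Rightarrow> bool"
  where "square_integrable f \<longleftrightarrow>
    f \<in> borel_measurable I01 \<and> integrable I01 (\<lambda>x. (cmod (f x))\<^sup>2)"

lemma square_integrable_zero: "square_integrable (\<lambda>_. 0)"
  by (simp add: square_integrable_def)

lemma square_integrable_add:
  assumes "square_integrable f" "square_integrable g"
  shows "square_integrable (\<lambda>x. f x + g x)"
proof -
  have [measurable]: "f \<in> borel_measurable I01" "g \<in> borel_measurable I01"
    using assms by (auto simp: square_integrable_def)
  have "integrable I01 (\<lambda>x. 2 * (cmod (f x))\<^sup>2 + 2 * (cmod (g x))\<^sup>2)"
    using assms by (auto simp: square_integrable_def)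
  then have "integrable I01 (\<lambda>x. (cmod (f x + g x))\<^sup>2)"
  proof (rule Bochner_Integration.integrable_bound)
    show "AE x in I01. norm ((cmod (f x + g x))\<^sup>2)
        \<le> norm (2 * (cmod (f x))\<^sup>2 + 2 * (cmod (g x))\<^sup>2)"
    proof (rule AE_I2)
      fix x
      have "(cmod (f x + g x))\<^sup>2 \<le> (cmod (f x) + cmod (g x))\<^sup>2"
        by (intro power_mono norm_triangle_ineq) auto
      also have "\<dots> \<le> 2 * (cmod (f x))\<^sup>2 + 2 * (cmod (g x))\<^sup>2"
        using sum_squares_bound[of "cmod (f x)" "cmod (g x)"] by (simp add: power2_sum)
      finally show "norm ((cmod (f x + g x))\<^sup>2)
          \<le> norm (2 * (cmod (f x))\<^sup>2 + 2 * (cmod (g x))\<^sup>2)"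
        by simp
    qed
  qed measurable
  then show ?thesis
    by (simp add: square_integrable_def)
qed

lemma square_integrable_mult:
  assumes "square_integrable f"
  shows "square_integrable (\<lambda>x. c * f x)"
  using assms by (auto simp: square_integrable_def norm_mult power_mult_distrib)

lemma integrable_mult_cnj:
  assumes "square_integrable f" "square_integrable g"
  shows "integrable I01 (\<lambda>x. f x * cnj (g x))"
proof -
  have [measurable]: "f \<in> borel_measurable I01" "g \<in> borel_measurable I01"
    using assms by (auto simp: square_integrable_def)
  have "integrable I01 (\<lambda>x. (cmod (f x))\<^sup>2 + (cmod (g x))\<^sup>2)"
    using assms by (auto simp: square_integrable_def)
  then show ?thesis
  proof (rule Bochner_Integration.integrable_bound)
    have "cmod (f x) * cmod (g x) \<le> (cmod (f x))\<^sup>2 + (cmod (g x))\<^sup>2" for x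
      using sum_squares_bound[of "cmod (f x)" "cmod (g x)"]
        mult_nonneg_nonneg[OF norm_ge_zero norm_ge_zero, of "f x" "g x"] by linarith
    then show "AE x in I01. norm (f x * cnj (g x)) \<le> norm ((cmod (f x))\<^sup>2 + (cmod (g x))\<^sup>2)"
      by (auto simp: norm_mult)
  next
    have [measurable]: "cnj \<in> borel_measurable borel"
      by (intro borel_measurable_continuous_onI continuous_on_cnj continuous_on_id)
    show "(\<lambda>x. f x * cnj (g x)) \<in> borel_measurable I01"
      by measurable
  qed
qed

lemma AE_conv2:
  assumes "AE x in M. P x" "AE x in M. Q x" "\<And>x. P x \<Longrightarrow> Q x \<Longrightarrow> R x"
  shows "AE x in M. R x"
  using assms(1,2) by eventually_elim (rule assms(3))

quotient_type L2 = "real \<Rightarrow> complex" / partial: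
  "\<lambda>f g. square_integrable f \<and> square_integrable g \<and> (AE x in I01. f x = g x)"
proof (rule part_equivpI)
  show "\<exists>f. square_integrable f \<and> square_integrable f \<and> (AE x in I01. f x = f x)"
    using square_integrable_zero by auto
  show "symp (\<lambda>f g. square_integrable f \<and> square_integrable g \<and> (AE x in I01. f x = g x))"
    by (rule sympI) (simp add: eq_commute)
  show "transp (\<lambda>f g. square_integrable f \<and> square_integrable g \<and> (AE x in I01. f x = g x))"
    by (rule transpI) (blast intro: AE_conv2 trans)
qed

instantiation L2 :: real_vector
begin

lift_definition zero_L2 :: L2 is "\<lambda>_. 0"
  by (simp add: square_integrable_zero)

lift_definition plus_L2 :: "L2 \<Rightarrow> L2 \<Rightarrow> L2" is "\<lambda>f g x. f x + g x"
  by (auto intro: square_integrable_add elim: AE_conv2)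

lift_definition uminus_L2 :: "L2 \<Rightarrow> L2" is "\<lambda>f x. - f x"
  using square_integrable_mult[of _ "-1"] by auto

lift_definition minus_L2 :: "L2 \<Rightarrow> L2 \<Rightarrow> L2" is "\<lambda>f g x. f x - g x"
  using square_integrable_add[of _ "\<lambda>x. - _ x"] square_integrable_mult[of _ "-1"]
  by (auto elim: AE_conv2)

lift_definition scaleR_L2 :: "real \<Rightarrow> L2 \<Rightarrow> L2" is "\<lambda>r f x. complex_of_real r * f x"
  by (auto intro: square_integrable_mult)

instance
proof
  fix u v w :: L2 and a b :: real
  show "u + v + w = u + (v + w)"
    by transfer (auto simp: add.assoc intro!: square_integrable_add)
  show "u + v = v + u"
    by transfer (auto simp: add.commute intro!: square_integrable_add)
  show "0 + u = u"
    by transfer auto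
  show "- u + u = 0"
    by transfer (auto simp: square_integrable_zero)
  show "u - v = u + - v"
    using square_integrable_add[of _ "\<lambda>x. - _ x"] square_integrable_mult[of _ "-1"]
    by transfer auto
  show "a *\<^sub>R (u + v) = a *\<^sub>R u + a *\<^sub>R v"
    by transfer (auto simp: distrib_left intro!: square_integrable_add square_integrable_mult)
  show "(a + b) *\<^sub>R u = a *\<^sub>R u + b *\<^sub>R u"
    by transfer (auto simp: distrib_right intro!: square_integrable_add square_integrable_mult)
  show "a *\<^sub>R b *\<^sub>R u = (a * b) *\<^sub>R u"
    by transfer (auto simp: mult.assoc intro!: square_integrable_mult)
  show "1 *\<^sub>R u = u"
    by transfer auto
qed

end

text \<open>The real inner product is the real part of the usual complex one, so the norm is the usual
  \<open>L\<^sup>2\<close> norm.\<close>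

instantiation L2 :: real_inner
begin

lift_definition inner_L2 :: "L2 \<Rightarrow> L2 \<Rightarrow> real" is "\<lambda>f g. Re (LINT x|I01. f x * cnj (g x))"
proof -
  fix f f' g g' :: "real \<Rightarrow> complex"
  assume a: "square_integrable f \<and> square_integrable f' \<and> (AE x in I01. f x = f' x)"
    and b: "square_integrable g \<and> square_integrable g' \<and> (AE x in I01. g x = g' x)"
  have "(LINT x|I01. f x * cnj (g x)) = (LINT x|I01. f' x * cnj (g' x))"
  proof (rule integral_cong_AE)
    show "(\<lambda>x. f x * cnj (g x)) \<in> borel_measurable I01"
      using integrable_mult_cnj[of f g] a b by auto
    show "(\<lambda>x. f' x * cnj (g' x)) \<in> borel_measurable I01"
      using integrable_mult_cnj[of f' g'] a b by auto
    show "AE x in I01. f x * cnj (g x) = f' x * cnj (g' x)"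
      using a b by (auto elim: AE_conv2)
  qed
  then show "Re (LINT x|I01. f x * cnj (g x)) = Re (LINT x|I01. f' x * cnj (g' x))"
    by simp
qed

definition norm_L2 :: "L2 \<Rightarrow> real"
  where "norm_L2 u = sqrt (inner u u)"

definition sgn_L2 :: "L2 \<Rightarrow> L2"
  where "sgn_L2 u = u /\<^sub>R norm u"

definition dist_L2 :: "L2 \<Rightarrow> L2 \<Rightarrow> real"
  where "dist_L2 u v = norm (u - v)"

definition uniformity_L2 :: "(L2 \<times> L2) filter"
  where "uniformity_L2 = (INF e\<in>{0<..}. principal {(u, v). dist u v < e})"

definition open_L2 :: "L2 set \<Rightarrow> bool"
  where "open_L2 U \<longleftrightarrow> (\<forall>u\<in>U. \<forall>\<^sub>F (u', v) in uniformity. u' = u \<longrightarrow> v \<in> U)"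

instance
proof
  fix u v w :: L2 and a :: real and U :: "L2 set"
  show "sgn u = u /\<^sub>R norm u"
    by (rule sgn_L2_def)
  show "dist u v = norm (u - v)"
    by (rule dist_L2_def)
  show "uniformity = (INF e\<in>{0<..}. principal {(u :: L2, v). dist u v < e})"
    by (rule uniformity_L2_def)
  show "open U \<longleftrightarrow> (\<forall>u\<in>U. \<forall>\<^sub>F (u', v) in uniformity. u' = u \<longrightarrow> v \<in> U)"
    by (rule open_L2_def)
  show "norm u = sqrt (inner u u)"
    by (rule norm_L2_def)
  show "inner u v = inner v u"
  proof transfer
    fix f g :: "real \<Rightarrow> complex"
    have "Re (LINT x|I01. f x * cnj (g x)) = Re (cnj (LINT x|I01. f x * cnj (g x)))"
      by simp
    also have "\<dots> = Re (LINT x|I01. cnj (f x * cnj (g x)))"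
      by (simp only: Bochner_Integration.integral_cnj)
    also have "(\<lambda>x. cnj (f x * cnj (g x))) = (\<lambda>x. g x * cnj (f x))"
      by (simp add: mult.commute)
    finally show "Re (LINT x|I01. f x * cnj (g x)) = Re (LINT x|I01. g x * cnj (f x))" .
  qed
  show "inner (u + v) w = inner u w + inner v w"
    by transfer (simp add: distrib_right integrable_mult_cnj)
  show "inner (a *\<^sub>R u) v = a * inner u v"
    by transfer (simp add: mult.assoc)
  have sq: "(LINT x|I01. f x * cnj (f x)) = complex_of_real (LINT x|I01. (cmod (f x))\<^sup>2)"
    for f :: "real \<Rightarrow> complex"
    by (simp add: complex_norm_square[symmetric] del: of_real_power)
  show "0 \<le> inner u u"
    by transfer (simp add: sq)
  show "inner u u = 0 \<longleftrightarrow> u = 0"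
  proof transfer
    fix f :: "real \<Rightarrow> complex"
    assume f: "square_integrable f \<and> square_integrable f \<and> (AE x in I01. f x = f x)"
    then have "(LINT x|I01. (cmod (f x))\<^sup>2) = 0 \<longleftrightarrow> (AE x in I01. (cmod (f x))\<^sup>2 = 0)"
      by (intro integral_nonneg_eq_0_iff_AE) (auto simp: square_integrable_def)
    then show "Re (LINT x|I01. f x * cnj (f x)) = 0 \<longleftrightarrow>
        square_integrable f \<and> square_integrable (\<lambda>_. 0) \<and> (AE x in I01. f x = 0)"
      using f by (simp add: sq square_integrable_zero)
  qed
qed

end

instantiation L2 :: complex_normed_vector
begin

lift_definition scaleC_L2 :: "complex \<Rightarrow> L2 \<Rightarrow> L2" is "\<lambda>c f x. c * f x"
  by (auto intro: square_integrable_mult)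

instance
proof
  fix a b :: complex and u v :: L2 and r :: real
  show "a *\<^sub>C (u + v) = a *\<^sub>C u + a *\<^sub>C v"
    by transfer (auto simp: distrib_left intro!: square_integrable_add square_integrable_mult)
  show "(a + b) *\<^sub>C u = a *\<^sub>C u + b *\<^sub>C u"
    by transfer (auto simp: distrib_right intro!: square_integrable_add square_integrable_mult)
  show "a *\<^sub>C b *\<^sub>C u = (a * b) *\<^sub>C u"
    by transfer (auto simp: mult.assoc intro!: square_integrable_mult)
  show "1 *\<^sub>C u = u"
    by transfer auto
  show "r *\<^sub>R u = complex_of_real r *\<^sub>C u"
    by transfer (auto intro!: square_integrable_mult)
  have "inner (a *\<^sub>C u) (a *\<^sub>C u) = (cmod a)\<^sup>2 * inner u u"
  proof transfer
    fix a :: complex and f :: "real \<Rightarrow> complex"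
    have "(\<lambda>x. a * f x * cnj (a * f x)) = (\<lambda>x. complex_of_real ((cmod a)\<^sup>2) * (f x * cnj (f x)))"
      unfolding complex_norm_square by (simp add: algebra_simps)
    then show "Re (LINT x|I01. a * f x * cnj (a * f x)) = (cmod a)\<^sup>2 * Re (LINT x|I01. f x * cnj (f x))"
      by (simp only: integral_mult_right_zero Re_complex_of_real Im_complex_of_real times_complex.sel
          mult_zero_left diff_zero)
  qed
  then show "norm (a *\<^sub>C u) = cmod a * norm u"
    by (simp add: norm_eq_sqrt_inner real_sqrt_mult)
qed

end


section \<open>Sobolev spaces on \<open>(0,1)\<close>\<close>

definition smooth :: "(real \<Rightarrow> complex) \<Rightarrow> bool"
  where "smooth \<phi> \<longleftrightarrow>
    (\<forall>n x. ((\<lambda>\<psi> y. vector_derivative \<psi> (at y)) ^^ n) \<phi> differentiable (at x))"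

definition test_function :: "(real \<Rightarrow> complex) \<Rightarrow> bool"
  where "test_function \<phi> \<longleftrightarrow>
    smooth \<phi> \<and> (\<exists>a b. 0 < a \<and> b < 1 \<and> (\<forall>x. \<phi> x \<noteq> 0 \<longrightarrow> x \<in> {a..b}))"

lemma integral_mult_cong_AE:
  assumes "square_integrable f" "square_integrable g" "AE x in I01. f x = g x"
    and h: "continuous_on UNIV h"
  shows "(LINT x|I01. f x * h x) = (LINT x|I01. g x * h x)"
proof -
  have [measurable]: "f \<in> borel_measurable I01" "g \<in> borel_measurable I01"
    using assms by (auto simp: square_integrable_def)
  have "h \<in> borel_measurable lebesgue"
    using h by (intro measurable_completion) (simp add: borel_measurable_continuous_onI)
  then have [measurable]: "h \<in> borel_measurable I01"
    by (rule measurable_restrict_space1)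
  show ?thesis
  proof (rule integral_cong_AE)
    show "AE x in I01. f x * h x = g x * h x"
      using assms(3) by eventually_elim simp
  qed measurable
qed

lemma test_function_continuous:
  assumes "test_function \<phi>"
  shows "continuous_on UNIV \<phi>" "continuous_on UNIV (\<lambda>x. vector_derivative \<phi> (at x))"
proof -
  have "((\<lambda>\<psi> y. vector_derivative \<psi> (at y)) ^^ n) \<phi> differentiable (at x)" for n x
    using assms by (auto simp: test_function_def smooth_def)
  from this[of 0] this[of 1] show "continuous_on UNIV \<phi>"
      "continuous_on UNIV (\<lambda>x. vector_derivative \<phi> (at x))"
    by (auto intro!: continuous_at_imp_continuous_on differentiable_imp_continuous_within)
qed

lift_definition has_weak_derivative :: "L2 \<Rightarrow> L2 \<Rightarrow> bool" is
  "\<lambda>f g. \<forall>\<phi>. test_function \<phi> \<longrightarrow>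
    (LINT x|I01. f x * vector_derivative \<phi> (at x)) = - (LINT x|I01. g x * \<phi> x)"
proof -
  fix f f' g g' :: "real \<Rightarrow> complex"
  assume f: "square_integrable f \<and> square_integrable f' \<and> (AE x in I01. f x = f' x)"
    and g: "square_integrable g \<and> square_integrable g' \<and> (AE x in I01. g x = g' x)"
  have eq: "(LINT x|I01. f x * vector_derivative \<phi> (at x))
        = (LINT x|I01. f' x * vector_derivative \<phi> (at x))"
    "(LINT x|I01. g x * \<phi> x) = (LINT x|I01. g' x * \<phi> x)"
    if "test_function \<phi>" for \<phi>
    using f g integral_mult_cong_AE[OF _ _ _ test_function_continuous(2)[OF that], of f f']
      integral_mult_cong_AE[OF _ _ _ test_function_continuous(1)[OF that], of g g']
    by simp_all
  show "(\<forall>\<phi>. test_function \<phi> \<longrightarrow>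
      (LINT x|I01. f x * vector_derivative \<phi> (at x)) = - (LINT x|I01. g x * \<phi> x)) \<longleftrightarrow>
    (\<forall>\<phi>. test_function \<phi> \<longrightarrow>
      (LINT x|I01. f' x * vector_derivative \<phi> (at x)) = - (LINT x|I01. g' x * \<phi> x))"
    by (simp add: eq cong: imp_cong)
qed

definition weak_derivative :: "L2 \<Rightarrow> L2"
  where "weak_derivative u = (THE v. has_weak_derivative u v)"

definition H1 :: "L2 set"
  where "H1 = {u. \<exists>v. has_weak_derivative u v}"

definition H2 :: "L2 set"
  where "H2 = {u \<in> H1. weak_derivative u \<in> H1}"

text \<open>Elements of \<open>H1\<close> have a unique representative which is continuous on \<open>[0,1]\<close>; point values,
  in particular at the boundary points, are those of this representative.\<close>

lift_definition continuous_representative :: "L2 \<Rightarrow> (real \<Rightarrow> complex) \<Rightarrow> bool" is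
  "\<lambda>f g. continuous_on {0..1} g \<and> (AE x in I01. f x = g x)"
  by (auto elim: AE_conv2)

definition point_value :: "L2 \<Rightarrow> real \<Rightarrow> complex"
  where "point_value u x = (THE c. \<exists>g. continuous_representative u g \<and> g x = c)"

lemma point_value_eq:
  assumes "continuous_representative u g" "x \<in> {0..1}"
  shows "point_value u x = g x"
proof -
  have "h x = g x" if "continuous_representative u h" for h
  proof -
    from assms(1) that have g: "continuous_on {0..1} g" and h: "continuous_on {0..1} h"
      and "AE y in I01. rep_L2 u y = g y" and "AE y in I01. rep_L2 u y = h y"
      by (simp_all add: continuous_representative.rep_eq)
    from this(3,4) have AE: "AE y in I01. g y = h y"
      by eventually_elim simp
    define N where "N = {y \<in> {0<..<1}. g y - h y \<noteq> 0}"
    have "continuous_on {0<..<1} (\<lambda>y. g y - h y)"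
      by (rule continuous_on_subset[OF continuous_on_diff[OF g h]]) auto
    then have "open ({0<..<1} \<inter> (\<lambda>y. g y - h y) -` (- {0}))"
      by (rule continuous_open_preimage) auto
    moreover have "{0<..<1} \<inter> (\<lambda>y. g y - h y) -` (- {0}) = N"
      by (auto simp: N_def)
    ultimately have "open N"
      by (simp only:)
    moreover have "negligible N"
    proof -
      from AE have "AE y in lebesgue. y \<in> {0<..<1} \<longrightarrow> g y = h y"
        by (simp add: AE_restrict_space_iff)
      then have "{y. \<not> (y \<in> {0<..<1} \<longrightarrow> g y = h y)} \<in> null_sets lebesgue"
        by (simp add: completion.AE_iff_null_sets)
      moreover have "{y. \<not> (y \<in> {0<..<1} \<longrightarrow> g y = h y)} = N"
        by (auto simp: N_def)
      ultimately show ?thesis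
        by (simp only: negligible_iff_null_sets)
    qed
    ultimately have "N = {}"
      using open_not_negligible by blast
    then have zero: "g y - h y = 0" if "y \<in> {0<..<1}" for y
      using that by (auto simp: N_def)
    have cont: "continuous_on (closure {0<..<1}) (\<lambda>y. g y - h y)"
      using continuous_on_diff[OF g h] by simp
    have x: "x \<in> closure {0<..<1}"
      using assms(2) by simp
    have "g x - h x = 0"
      by (rule continuous_constant_on_closure[OF cont zero x])
    then show "h x = g x"
      by simp
  qed
  then show ?thesis
    unfolding point_value_def using assms(1) by (intro the_equality) blast+
qed


section \<open>The system operator and reality of semigroups\<close>

text \<open>States are triples \<open>(u\<^sub>1, u\<^sub>2, u_del)\<close> in \<open>L\<^sup>2(0,1)\<^sup>3\<close>; the norm of the product type is the
  Hilbert space norm.\<close>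

definition system_domain :: "(L2 \<times> L2 \<times> L2) set"
  where "system_domain = {(u1, u2, udel).
    u1 \<in> H2 \<and> u2 \<in> H2 \<and> udel \<in> H1 \<and>
    point_value (weak_derivative u1) 1 = point_value udel 0 \<and>
    point_value (weak_derivative u1) 1 = point_value u1 1 \<and>
    - point_value (weak_derivative u2) 0 = point_value udel 1 \<and>
    point_value (weak_derivative u1) 0 = 0 \<and>
    point_value (weak_derivative u2) 1 = 0}"

fun system_operator :: "L2 \<times> L2 \<times> L2 \<Rightarrow> L2 \<times> L2 \<times> L2"
  where "system_operator (u1, u2, udel) =
    (weak_derivative (weak_derivative u1), weak_derivative (weak_derivative u2),
     - weak_derivative udel)"

lift_definition real_valued :: "L2 \<Rightarrow> bool" is "\<lambda>f. AE x in I01. f x \<in> \<real>"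
  by (auto elim: AE_conv2)

definition real_valued3 :: "L2 \<times> L2 \<times> L2 \<Rightarrow> bool"
  where "real_valued3 = (\<lambda>(u1, u2, udel). real_valued u1 \<and> real_valued u2 \<and> real_valued udel)"

definition real_semigroup :: "(real \<Rightarrow> L2 \<times> L2 \<times> L2 \<Rightarrow> L2 \<times> L2 \<times> L2) \<Rightarrow> bool"
  where "real_semigroup T \<longleftrightarrow> (\<forall>t\<ge>0. \<forall>u. real_valued3 u \<longrightarrow> real_valued3 (T t u))"

end

(* The operator A is quasi-dissipative for the usual norm of L^2(0,1)^3: integration by parts and the
   boundary conditions give
     Re <A u, u> = 3/2 |u_1(1)|^2 + Re (u_del(1) cnj u_2(0)) - 1/2 |u_del(1)|^2 - |u_1'|^2 - |u_2'|^2,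
   and the boundary terms are absorbed by a trace inequality, so that Re <A u, u> <= 5 |u|^2.
   The equation (l - A) u = y with l > 5 is solved explicitly, one component after the other: u_1 does
   not depend on the others, u_del depends on u_1 only through u_1(1), and u_2 depends on u_del only
   through u_del(1). Hence A generates a semigroup by the Lumer-Phillips theorem, which is proved by the
   convergence of the backward Euler scheme. An operator that commutes with the resolvents of A commutes
   with the semigroup; for complex conjugation this is reality.

   Elements of the Sobolev spaces are handled through their absolutely continuous representatives; the
   fundamental lemma of du Bois-Reymond says that these are the primitives of the weak derivatives. *)

theory Submission
  imports Defs
begin

section \<open>Semigroups generated by maximal dissipative operators\<close>

text \<open>The condition \<open>u1'(1) = u1(1)\<close> feeds energy into the system: the operator
  has the positive eigenvalue \<open>m^2\<close> with \<open>m * tanh m = 1\<close>, so a shift is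
  unavoidable. The number 5 serves both requirements: it exceeds the 15/4 that the trace inequality
  yields, and \<open>l > 5\<close> makes \<open>sqrt l\<close> at least 2, which is beyond
  \<open>m\<close>.

  The Euler scheme runs through the step sizes \<open>2^-k\<close> because
  \<open>(1 - h/2 B)^2 = 1 - h B + h^2/4 B^2\<close>: on the domain of the square of
  \<open>B\<close>, halving the step changes one step by order \<open>h^2\<close>, hence the
  approximation at a fixed time by order \<open>2^-k\<close>, and the differences can be summed. All
  other vectors are reached by density, which is itself derived from dissipativity and the range
  condition in the Hilbert space.

  The abstract part sees only the real structure. One commutation result for real linear maps then
  serves twice: applied to multiplication by a complex number it makes the semigroup complex linear,
  applied to conjugation, which is only real linear, it makes the semigroup real.\<close>

locale m_dissipative =
  fixes D :: "'a::{real_inner,banach} set" and B :: "'a \<Rightarrow> 'a"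
  assumes subspace_domain: "subspace D"
    and add: "x \<in> D \<Longrightarrow> y \<in> D \<Longrightarrow> B (x + y) = B x + B y"
    and scale: "x \<in> D \<Longrightarrow> B (r *\<^sub>R x) = r *\<^sub>R B x"
    and dissipative: "x \<in> D \<Longrightarrow> B x \<bullet> x \<le> 0"
    and range: "0 < h \<Longrightarrow> \<exists>x\<in>D. x - h *\<^sub>R B x = y"
begin

section \<open>Resolvents of a dissipative operator\<close>

lemma domain_closed:
  "x \<in> D \<Longrightarrow> y \<in> D \<Longrightarrow> x + y \<in> D" "x \<in> D \<Longrightarrow> r *\<^sub>R x \<in> D"
  "x \<in> D \<Longrightarrow> y \<in> D \<Longrightarrow> x - y \<in> D" "0 \<in> D"
  using subspace_domain by (auto simp: subspace_add subspace_scale subspace_diff subspace_0)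

lemma diff:
  assumes "x \<in> D" "y \<in> D"
  shows "B (x - y) = B x - B y"
  using add[of x "(-1) *\<^sub>R y"] scale[of y "-1"] domain_closed(2)[of y "-1"] assms by simp

text \<open>Pair \<open>x - h B x\<close> with \<open>x\<close>: dissipativity leaves at least the
  squared norm of \<open>x\<close>, and Cauchy-Schwarz does the rest. So \<open>1 - h B\<close> is
  injective with a contractive inverse.\<close>

lemma norm_le_norm_diff:
  assumes "x \<in> D" "0 \<le> h"
  shows "norm x \<le> norm (x - h *\<^sub>R B x)"
proof -
  have "norm x * norm x \<le> x \<bullet> x - h * (B x \<bullet> x)"
    using mult_nonneg_nonpos[OF assms(2) dissipative[OF assms(1)]]
    by (simp add: norm_eq_sqrt_inner)
  also have "\<dots> = (x - h *\<^sub>R B x) \<bullet> x"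
    by (simp add: inner_diff_left)
  also have "\<dots> \<le> norm (x - h *\<^sub>R B x) * norm x"
    by (rule norm_cauchy_schwarz)
  finally show ?thesis
    by (cases "norm x = 0") auto
qed

text \<open>The resolvent \<open>(1 - h B)^-1\<close>, which is one backward Euler step;
  \<open>range\<close> and \<open>norm_le_norm_diff\<close> make it an everywhere defined
  contraction for \<open>h > 0\<close>.\<close>

definition J :: "real \<Rightarrow> 'a \<Rightarrow> 'a"
  where "J h y = (THE x. x \<in> D \<and> x - h *\<^sub>R B x = y)"

text \<open>The way to prove identities for \<open>J\<close>: exhibit a candidate in
  \<open>D\<close> and apply \<open>1 - h B\<close> to it.\<close>

lemma J_unique:
  assumes "0 < h" "x \<in> D" "x - h *\<^sub>R B x = y"
  shows "J h y = x"
  unfolding J_def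
proof (rule the_equality)
  fix z assume z: "z \<in> D \<and> z - h *\<^sub>R B z = y"
  have "norm (z - x) \<le> norm ((z - x) - h *\<^sub>R B (z - x))"
    using z assms by (intro norm_le_norm_diff domain_closed) auto
  also have "(z - x) - h *\<^sub>R B (z - x) = (z - h *\<^sub>R B z) - (x - h *\<^sub>R B x)"
    using z assms by (simp add: diff algebra_simps)
  finally show "z = x"
    using z assms by simp
qed (use assms in auto)

lemma
  assumes "0 < h"
  shows J_in: "J h y \<in> D" and J_eq: "J h y - h *\<^sub>R B (J h y) = y"
proof -
  from range[OF assms, of y] obtain x where "x \<in> D" "x - h *\<^sub>R B x = y"
    by blast
  with J_unique[OF assms] show "J h y \<in> D" "J h y - h *\<^sub>R B (J h y) = y"
    by auto
qed

lemma J_norm: "0 < h \<Longrightarrow> norm (J h y) \<le> norm y"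
  using norm_le_norm_diff[OF J_in, of h h y] J_eq[of h y] by simp

lemma scale_B_J: "0 < h \<Longrightarrow> h *\<^sub>R B (J h y) = J h y - y"
  using J_eq[of h y] by (simp add: algebra_simps)

lemma J_add: "0 < h \<Longrightarrow> J h (x + y) = J h x + J h y"
  by (intro J_unique domain_closed J_in) (auto simp: add J_in scale_B_J algebra_simps)

lemma J_scale: "0 < h \<Longrightarrow> J h (r *\<^sub>R x) = r *\<^sub>R J h x"
proof (rule J_unique)
  assume h: "0 < h"
  have "r *\<^sub>R J h x - h *\<^sub>R B (r *\<^sub>R J h x) = r *\<^sub>R (J h x - h *\<^sub>R B (J h x))"
    using h by (simp add: scale J_in scaleR_diff_right)
  then show "r *\<^sub>R J h x - h *\<^sub>R B (r *\<^sub>R J h x) = r *\<^sub>R x"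
    using J_eq[OF h] by simp
qed (auto intro: domain_closed J_in)

lemma bounded_linear_J: "0 < h \<Longrightarrow> bounded_linear (J h)"
  by (rule bounded_linear_intro[where K = 1]) (auto simp: J_add J_scale J_norm)

lemma J_diff: "0 < h \<Longrightarrow> J h (x - y) = J h x - J h y"
  by (simp add: bounded_linear_J linear_diff bounded_linear.linear)

text \<open>\<open>h B (J h x) = J h x - x\<close> is a difference of elements of \<open>D\<close>:
  the resolvent gains one power of the domain.\<close>

lemma B_J_in:
  assumes "0 < h" "x \<in> D"
  shows "B (J h x) \<in> D"
proof -
  have "inverse h *\<^sub>R (h *\<^sub>R B (J h x)) \<in> D"
    unfolding scale_B_J[OF assms(1)] by (intro domain_closed J_in assms)
  then show ?thesis
    using assms by simp
qed

lemma J_B: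
  assumes "0 < h" "x \<in> D"
  shows "J h (B x) = B (J h x)"
proof (rule J_unique)
  have "B (J h x) - h *\<^sub>R B (B (J h x)) = B (J h x - h *\<^sub>R B (J h x))"
    using assms by (simp add: diff scale domain_closed J_in B_J_in)
  then show "B (J h x) - h *\<^sub>R B (B (J h x)) = B x"
    using J_eq[OF assms(1)] by simp
qed (use assms in \<open>auto intro: B_J_in\<close>)

lemma J_step:
  assumes "0 < h" "x \<in> D"
  shows "norm (J h x - x) \<le> h * norm (B x)"
proof -
  have "J h x - x = h *\<^sub>R J h (B x)"
    using scale_B_J[OF assms(1), of x] J_B[OF assms] by simp
  then show ?thesis
    using J_norm[OF assms(1)] assms(1) by simp
qed

text \<open>The domain of the square of \<open>B\<close>, on which halving a step costs only order
  \<open>h^2\<close>.\<close>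

definition D2 :: "'a set"
  where "D2 = {x \<in> D. B x \<in> D}"

lemma J_D2: "0 < h \<Longrightarrow> x \<in> D2 \<Longrightarrow> J h x \<in> D2"
  by (auto simp: D2_def J_in B_J_in)

lemma J_BB: "0 < h \<Longrightarrow> x \<in> D2 \<Longrightarrow> J h (B (B x)) = B (B (J h x))"
  by (auto simp: D2_def J_B)

text \<open>Two half steps invert \<open>1 - h B + h^2/4 B^2\<close>. Their result \<open>z\<close>
  therefore solves the equation of the full step up to the term \<open>h^2/4 B (B z)\<close>, and
  contractivity of \<open>J h\<close> bounds the difference.\<close>

lemma J_half:
  assumes h: "0 < h" and y: "y \<in> D2"
  shows "norm (J (h/2) (J (h/2) y) - J h y) \<le> h\<^sup>2 / 4 * norm (B (B y))"
proof -
  have h2: "0 < h/2"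
    using h by simp
  define z where "z = J (h/2) (J (h/2) y)"
  have z: "z \<in> D" "B z \<in> D"
    using J_D2[OF h2 J_D2[OF h2 y]] by (auto simp: z_def D2_def)
  have "y = (z - (h/2) *\<^sub>R B z) - (h/2) *\<^sub>R B (z - (h/2) *\<^sub>R B z)"
    unfolding z_def J_eq[OF h2] ..
  also have "\<dots> = z - h *\<^sub>R B z + (h\<^sup>2/4) *\<^sub>R B (B z)"
    using z by (simp add: diff scale domain_closed power2_eq_square algebra_simps
        flip: scaleR_add_left)
  finally have "z - h *\<^sub>R B z = y - (h\<^sup>2/4) *\<^sub>R B (B z)"
    by (simp add: algebra_simps)
  then have "J h (y - (h\<^sup>2/4) *\<^sub>R B (B z)) = z"
    by (intro J_unique h z)
  then have "z - J h y = - ((h\<^sup>2/4) *\<^sub>R J h (B (B z)))"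
    by (simp add: J_diff[OF h] J_scale[OF h] algebra_simps)
  then have "norm (z - J h y) = h\<^sup>2/4 * norm (J h (B (B z)))"
    by simp
  \<comment> \<open>The square of \<open>B\<close> commutes with the resolvents, which trades the
    computed \<open>z\<close> for the given \<open>y\<close>.\<close>
  also have "B (B z) = J (h/2) (J (h/2) (B (B y)))"
    unfolding z_def using J_D2[OF h2 y] y by (simp add: J_BB[OF h2])
  also have "norm (J h (J (h/2) (J (h/2) (B (B y))))) \<le> norm (B (B y))"
    by (meson J_norm h h2 order_trans)
  finally show ?thesis
    by (simp add: z_def mult_left_mono)
qed

section \<open>Stability and refinement of the Euler powers\<close>

lemma funpow_J_norm: "0 < h \<Longrightarrow> norm ((J h ^^ n) x) \<le> norm x"
  by (induction n) (auto intro: order_trans[OF J_norm])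

lemma funpow_J_linear: "0 < h \<Longrightarrow> linear (J h ^^ n)"
proof (induction n)
  case (Suc n)
  then have "linear (J h \<circ> (J h ^^ n))"
    by (intro linear_compose bounded_linear.linear[OF bounded_linear_J]) auto
  then show ?case
    by (simp add: o_def)
qed (simp add: linear_id)

lemma funpow_J_dist: "0 < h \<Longrightarrow> norm ((J h ^^ n) x - (J h ^^ n) y) \<le> norm (x - y)"
  using funpow_J_norm[of h n "x - y"] linear_diff[OF funpow_J_linear[of h n], of x y] by simp

lemma funpow_J_steps:
  assumes "0 < h" "x \<in> D"
  shows "norm ((J h ^^ n) x - x) \<le> real n * h * norm (B x)"
proof (induction n)
  case (Suc n)
  have "norm ((J h ^^ Suc n) x - x) \<le> norm ((J h ^^ n) (J h x) - (J h ^^ n) x) + norm ((J h ^^ n) x - x)"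
    using norm_triangle_ineq[of "(J h ^^ n) (J h x) - (J h ^^ n) x" "(J h ^^ n) x - x"]
    by (simp add: funpow_swap1)
  also have "\<dots> \<le> h * norm (B x) + real n * h * norm (B x)"
    using funpow_J_dist[OF assms(1), of n "J h x" x] J_step[OF assms] Suc by linarith
  finally show ?case
    by (simp add: algebra_simps)
qed simp

text \<open>The local errors of \<open>J_half\<close> add up, since later steps are contractions and
  do not amplify them. The innermost step is split off, so the induction hypothesis is used at
  \<open>J h y\<close>, where the norm of \<open>B (B y)\<close> has not grown.\<close>

lemma funpow_J_half:
  assumes h: "0 < h" and "y \<in> D2"
  shows "norm ((J (h/2) ^^ (2 * n)) y - (J h ^^ n) y) \<le> real n * (h\<^sup>2 / 4 * norm (B (B y)))"
  using assms(2)
proof (induction n arbitrary: y)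
  case (Suc n)
  have h2: "0 < h/2"
    using h by simp
  let ?P = "\<lambda>n. J (h/2) ^^ (2 * n)" and ?Q = "\<lambda>n. J h ^^ n"
  have P: "?P (Suc n) y = ?P n (J (h/2) (J (h/2) y))" and Q: "?Q (Suc n) y = ?Q n (J h y)"
    by (simp_all add: funpow_swap1)
  have "norm (?P (Suc n) y - ?Q (Suc n) y)
      \<le> norm (?P n (J (h/2) (J (h/2) y)) - ?P n (J h y)) + norm (?P n (J h y) - ?Q n (J h y))"
    unfolding P Q using norm_triangle_ineq[of "?P n (J (h/2) (J (h/2) y)) - ?P n (J h y)"
        "?P n (J h y) - ?Q n (J h y)"] by simp
  also have "norm (?P n (J (h/2) (J (h/2) y)) - ?P n (J h y)) \<le> h\<^sup>2 / 4 * norm (B (B y))"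
    using funpow_J_dist[OF h2] J_half[OF h Suc.prems] by (rule order_trans)
  also have "norm (?P n (J h y) - ?Q n (J h y)) \<le> real n * (h\<^sup>2 / 4 * norm (B (B (J h y))))"
    by (intro Suc.IH J_D2 h Suc.prems)
  also have "norm (B (B (J h y))) \<le> norm (B (B y))"
    using J_BB[OF h Suc.prems] J_norm[OF h, of "B (B y)"] by simp
  finally have "norm (?P (Suc n) y - ?Q (Suc n) y)
      \<le> h\<^sup>2 / 4 * norm (B (B y)) + real n * (h\<^sup>2 / 4 * norm (B (B y)))"
    by (simp add: mult_left_mono)
  then show ?case
    by (simp only: of_nat_Suc distrib_right mult_1 add.commute)
qed simp

text \<open>The norms of \<open>a\<^sub>h = J\<^sub>h y - y\<close> are monotone in \<open>h\<close> and dominate the distances of the \<open>a\<^sub>h\<close>,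
  so that \<open>a\<^sub>h\<close> converges as \<open>h \<rightarrow> 0\<close>.\<close>

lemma J_defect_Cauchy:
  assumes "0 < h" "h < k"
  shows "(norm (J h y - J k y))\<^sup>2 \<le> (norm (J k y - y))\<^sup>2 - (norm (J h y - y))\<^sup>2"
proof -
  define a b where "a = J h y - y" and "b = J k y - y"
  have k: "0 < k"
    using assms by simp
  have "B (J h y) = inverse h *\<^sub>R a" "B (J k y) = inverse k *\<^sub>R b"
    using arg_cong[OF scale_B_J[OF assms(1), of y], of "scaleR (inverse h)"]
      arg_cong[OF scale_B_J[OF k, of y], of "scaleR (inverse k)"] assms k
    by (simp_all add: a_def b_def)
  moreover have "B (J h y - J k y) \<bullet> (J h y - J k y) \<le> 0"
    by (intro dissipative domain_closed J_in assms k)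
  moreover have "J h y - J k y = a - b"
    by (simp add: a_def b_def)
  ultimately have "(inverse h *\<^sub>R a - inverse k *\<^sub>R b) \<bullet> (a - b) \<le> 0"
    using diff[OF J_in J_in, OF assms(1) k, of y y] by simp
  then have "h * k * ((inverse h *\<^sub>R a - inverse k *\<^sub>R b) \<bullet> (a - b)) \<le> 0"
    using assms k by (intro mult_nonneg_nonpos) auto
  also have "h * k * ((inverse h *\<^sub>R a - inverse k *\<^sub>R b) \<bullet> (a - b))
      = (k *\<^sub>R a - h *\<^sub>R b) \<bullet> (a - b)"
    using assms k by (simp add: inner_diff_left field_simps)
  also have "\<dots> = k * (a \<bullet> a) + h * (b \<bullet> b) - (h + k) * (a \<bullet> b)"
    by (simp add: inner_diff_left inner_diff_right inner_commute algebra_simps)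
  finally have 1: "k * (a \<bullet> a) + h * (b \<bullet> b) \<le> (h + k) * (a \<bullet> b)"
    by simp
  \<comment> \<open>Expand and eliminate \<open>a \<bullet> b\<close> by fact \<open>1\<close>,
    which is dissipativity at \<open>J h y - J k y\<close>. As the left-hand side is nonnegative,
    \<open>a \<bullet> a \<le> b \<bullet> b\<close> follows, so the factor \<open>k - h\<close> may
    be enlarged to \<open>h + k\<close> and cancelled.\<close>
  have "(h + k) * ((a - b) \<bullet> (a - b)) = (h + k) * (a \<bullet> a + b \<bullet> b) - 2 * ((h + k) * (a \<bullet> b))"
    by (simp add: inner_diff_left inner_diff_right inner_commute algebra_simps)
  also have "\<dots> \<le> (h + k) * (a \<bullet> a + b \<bullet> b) - 2 * (k * (a \<bullet> a) + h * (b \<bullet> b))"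
    using 1 by simp
  also have "\<dots> = (k - h) * (b \<bullet> b - a \<bullet> a)"
    by (simp add: algebra_simps)
  finally have 2: "(h + k) * ((a - b) \<bullet> (a - b)) \<le> (k - h) * (b \<bullet> b - a \<bullet> a)" .
  then have "0 \<le> (k - h) * (b \<bullet> b - a \<bullet> a)"
    using assms k by (intro order_trans[OF mult_nonneg_nonneg 2]) auto
  then have "0 \<le> b \<bullet> b - a \<bullet> a"
    using assms by (simp add: zero_le_mult_iff)
  then have "(k - h) * (b \<bullet> b - a \<bullet> a) \<le> (h + k) * (b \<bullet> b - a \<bullet> a)"
    using assms by (intro mult_right_mono) auto
  with 2 have "(h + k) * ((a - b) \<bullet> (a - b)) \<le> (h + k) * (b \<bullet> b - a \<bullet> a)"
    by (rule order_trans)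
  then have "(a - b) \<bullet> (a - b) \<le> b \<bullet> b - a \<bullet> a"
    by (rule mult_left_le_imp_le) (use assms in simp)
  then show ?thesis
    unfolding power2_norm_eq_inner \<open>J h y - J k y = a - b\<close> by (simp only: a_def b_def)
qed

text \<open>The source of density. The norms of the defects \<open>a k\<close> decrease, so
  \<open>J_defect_Cauchy\<close> makes the defects themselves Cauchy; their limit \<open>z\<close>
  satisfies \<open>J 1 z = 0\<close>, and \<open>J 1\<close> is injective.\<close>

lemma J_tendsto: "(\<lambda>k. J (1/2^k) y) \<longlonglongrightarrow> y"
proof -
  let ?h = "\<lambda>k::nat. 1/2^k :: real"
  define a where "a k = J (?h k) y - y" for k
  have mono: "(norm (a m - a n))\<^sup>2 \<le> (norm (a m))\<^sup>2 - (norm (a n))\<^sup>2" if "m < n" for m n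
    using J_defect_Cauchy[of "?h n" "?h m" y] that
    by (simp add: a_def norm_minus_commute divide_strict_left_mono)
  then have "decseq (\<lambda>k. (norm (a k))\<^sup>2)"
    unfolding decseq_Suc_iff by (smt (verit) lessI zero_le_power2)
  then have Cauchy_sq: "Cauchy (\<lambda>k. (norm (a k))\<^sup>2)"
    by (intro convergent_Cauchy Bseq_monoseq_convergent decseq_bounded[of _ 0]) (auto simp: monoseq_iff)
  have "Cauchy a"
  proof (rule metric_CauchyI)
    fix e :: real assume "0 < e"
    then obtain M where M: "\<And>m n. m \<ge> M \<Longrightarrow> n \<ge> M \<Longrightarrow> \<bar>(norm (a m))\<^sup>2 - (norm (a n))\<^sup>2\<bar> < e\<^sup>2"
      using Cauchy_sq by (auto simp: Cauchy_def dist_real_def) (meson zero_less_power)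
    have *: "norm (a m - a n) < e" if "m \<ge> M" "n \<ge> M" "m < n" for m n
    proof -
      have "(norm (a m - a n))\<^sup>2 < e\<^sup>2"
        using mono[OF that(3)] M[OF that(1,2)] by linarith
      then show ?thesis
        using \<open>0 < e\<close> by (simp add: power2_less_imp_less)
    qed
    show "\<exists>M. \<forall>m\<ge>M. \<forall>n\<ge>M. dist (a m) (a n) < e"
      using * \<open>0 < e\<close> by (metis dist_commute dist_norm dist_self linorder_neqE_nat)
  qed
  then obtain z where z: "a \<longlonglongrightarrow> z"
    by (auto simp: Cauchy_convergent_iff convergent_def)
  \<comment> \<open>\<open>a k\<close> is \<open>2^-k\<close> times a value of \<open>B\<close>, and
    \<open>J 1\<close> composed with \<open>B\<close> is bounded, so \<open>J 1 (a k)\<close> has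
    order \<open>2^-k\<close>.\<close>
  have "norm (J 1 (a k)) \<le> ?h k * (2 * norm y)" for k
  proof -
    have "J 1 (a k) = ?h k *\<^sub>R (J 1 (J (?h k) y) - J (?h k) y)"
    proof -
      have "a k = ?h k *\<^sub>R B (J (?h k) y)"
        by (simp add: scale_B_J a_def)
      then have "J 1 (a k) = ?h k *\<^sub>R B (J 1 (J (?h k) y))"
        by (simp add: J_scale J_B J_in)
      then show ?thesis
        using scale_B_J[of 1 "J (?h k) y"] by simp
    qed
    moreover have "norm (J 1 (J (?h k) y) - J (?h k) y) \<le> 2 * norm y"
      using norm_triangle_ineq4[of "J 1 (J (?h k) y)" "J (?h k) y"] J_norm[of 1 "J (?h k) y"]
        J_norm[of "?h k" y] by simp
    ultimately show ?thesis
      by (simp add: divide_right_mono)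
  qed
  moreover have "(\<lambda>k. ?h k * (2 * norm y)) \<longlonglongrightarrow> 0 * (2 * norm y)"
    by (intro tendsto_intros LIMSEQ_divide_realpow_zero) simp
  ultimately have "(\<lambda>k. J 1 (a k)) \<longlonglongrightarrow> 0"
    by (intro Lim_null_comparison[of "\<lambda>k. J 1 (a k)" "\<lambda>k. ?h k * (2 * norm y)"]) auto
  moreover have "(\<lambda>k. J 1 (a k)) \<longlonglongrightarrow> J 1 z"
    by (intro bounded_linear.tendsto[OF bounded_linear_J] z) simp
  ultimately have "J 1 z = 0"
    by (rule LIMSEQ_unique[rotated])
  then have "z = 0"
    using J_eq[of 1 z] scale[of 0 0] domain_closed(4) by simp
  then have "(\<lambda>k. a k + y) \<longlonglongrightarrow> 0 + y"
    using z by (intro tendsto_intros) auto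
  then show ?thesis
    by (simp add: a_def)
qed

text \<open>One resolvent leads into \<open>D\<close>, a second one into \<open>D2\<close>. By
  \<open>J (J y) - J y = J (J y - y)\<close> the second moves the point no further than the first,
  whence \<open>e/2\<close>.\<close>

lemma dense_D2:
  assumes "0 < e"
  shows "\<exists>x\<in>D2. norm (x - y) < e"
proof -
  obtain k where k: "norm (J (1/2^k) y - y) < e/2"
    using J_tendsto[of y] assms by (metis LIMSEQ_iff half_gt_zero order_refl)
  let ?J = "J (1/2^k)"
  have "norm (?J (?J y) - ?J y) \<le> norm (?J y - y)"
    using J_norm[of "1/2^k" "?J y - y"] by (simp add: J_diff)
  then have "norm (?J (?J y) - y) < e"
    using norm_triangle_ineq[of "?J (?J y) - ?J y" "?J y - y"] k by simp
  then show ?thesis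
    by (intro bexI[of _ "?J (?J y)"]) (auto simp: D2_def J_in B_J_in)
qed

lemma dense_D: "0 < e \<Longrightarrow> \<exists>x\<in>D. norm (x - y) < e"
  using dense_D2[of e y] by (auto simp: D2_def)

end

lemma norm_triangle3: "norm (a + b + c) \<le> norm a + norm b + norm (c :: 'a::real_normed_vector)"
  using norm_triangle_ineq[of "a + b" c] norm_triangle_ineq[of a b] by linarith

context m_dissipative
begin

text \<open>The backward Euler scheme with step \<open>2\<^sup>-\<^sup>k\<close>.\<close>

definition E :: "nat \<Rightarrow> real \<Rightarrow> 'a \<Rightarrow> 'a"
  where "E k t = J (1/2^k) ^^ nat \<lfloor>t * 2^k\<rfloor>"

definition T :: "real \<Rightarrow> 'a \<Rightarrow> 'a"
  where "T t y = lim (\<lambda>k. E k t y)"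

section \<open>Convergence of the Euler scheme\<close>

lemma nat_floor_bounds:
  fixes t :: real
  assumes "0 \<le> t"
  shows "real (nat \<lfloor>t * 2^k\<rfloor>) * (1/2^k) \<le> t" "t - 1/2^k \<le> real (nat \<lfloor>t * 2^k\<rfloor>) * (1/2^k)"
proof -
  have "real (nat \<lfloor>t * 2^k\<rfloor>) = of_int \<lfloor>t * 2^k\<rfloor>"
    using assms by simp
  moreover have "of_int \<lfloor>t * 2^k\<rfloor> \<le> t * 2^k" "t * 2^k - 1 \<le> of_int \<lfloor>t * 2^k\<rfloor>"
    by linarith+
  ultimately have "real (nat \<lfloor>t * 2^k\<rfloor>) * (1/2^k) \<le> t * 2^k * (1/2^k)"
      "(t * 2^k - 1) * (1/2^k) \<le> real (nat \<lfloor>t * 2^k\<rfloor>) * (1/2^k)"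
    by (simp_all only:) (intro mult_right_mono; simp)+
  then show "real (nat \<lfloor>t * 2^k\<rfloor>) * (1/2^k) \<le> t"
      "t - 1/2^k \<le> real (nat \<lfloor>t * 2^k\<rfloor>) * (1/2^k)"
    by (simp_all add: diff_divide_distrib)
qed

lemma E_norm: "norm (E k t x) \<le> norm x"
  by (simp add: E_def funpow_J_norm)

lemma E_linear: "linear (E k t)"
  by (simp add: E_def funpow_J_linear)

lemma E_dist: "norm (E k t x - E k t y) \<le> norm (x - y)"
  by (simp add: E_def funpow_J_dist)

text \<open>With \<open>h = 2^-k\<close>, time \<open>t\<close> consists of \<open>n\<close> full
  steps and of \<open>2 n\<close> or \<open>2 n + 1\<close> half steps. The even case is
  \<open>funpow_J_half\<close> with \<open>n h \<le> t\<close>; an odd extra half step costs at most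
  \<open>h/2 * norm (B y)\<close>. The bound is summable in \<open>k\<close>.\<close>

lemma E_refine:
  assumes "y \<in> D2" "0 \<le> t"
  shows "norm (E (Suc k) t y - E k t y) \<le> (t / 4 * norm (B (B y)) + norm (B y)) / 2^k"
proof -
  define h :: real where "h = 1/2^k"
  define n m where "n = nat \<lfloor>t * 2^k\<rfloor>" and "m = nat \<lfloor>t * 2^Suc k\<rfloor>"
  have h: "0 < h" "0 < h/2"
    by (simp_all add: h_def)
  have nh: "real n * h \<le> t"
    using nat_floor_bounds[OF assms(2)] by (simp add: n_def h_def)
  have "real n * (h\<^sup>2/4 * norm (B (B y))) = (real n * h) * (h / 4 * norm (B (B y)))"
    by (simp add: power2_eq_square)
  also have "\<dots> \<le> t * (h / 4 * norm (B (B y)))"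
    using h by (intro mult_right_mono nh) auto
  finally have "real n * (h\<^sup>2/4 * norm (B (B y))) \<le> t * (h / 4 * norm (B (B y)))" .
  from order_trans[OF funpow_J_half[OF h(1) assms(1)] this]
  have even: "norm ((J (h/2) ^^ (2*n)) y - (J h ^^ n) y) \<le> t * (h / 4 * norm (B (B y)))" .
  have By: "0 \<le> h * norm (B y)"
    using h by simp
  have "\<lfloor>t * 2^Suc k\<rfloor> = 2 * \<lfloor>t * 2^k\<rfloor> \<or> \<lfloor>t * 2^Suc k\<rfloor> = 2 * \<lfloor>t * 2^k\<rfloor> + 1"
  proof -
    have "\<lfloor>t * 2^Suc k\<rfloor> < 2 * \<lfloor>t * 2^k\<rfloor> + 2" "2 * \<lfloor>t * 2^k\<rfloor> \<le> \<lfloor>t * 2^Suc k\<rfloor>"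
      unfolding floor_less_iff le_floor_iff by (simp_all; linarith)+
    then show ?thesis
      by linarith
  qed
  moreover have "0 \<le> \<lfloor>t * 2^k\<rfloor>"
    using assms(2) by simp
  ultimately have "m = 2 * n \<or> m = 2 * n + 1"
    unfolding m_def n_def by linarith
  then have "norm ((J (h/2) ^^ m) y - (J h ^^ n) y) \<le> h * norm (B y) + t * (h / 4 * norm (B (B y)))"
  proof
    assume "m = 2 * n"
    then show ?thesis
      using even By by simp
  next
    assume "m = 2 * n + 1"
    then have m: "(J (h/2) ^^ m) y = (J (h/2) ^^ (2*n)) (J (h/2) y)"
      by (simp add: funpow_swap1)
    have "norm ((J (h/2) ^^ (2*n)) (J (h/2) y) - (J (h/2) ^^ (2*n)) y) \<le> h / 2 * norm (B y)"
      using order_trans[OF funpow_J_dist[OF h(2)] J_step[OF h(2)]] assms(1) by (simp add: D2_def)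
    then show ?thesis
      using norm_triangle_ineq[of "(J (h/2) ^^ m) y - (J (h/2) ^^ (2*n)) y"
          "(J (h/2) ^^ (2*n)) y - (J h ^^ n) y"] even By unfolding m by simp
  qed
  then show ?thesis
    by (simp add: E_def h_def n_def m_def field_simps)
qed

lemma E_convergent_D2:
  assumes "y \<in> D2" "0 \<le> t"
  shows "convergent (\<lambda>k. E k t y)"
proof -
  let ?c = "t / 4 * norm (B (B y)) + norm (B y)"
  have "summable (\<lambda>k. ?c * (1/2)^k)"
    by (intro summable_mult summable_geometric) simp
  then have "summable (\<lambda>k. E (Suc k) t y - E k t y)"
    by (rule summable_comparison_test'[where N = 0])
      (use E_refine[OF assms] in \<open>simp add: power_one_over\<close>)
  then have "convergent (\<lambda>n. \<Sum>k<n. E (Suc k) t y - E k t y)"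
    by (simp add: summable_iff_convergent)
  then have "convergent (\<lambda>n. (\<Sum>k<n. E (Suc k) t y - E k t y) + E 0 t y)"
    by (intro convergent_add convergent_const)
  then show ?thesis
    unfolding sum_lessThan_telescope[of "\<lambda>k. E k t y"] by simp
qed

text \<open>Convergence on the dense set \<open>D2\<close> extends to all vectors because the
  \<open>E k t\<close> are contractions, uniformly in \<open>k\<close>.\<close>

lemma E_tendsto:
  assumes "0 \<le> t"
  shows "(\<lambda>k. E k t y) \<longlonglongrightarrow> T t y"
proof -
  have "Cauchy (\<lambda>k. E k t y)"
  proof (rule metric_CauchyI)
    fix e :: real assume "0 < e"
    then obtain x where x: "x \<in> D2" "norm (x - y) < e/3"
      using dense_D2[of "e/3" y] by auto
    have "Cauchy (\<lambda>k. E k t x)"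
      by (intro convergent_Cauchy E_convergent_D2 x assms)
    then obtain M where M: "\<And>m n. m \<ge> M \<Longrightarrow> n \<ge> M \<Longrightarrow> norm (E m t x - E n t x) < e/3"
      using \<open>0 < e\<close> by (metis CauchyD divide_pos_pos zero_less_numeral)
    have "norm (E m t y - E n t y) < e" if "m \<ge> M" "n \<ge> M" for m n
    proof -
      have "E m t y - E n t y = (E m t y - E m t x) + (E m t x - E n t x) + (E n t x - E n t y)"
        by simp
      then have "norm (E m t y - E n t y)
          \<le> norm (E m t y - E m t x) + norm (E m t x - E n t x) + norm (E n t x - E n t y)"
        by (simp only: norm_triangle3)
      then show ?thesis
        using M[OF that] x(2) E_dist[of m t y x] E_dist[of n t x y]
        by (simp add: norm_minus_commute)
    qed
    then show "\<exists>M. \<forall>m\<ge>M. \<forall>n\<ge>M. dist (E m t y) (E n t y) < e"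
      by (auto simp: dist_norm)
  qed
  then show ?thesis
    unfolding T_def by (simp add: Cauchy_convergent_iff convergent_LIMSEQ_iff)
qed

lemma T_norm: "0 \<le> t \<Longrightarrow> norm (T t x) \<le> norm x"
  using E_norm by (intro LIMSEQ_le_const2[OF tendsto_norm[OF E_tendsto]]) auto

lemma T_bounded_linear:
  assumes "0 \<le> t"
  shows "bounded_linear (T t)"
proof (rule bounded_linear_intro[where K = 1])
  show "T t (x + y) = T t x + T t y" for x y
    using tendsto_add[OF E_tendsto[OF assms, of x] E_tendsto[OF assms, of y]]
    by (intro LIMSEQ_unique[OF E_tendsto[OF assms]]) (simp add: linear_add[OF E_linear])
  show "T t (r *\<^sub>R x) = r *\<^sub>R T t x" for r x
    using tendsto_scaleR[OF tendsto_const E_tendsto[OF assms, of x], of r]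
    by (intro LIMSEQ_unique[OF E_tendsto[OF assms]]) (simp add: linear_scale[OF E_linear])
qed (use T_norm[OF assms] in simp)

section \<open>Commutation, semigroup law and strong continuity\<close>

lemma T_zero: "T 0 x = x"
  by (rule LIMSEQ_unique[OF E_tendsto]) (simp_all add: E_def)

text \<open>\<open>C\<close> carries the equation of a resolvent step for \<open>x\<close> to the
  one for \<open>C x\<close>, so it commutes with \<open>J\<close>, with the powers of
  \<open>J\<close> and with their limit.\<close>

lemma T_commute:
  assumes C: "bounded_linear C" and "\<And>x. x \<in> D \<Longrightarrow> C x \<in> D" "\<And>x. x \<in> D \<Longrightarrow> B (C x) = C (B x)"
    and t: "0 \<le> t"
  shows "T t (C x) = C (T t x)"
proof -
  interpret C: bounded_linear C
    by fact
  have J: "J h (C x) = C (J h x)" if "0 < h" for h x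
    using that assms by (intro J_unique) (auto simp: J_in J_eq simp flip: C.scaleR C.diff)
  have "(J h ^^ n) (C x) = C ((J h ^^ n) x)" if "0 < h" for h n x
    by (induction n) (auto simp: J that)
  then have "E k t (C x) = C (E k t x)" for k
    by (simp add: E_def)
  then show ?thesis
    using C.tendsto[OF E_tendsto[OF t, of x]] LIMSEQ_unique[OF E_tendsto[OF t, of "C x"]] by simp
qed

text \<open>The step counts for \<open>s\<close> and \<open>t\<close> add up to the count for
  \<open>s + t\<close> or fall short of it by one, and a single step of length \<open>2^-k\<close>
  tends to the identity by \<open>J_tendsto\<close>.\<close>

lemma T_add:
  assumes "0 \<le> s" "0 \<le> t"
  shows "T (s + t) x = T s (T t x)"
proof -
  have split: "norm (E k (s + t) x - E k s (E k t x)) \<le> norm (J (1/2^k) x - x)" for k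
  proof -
    define n m l where "n = nat \<lfloor>s * 2^k\<rfloor>" and "m = nat \<lfloor>t * 2^k\<rfloor>" and "l = nat \<lfloor>(s + t) * 2^k\<rfloor>"
    have "\<lfloor>s * 2^k + t * 2^k\<rfloor> = \<lfloor>s * 2^k\<rfloor> + \<lfloor>t * 2^k\<rfloor>
        \<or> \<lfloor>s * 2^k + t * 2^k\<rfloor> = \<lfloor>s * 2^k\<rfloor> + \<lfloor>t * 2^k\<rfloor> + 1"
    proof -
      have "\<lfloor>s * 2^k + t * 2^k\<rfloor> < \<lfloor>s * 2^k\<rfloor> + \<lfloor>t * 2^k\<rfloor> + 2"
          "\<lfloor>s * 2^k\<rfloor> + \<lfloor>t * 2^k\<rfloor> \<le> \<lfloor>s * 2^k + t * 2^k\<rfloor>"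
        unfolding floor_less_iff le_floor_iff by (simp_all; linarith)+
      then show ?thesis
        by linarith
    qed
    moreover have "0 \<le> \<lfloor>s * 2^k\<rfloor>" "0 \<le> \<lfloor>t * 2^k\<rfloor>"
      using assms by auto
    ultimately have "l = n + m \<or> l = n + m + 1"
      unfolding l_def m_def n_def distrib_right by linarith
    then have "norm ((J (1/2^k) ^^ l) x - (J (1/2^k) ^^ (n + m)) x) \<le> norm (J (1/2^k) x - x)"
      using funpow_J_dist[of "1/2^k" "n + m" "J (1/2^k) x" x] by (auto simp: funpow_swap1)
    then show ?thesis
      by (simp add: E_def n_def m_def l_def funpow_add)
  qed
  have 1: "(\<lambda>k. E k (s + t) x - E k s (E k t x)) \<longlonglongrightarrow> 0"
    by (rule Lim_null_comparison[OF always_eventually tendsto_norm_zero[OF LIM_zero[OF J_tendsto]]])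
      (use split in blast)
  \<comment> \<open>Contractivity of \<open>E k s\<close>, uniform in \<open>k\<close>, permits
    replacing the moving argument \<open>E k t x\<close> by its limit.\<close>
  have 2: "(\<lambda>k. E k s (E k t x) - E k s (T t x)) \<longlonglongrightarrow> 0"
    by (rule Lim_null_comparison[OF always_eventually tendsto_norm_zero[OF LIM_zero[OF E_tendsto[OF assms(2)]]]])
      (use E_dist in blast)
  have "(\<lambda>k. (E k (s + t) x - E k s (E k t x)) + (E k s (E k t x) - E k s (T t x)) + E k s (T t x))
      \<longlonglongrightarrow> 0 + 0 + T s (T t x)"
    by (intro tendsto_add 1 2 E_tendsto assms)
  then show ?thesis
    using assms by (intro LIMSEQ_unique[OF E_tendsto]) auto
qed

lemma T_step:
  assumes "x \<in> D" "0 \<le> t"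
  shows "norm (T t x - x) \<le> t * norm (B x)"
proof (rule LIMSEQ_le_const2)
  show "(\<lambda>k. norm (E k t x - x)) \<longlonglongrightarrow> norm (T t x - x)"
    by (intro tendsto_intros E_tendsto assms)
  have "norm (E k t x - x) \<le> t * norm (B x)" for k
  proof -
    have "norm (E k t x - x) \<le> real (nat \<lfloor>t * 2^k\<rfloor>) * (1/2^k) * norm (B x)"
      unfolding E_def by (intro funpow_J_steps assms) simp
    also have "\<dots> \<le> t * norm (B x)"
      by (intro mult_right_mono nat_floor_bounds assms) simp
    finally show ?thesis .
  qed
  then show "\<exists>N. \<forall>k\<ge>N. norm (E k t x - x) \<le> t * norm (B x)"
    by auto
qed

lemma T_dist_time:
  assumes "0 \<le> s" "0 \<le> t"
  shows "norm (T s x - T t x) \<le> norm (T \<bar>s - t\<bar> x - x)"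
proof -
  have *: "norm (T s x - T t x) \<le> norm (T (s - t) x - x)" if "0 \<le> t" "t \<le> s" for s t
  proof -
    have "T s x - T t x = T t (T (s - t) x - x)"
      using T_add[of t "s - t" x] that T_bounded_linear[of t] by (simp add: linear_simps)
    then show ?thesis
      using T_norm[of t] that by simp
  qed
  show ?thesis
    using *[of t s] *[of s t] assms by (cases "s \<le> t") (auto simp: norm_minus_commute)
qed

text \<open>\<open>T_dist_time\<close> reduces two times to their distance from 0; there
  \<open>T_step\<close> gives the bound on \<open>D\<close>, and density with contractivity carries
  continuity over to \<open>x\<close>.\<close>

lemma T_continuous: "continuous_on {0..} (\<lambda>t. T t x)"
  unfolding continuous_on_iff
proof (intro ballI allI impI)
  fix t e :: real assume t: "t \<in> {0..}" and "0 < e"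
  then obtain y where y: "y \<in> D" "norm (y - x) < e/3"
    using dense_D[of "e/3" x] by auto
  \<comment> \<open>The summand 1 keeps the divisor positive when \<open>B y\<close>
    vanishes.\<close>
  define N where "N = norm (B y) + 1"
  have pos: "0 < N" "norm (B y) \<le> N"
    unfolding N_def by (auto intro: add_nonneg_pos)
  define d where "d = e / 3 / N"
  have "0 < d"
    unfolding d_def using \<open>0 < e\<close> pos by simp
  moreover have "dist (T s x) (T t x) < e" if s: "s \<in> {0..}" "dist s t < d" for s
  proof -
    let ?r = "\<bar>s - t\<bar>"
    have "norm (T ?r y - y) \<le> ?r * norm (B y)"
      by (intro T_step y) simp
    also have "\<dots> \<le> d * N"
      using s(2) pos by (intro mult_mono) (auto simp: dist_real_def)
    also have "\<dots> = e/3"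
      unfolding d_def using pos by simp
    finally have 1: "norm (T ?r y - y) \<le> e/3" .
    have "T ?r x - x = T ?r (x - y) + (T ?r y - y) + (y - x)"
      using T_bounded_linear[of ?r] by (simp add: linear_simps)
    then have "norm (T ?r x - x) \<le> norm (T ?r (x - y)) + norm (T ?r y - y) + norm (y - x)"
      by (simp only: norm_triangle3)
    moreover have "norm (T ?r (x - y)) \<le> norm (x - y)"
      by (intro T_norm) simp
    ultimately have "norm (T ?r x - x) < e"
      using 1 y(2) by (simp add: norm_minus_commute)
    then show ?thesis
      using T_dist_time[of s t x] s t by (simp add: dist_norm)
  qed
  ultimately show "\<exists>d>0. \<forall>s\<in>{0..}. dist s t < d \<longrightarrow> dist (T s x) (T t x) < e"
    by blast
qed

section \<open>Identification of the generator\<close>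

text \<open>Each step adds \<open>h\<close> times an Euler iterate of \<open>B x\<close>, which has
  to be compared with \<open>h B x\<close>. Since \<open>B x\<close> may lie outside
  \<open>D\<close>, an arbitrary \<open>z\<close> in \<open>D\<close> stands in for it: the iterates
  move \<open>z\<close> by at most \<open>n h norm (B z)\<close>, and the exchange costs
  \<open>norm (B x - z)\<close> twice.\<close>

lemma funpow_J_Taylor:
  assumes h: "0 < h" and "x \<in> D" "z \<in> D"
  shows "norm ((J h ^^ n) x - x - (real n * h) *\<^sub>R B x)
    \<le> (real n * h) * (2 * norm (B x - z) + (real n * h) * norm (B z))"
proof (induction n)
  case (Suc n)
  let ?P = "\<lambda>n. J h ^^ n" and ?a = "2 * norm (B x - z)" and ?b = "norm (B z)"
  have "?P (Suc n) x - ?P n x = ?P n (J h x - x)"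
    by (simp add: linear_diff[OF funpow_J_linear[OF h]] funpow_swap1)
  also have "J h x - x = h *\<^sub>R J h (B x)"
    using scale_B_J[OF h, of x] J_B[OF h assms(2)] by simp
  also have "?P n (h *\<^sub>R J h (B x)) = h *\<^sub>R ?P (Suc n) (B x)"
    by (simp add: linear_scale[OF funpow_J_linear[OF h]] funpow_swap1)
  finally have 1: "?P (Suc n) x - x - (real (Suc n) * h) *\<^sub>R B x
      = (?P n x - x - (real n * h) *\<^sub>R B x) + h *\<^sub>R (?P (Suc n) (B x) - B x)"
    by (simp add: algebra_simps)
  have "?P (Suc n) (B x) - B x = (?P (Suc n) (B x) - ?P (Suc n) z) + (?P (Suc n) z - z) + (z - B x)"
    by simp
  then have "norm (?P (Suc n) (B x) - B x)
      \<le> norm (?P (Suc n) (B x) - ?P (Suc n) z) + norm (?P (Suc n) z - z) + norm (z - B x)"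
    by (simp only: norm_triangle3)
  also have "\<dots> \<le> ?a + real (Suc n) * h * ?b"
    using funpow_J_dist[OF h, of "Suc n" "B x" z] funpow_J_steps[OF h assms(3), of "Suc n"]
      norm_minus_commute[of z "B x"] by linarith
  finally have 2: "norm (?P (Suc n) (B x) - B x) \<le> ?a + real (Suc n) * h * ?b" .
  have "norm (?P (Suc n) x - x - (real (Suc n) * h) *\<^sub>R B x)
      \<le> norm (?P n x - x - (real n * h) *\<^sub>R B x) + norm (h *\<^sub>R (?P (Suc n) (B x) - B x))"
    unfolding 1 by (rule norm_triangle_ineq)
  also have "norm (h *\<^sub>R (?P (Suc n) (B x) - B x)) \<le> h * (?a + real (Suc n) * h * ?b)"
    using 2 h by simp
  also note Suc.IH
  also have "real n * h * (?a + real n * h * ?b) \<le> real n * h * (?a + real (Suc n) * h * ?b)"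
    using h by (intro mult_left_mono add_left_mono mult_right_mono) auto
  finally show ?case
    by (simp add: algebra_simps)
qed simp

lemma T_Taylor:
  assumes "x \<in> D" "z \<in> D" "0 \<le> t"
  shows "norm (T t x - x - t *\<^sub>R B x) \<le> t * (2 * norm (B x - z) + t * norm (B z))"
proof (rule LIMSEQ_le)
  let ?r = "\<lambda>k. real (nat \<lfloor>t * 2^k\<rfloor>) * (1/2^k)"
  have "(\<lambda>k. t - 1/2^k) \<longlonglongrightarrow> t - 0"
    by (intro tendsto_intros LIMSEQ_divide_realpow_zero) simp
  then have r: "?r \<longlonglongrightarrow> t"
    using nat_floor_bounds[OF assms(3)]
    by (intro real_tendsto_sandwich[of "\<lambda>k. t - 1/2^k" ?r _ "\<lambda>_. t"]) auto
  show "(\<lambda>k. norm (E k t x - x - ?r k *\<^sub>R B x)) \<longlonglongrightarrow> norm (T t x - x - t *\<^sub>R B x)"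
    by (intro tendsto_intros E_tendsto assms r)
  show "(\<lambda>k. ?r k * (2 * norm (B x - z) + ?r k * norm (B z)))
      \<longlonglongrightarrow> t * (2 * norm (B x - z) + t * norm (B z))"
    by (intro tendsto_intros r)
  show "\<exists>N. \<forall>k\<ge>N. norm (E k t x - x - ?r k *\<^sub>R B x) \<le> ?r k * (2 * norm (B x - z) + ?r k * norm (B z))"
    unfolding E_def using assms by (intro exI allI impI funpow_J_Taylor) auto
qed

text \<open>Divide \<open>T_Taylor\<close> by \<open>h\<close>; choose \<open>z\<close> close to
  \<open>B x\<close> first, and then \<open>h\<close> small depending on \<open>z\<close>.\<close>

lemma T_derivative:
  assumes "x \<in> D"
  shows "((\<lambda>h. (T h x - x) /\<^sub>R h) \<longlongrightarrow> B x) (at_right 0)"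
proof (rule tendstoI)
  fix e :: real assume "0 < e"
  then obtain z where z: "z \<in> D" "norm (z - B x) < e/4"
    using dense_D[of "e/4" "B x"] by auto
  define N where "N = norm (B z) + 1"
  have pos: "0 < N" "norm (B z) \<le> N"
    unfolding N_def by (auto intro: add_nonneg_pos)
  define d where "d = e / 2 / N"
  have "0 < d"
    unfolding d_def using \<open>0 < e\<close> pos by simp
  have "dist ((T h x - x) /\<^sub>R h) (B x) < e" if "0 < h" "h < d" for h
  proof -
    have "norm ((T h x - x) /\<^sub>R h - B x) = norm (T h x - x - h *\<^sub>R B x) / h"
    proof -
      have "(T h x - x) /\<^sub>R h - B x = (T h x - x - h *\<^sub>R B x) /\<^sub>R h"
        using that by (simp add: scaleR_diff_right)
      then show ?thesis
        using that by (simp add: divide_inverse_commute)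
    qed
    also have "\<dots> \<le> 2 * norm (B x - z) + h * norm (B z)"
      using T_Taylor[OF assms z(1), of h] that by (simp add: pos_divide_le_eq mult.commute)
    also have "h * norm (B z) \<le> d * N"
      using that pos by (intro mult_mono) auto
    also have "\<dots> = e/2"
      unfolding d_def using pos by simp
    finally show ?thesis
      using z(2) by (simp add: dist_norm norm_minus_commute)
  qed
  then show "\<forall>\<^sub>F h in at_right 0. dist ((T h x - x) /\<^sub>R h) (B x) < e"
    using \<open>0 < d\<close> by (auto simp: eventually_at_right_field)
qed

text \<open>The generator is a dissipative extension of the maximal dissipative operator \<open>B\<close>.\<close>

lemma T_differentiable_imp_domain:
  assumes "((\<lambda>h. (T h x - x) /\<^sub>R h) \<longlongrightarrow> y) (at_right 0)"
  shows "x \<in> D"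
proof -
  \<comment> \<open>If \<open>y\<close> were \<open>B x\<close>, then \<open>x\<close> would solve
    the equation that defines \<open>u\<close>. The aim is therefore
    \<open>v = x - u = 0\<close>.\<close>
  obtain u where u: "u \<in> D" "u - 1 *\<^sub>R B u = x - y"
    using range[of 1 "x - y"] by auto
  define v where "v = x - u"
  have "((\<lambda>h. (T h x - x) /\<^sub>R h - (T h u - u) /\<^sub>R h) \<longlongrightarrow> y - B u) (at_right 0)"
    by (intro tendsto_diff assms T_derivative u)
  also have "y - B u = v"
    using u(2) by (simp add: v_def algebra_simps)
  finally have lim: "((\<lambda>h. ((T h x - x) /\<^sub>R h - (T h u - u) /\<^sub>R h) \<bullet> v) \<longlongrightarrow> v \<bullet> v) (at_right 0)"
    by (intro tendsto_inner tendsto_const)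
  \<comment> \<open>The difference is the quotient of \<open>v\<close>, and contractivity gives
    \<open>T h v \<bullet> v \<le> v \<bullet> v\<close>. Since the quotient tends to
    \<open>v\<close> itself, \<open>v \<bullet> v \<le> 0\<close> results.\<close>
  have "((T h x - x) /\<^sub>R h - (T h u - u) /\<^sub>R h) \<bullet> v \<le> 0" if "0 < h" for h
  proof -
    have "T h v \<bullet> v \<le> norm (T h v) * norm v"
      by (rule norm_cauchy_schwarz)
    also have "\<dots> \<le> norm v * norm v"
      using that by (intro mult_right_mono T_norm) auto
    finally have "(T h v - v) \<bullet> v \<le> 0"
      by (simp add: inner_diff_left norm_eq_sqrt_inner)
    moreover have "(T h x - x) /\<^sub>R h - (T h u - u) /\<^sub>R h = (T h v - v) /\<^sub>R h"
      using T_bounded_linear[of h] that by (simp add: v_def linear_simps algebra_simps)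
    ultimately show ?thesis
      using that by (simp add: mult_nonneg_nonpos)
  qed
  then have "\<forall>\<^sub>F h in at_right 0. ((T h x - x) /\<^sub>R h - (T h u - u) /\<^sub>R h) \<bullet> v \<le> 0"
    by (auto simp: eventually_at_right_field intro: exI[of _ 1])
  then have "v \<bullet> v \<le> 0"
    using tendsto_upperbound[OF lim] by simp
  then have "v = 0"
    by (metis inner_ge_zero inner_eq_zero_iff order_antisym)
  then show ?thesis
    using u by (simp add: v_def)
qed

end

text \<open>The contraction semigroup of \<open>A - w\<close> is multiplied by
  \<open>exp (w t)\<close>. The commutation property is part of the conclusion because it depends on
  how the semigroup arises from the resolvents.\<close>

theorem quasi_m_dissipative_generates:
  fixes D :: "'a::{complex_normed_vector,real_inner,banach} set"
  assumes D_zero: "0 \<in> D" and D_add: "\<And>x y. x \<in> D \<Longrightarrow> y \<in> D \<Longrightarrow> x + y \<in> D"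
    and D_scale: "\<And>c x. x \<in> D \<Longrightarrow> c *\<^sub>C x \<in> D"
    and A_add: "\<And>x y. x \<in> D \<Longrightarrow> y \<in> D \<Longrightarrow> A (x + y) = A x + A y"
    and A_scale: "\<And>c x. x \<in> D \<Longrightarrow> A (c *\<^sub>C x) = c *\<^sub>C A x"
    and dissipative: "\<And>x. x \<in> D \<Longrightarrow> A x \<bullet> x \<le> w * (norm x)\<^sup>2"
    and range: "\<And>l y. w < l \<Longrightarrow> \<exists>x\<in>D. l *\<^sub>R x - A x = y"
  obtains T where "generates D A T"
    and "\<And>C t x. \<lbrakk>bounded_linear C; \<And>x. x \<in> D \<Longrightarrow> C x \<in> D; \<And>x. x \<in> D \<Longrightarrow> A (C x) = C (A x); 0 \<le> t\<rbrakk>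
      \<Longrightarrow> T t (C x) = C (T t x)"
proof -
  let ?B = "\<lambda>x. A x - w *\<^sub>R x"
  interpret m_dissipative D ?B
  proof
    show "subspace D"
      using D_zero D_add D_scale by (simp add: subspace_def scaleR_eq_scaleC)
    show "?B (x + y) = ?B x + ?B y" if "x \<in> D" "y \<in> D" for x y
      using that by (simp add: A_add algebra_simps)
    show "?B (r *\<^sub>R x) = r *\<^sub>R ?B x" if "x \<in> D" for x r
      using A_scale[OF that, of "complex_of_real r"] by (simp add: scaleR_eq_scaleC[symmetric] algebra_simps)
    show "?B x \<bullet> x \<le> 0" if "x \<in> D" for x
      using dissipative[OF that] by (simp add: inner_diff_left power2_norm_eq_inner)
    show "\<exists>x\<in>D. x - h *\<^sub>R ?B x = y" if h: "0 < h" for h y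
    proof -
      \<comment> \<open>Divided by \<open>h\<close>, the equation for the shifted operator is the
        resolvent equation of \<open>A\<close> at \<open>1/h + w\<close>, which is above
        \<open>w\<close>.\<close>
      obtain x where x: "x \<in> D" "(inverse h + w) *\<^sub>R x - A x = inverse h *\<^sub>R y"
        using range[of "inverse h + w" "inverse h *\<^sub>R y"] h by auto
      then have "h *\<^sub>R ((inverse h + w) *\<^sub>R x - A x) = y"
        using h by simp
      then have "x - h *\<^sub>R ?B x = y"
        using h by (simp add: algebra_simps)
      then show ?thesis
        using x by blast
    qed
  qed
  define S where "S t x = exp (w * t) *\<^sub>R T t x" for t x
  have commute: "S t (C x) = C (S t x)"
    if C: "bounded_linear C" "\<And>x. x \<in> D \<Longrightarrow> C x \<in> D" "\<And>x. x \<in> D \<Longrightarrow> A (C x) = C (A x)" "0 \<le> t"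
    for C t x
  proof -
    interpret C: bounded_linear C
      by fact
    have "T t (C x) = C (T t x)"
      by (rule T_commute) (use C in \<open>auto simp: C.scaleR C.diff\<close>)
    then show ?thesis
      by (simp add: S_def C.scaleR)
  qed
  \<comment> \<open>Complex homogeneity of the semigroup will be its commutation with multiplication
    by \<open>c\<close>.\<close>
  have scaleC: "bounded_linear (\<lambda>x::'a. c *\<^sub>C x)" for c
    by (rule bounded_linear_intro[where K = "cmod c"])
      (auto simp: scaleC_add_right scaleR_eq_scaleC scaleC_scaleC norm_scaleC mult.commute)
  \<comment> \<open>An equivalence, so that the whole domain of the generator is transferred and not
    only its values on \<open>D\<close>.\<close>
  have derivative: "((\<lambda>h. (S h x - x) /\<^sub>R h) \<longlongrightarrow> y) (at_right 0)
      \<longleftrightarrow> ((\<lambda>h. (T h x - x) /\<^sub>R h) \<longlongrightarrow> y - w *\<^sub>R x) (at_right 0)" for x y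
  proof -
    have e: "((\<lambda>h. (exp (w * h) - 1) / h) \<longlongrightarrow> w) (at_right 0)"
    proof -
      have "((\<lambda>h. exp (w * h)) has_real_derivative w) (at 0)"
        by (auto intro!: derivative_eq_intros)
      then have "((\<lambda>h. (exp (w * h) - 1) / h) \<longlongrightarrow> w) (at 0)"
        by (simp add: DERIV_def)
      then show ?thesis
        by (rule tendsto_within_subset) simp
    qed
    have e1: "((\<lambda>h. exp (w * h)) \<longlongrightarrow> 1) (at_right 0)" "((\<lambda>h. exp (- w * h)) \<longlongrightarrow> 1) (at_right 0)"
      by (auto intro!: tendsto_eq_intros)
    have inv: "exp (- w * h) *\<^sub>R (exp (w * h) *\<^sub>R v) = v" for h and v :: 'a
      by (simp flip: exp_add)
    have S: "(S h x - x) /\<^sub>R h = exp (w * h) *\<^sub>R ((T h x - x) /\<^sub>R h) + ((exp (w * h) - 1) / h) *\<^sub>R x" for h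
      by (simp add: S_def algebra_simps divide_inverse)
    show ?thesis
    proof
      assume "((\<lambda>h. (T h x - x) /\<^sub>R h) \<longlongrightarrow> y - w *\<^sub>R x) (at_right 0)"
      then have "((\<lambda>h. (S h x - x) /\<^sub>R h) \<longlongrightarrow> 1 *\<^sub>R (y - w *\<^sub>R x) + w *\<^sub>R x) (at_right 0)"
        unfolding S by (intro tendsto_intros e e1)
      then show "((\<lambda>h. (S h x - x) /\<^sub>R h) \<longlongrightarrow> y) (at_right 0)"
        by simp
    next
      assume "((\<lambda>h. (S h x - x) /\<^sub>R h) \<longlongrightarrow> y) (at_right 0)"
      then have "((\<lambda>h. exp (- w * h) *\<^sub>R ((S h x - x) /\<^sub>R h - ((exp (w * h) - 1) / h) *\<^sub>R x))
          \<longlongrightarrow> 1 *\<^sub>R (y - w *\<^sub>R x)) (at_right 0)"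
        by (intro tendsto_intros e e1)
      then show "((\<lambda>h. (T h x - x) /\<^sub>R h) \<longlongrightarrow> y - w *\<^sub>R x) (at_right 0)"
        unfolding S add_diff_cancel_right' inv by simp
    qed
  qed
  have S_derivative: "((\<lambda>h. (S h x - x) /\<^sub>R h) \<longlongrightarrow> A x) (at_right 0)" if "x \<in> D" for x
    using T_derivative[OF that] by (simp add: derivative)
  have "generates D A S"
    unfolding generates_def
  proof (intro conjI ballI)
    show "c0_semigroup S"
      unfolding c0_semigroup_def
    proof (intro conjI allI impI)
      fix t :: real assume t: "0 \<le> t"
      have "bounded_linear (\<lambda>x. exp (w * t) *\<^sub>R T t x)"
        by (intro bounded_linear_compose[OF bounded_linear_scaleR_right] T_bounded_linear t)
      then show "bounded_clinear (S t)"
        unfolding bounded_clinear_def using commute[OF scaleC D_scale A_scale t]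
        by (auto simp: S_def[abs_def])
    next
      show "S 0 x = x" for x
        by (simp add: S_def T_zero)
    next
      fix s t :: real and x assume "0 \<le> s" "0 \<le> t"
      then show "S (s + t) x = S s (S t x)"
        using T_bounded_linear[of s] by (simp add: S_def T_add linear_simps distrib_left exp_add)
    next
      show "continuous_on {0..} (\<lambda>t. S t x)" for x
        unfolding S_def by (intro continuous_intros T_continuous)
    qed
    show "generator_domain S = D"
      unfolding generator_domain_def derivative
      using T_differentiable_imp_domain T_derivative
      by (auto intro: exI[of _ "A _"])
    show "generator S x = A x" if "x \<in> D" for x
      unfolding generator_def using S_derivative[OF that] by (intro tendsto_Lim) auto
  qed
  then show thesis
    using that commute by blast
qed

section \<open>The Hilbert space \<open>L\<^sup>2(0,1)\<close>\<close>

text \<open>Relates a class to each of its square integrable representatives, so that a continuous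
  one can be chosen; \<open>rep_L2\<close> would fix an arbitrary one.\<close>

lift_definition represents :: "(real \<Rightarrow> complex) \<Rightarrow> L2 \<Rightarrow> bool" is
  "\<lambda>f g. square_integrable f \<and> (AE x in I01. f x = g x)"
  by (auto elim: AE_conv2)

lemma represents_exists:
  obtains f where "represents f u"
proof -
  have "\<exists>f. represents f u"
    by transfer blast
  then show thesis
    using that by blast
qed

lemma represents_abs:
  assumes "square_integrable f"
  obtains u where "represents f u"
proof -
  have "represents f (abs_L2 f)"
    using assms by (simp add: represents.abs_eq)
  then show thesis
    by (rule that)
qed

lemma represents_square_integrable: "represents f u \<Longrightarrow> square_integrable f"
  by transfer simp

lemma represents_add: "represents f u \<Longrightarrow> represents g v \<Longrightarrow> represents (\<lambda>x. f x + g x) (u + v)"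
  by transfer (auto intro: square_integrable_add elim: AE_conv2)

lemma represents_scaleC: "represents f u \<Longrightarrow> represents (\<lambda>x. c * f x) (c *\<^sub>C u)"
  by transfer (auto intro: square_integrable_mult)

lemma represents_minus: "represents f u \<Longrightarrow> represents (\<lambda>x. - f x) (- u)"
  by transfer (use square_integrable_mult[of _ "-1"] in auto)

lemma represents_diff: "represents f u \<Longrightarrow> represents g v \<Longrightarrow> represents (\<lambda>x. f x - g x) (u - v)"
  using represents_add[of f u "\<lambda>x. - g x" "- v"] represents_minus[of g v] by simp

lemma represents_scaleR: "represents f u \<Longrightarrow> represents (\<lambda>x. complex_of_real r * f x) (r *\<^sub>R u)"
  using represents_scaleC[of f u "complex_of_real r"] by (simp add: scaleR_eq_scaleC)

lemma represents_AE_eq: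
  assumes "represents f u" "represents g v"
  shows "u = v \<longleftrightarrow> (AE x in I01. f x = g x)"
  using assms by transfer (auto elim: AE_conv2)

lemma represents_cong_AE:
  assumes "represents f u" "square_integrable g" "AE x in I01. f x = g x"
  shows "represents g u"
  using assms by transfer (auto elim: AE_conv2)

lemma represents_inner:
  assumes "represents f u" "represents g v"
  shows "u \<bullet> v = Re (LINT x|I01. f x * cnj (g x))"
  using assms
proof transfer
  fix f g f' g' :: "real \<Rightarrow> complex"
  assume f: "square_integrable f' \<and> square_integrable f' \<and> (AE x in I01. f' x = f' x)"
    and g: "square_integrable g' \<and> square_integrable g' \<and> (AE x in I01. g' x = g' x)"
    and ff': "square_integrable f \<and> (AE x in I01. f x = f' x)"
    and gg': "square_integrable g \<and> (AE x in I01. g x = g' x)"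
  have "(LINT x|I01. f' x * cnj (g' x)) = (LINT x|I01. f x * cnj (g x))"
  proof (rule integral_cong_AE)
    show "(\<lambda>x. f' x * cnj (g' x)) \<in> borel_measurable I01"
      using integrable_mult_cnj[of f' g'] f g by auto
    show "(\<lambda>x. f x * cnj (g x)) \<in> borel_measurable I01"
      using integrable_mult_cnj[of f g] ff' gg' by auto
    show "AE x in I01. f' x * cnj (g' x) = f x * cnj (g x)"
      using ff' gg' by (auto elim: AE_conv2)
  qed
  then show "Re (LINT x|I01. f' x * cnj (g' x)) = Re (LINT x|I01. f x * cnj (g x))"
    by simp
qed

lemma represents_norm:
  assumes "represents f u"
  shows "(norm u)\<^sup>2 = (LINT x|I01. (cmod (f x))\<^sup>2)"
proof -
  have "u \<bullet> u = Re (LINT x|I01. complex_of_real ((cmod (f x))\<^sup>2))"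
    unfolding represents_inner[OF assms assms] complex_norm_square ..
  then show ?thesis
    by (simp add: power2_norm_eq_inner del: of_real_power)
qed

section \<open>Completeness of the Hilbert space\<close>

lemma emeasure_I01: "emeasure I01 (space I01) = 1"
  by (simp add: emeasure_restrict_space)

interpretation I01: finite_measure I01
  by standard (simp only: emeasure_I01, simp)

text \<open>Takes the place of Cauchy-Schwarz in comparing the \<open>L1\<close> norm with the
  \<open>L2\<close> norm on an interval of length 1.\<close>

lemma norm_le_Young:
  fixes a e :: real
  assumes "0 < e"
  shows "a \<le> e / 2 + a\<^sup>2 / (2 * e)"
proof -
  have "2 * e * a \<le> e\<^sup>2 + a\<^sup>2"
    using sum_squares_bound[of e a] by simp
  then show ?thesis
    using assms by (simp add: field_simps power2_eq_square)
qed

lemma square_integrable_imp_integrable: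
  assumes "square_integrable f"
  shows "integrable I01 f"
proof (rule Bochner_Integration.integrable_bound)
  show "integrable I01 (\<lambda>x. 1 / 2 + (cmod (f x))\<^sup>2 / (2 * 1))"
    using assms by (auto simp: square_integrable_def)
  show "f \<in> borel_measurable I01"
    using assms by (simp add: square_integrable_def)
  show "AE x in I01. norm (f x) \<le> norm (1 / 2 + (cmod (f x))\<^sup>2 / (2 * 1))"
    using norm_le_Young[of 1 "cmod (f _)"] by (intro AE_I2) (simp add: order_trans[OF _ abs_ge_self])
qed

text \<open>Riesz-Fischer: an \<open>L2\<close> Cauchy sequence is Cauchy in \<open>L1\<close>, so a
  subsequence converges almost everywhere; Fatou's lemma shows that its limit is square integrable
  and the limit in norm of the whole sequence.\<close>

instance L2 :: complete_space
proof
  fix X :: "nat \<Rightarrow> L2" assume Cauchy: "Cauchy X"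
  have "\<forall>n. \<exists>f. represents f (X n)"
    by (metis represents_exists)
  then obtain s where s: "\<And>n. represents (s n) (X n)"
    by metis
  have sq: "square_integrable (s n)" for n
    using s by (rule represents_square_integrable)
  then have [measurable]: "s n \<in> borel_measurable I01" for n
    by (simp add: square_integrable_def)
  have sq_diff: "square_integrable (\<lambda>x. s i x - s j x)"
    and norm_diff: "(norm (X i - X j))\<^sup>2 = (LINT x|I01. (cmod (s i x - s j x))\<^sup>2)" for i j
    using represents_diff[OF s s] represents_square_integrable represents_norm by blast+
  have L1: "\<exists>N. \<forall>i\<ge>N. \<forall>j\<ge>N. (LINT x|I01. cmod (s i x - s j x)) < e" if "0 < e" for e
  proof -
    obtain N where N: "\<And>i j. i \<ge> N \<Longrightarrow> j \<ge> N \<Longrightarrow> norm (X i - X j) < e / 2"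
      using CauchyD[OF Cauchy, of "e/2"] \<open>0 < e\<close> by auto
    have "(LINT x|I01. cmod (s i x - s j x)) < e" if "i \<ge> N" "j \<ge> N" for i j
    proof -
      have e: "0 < e / 2"
        using \<open>0 < e\<close> by simp
      have int: "integrable I01 (\<lambda>x. (cmod (s i x - s j x))\<^sup>2)"
        using sq_diff by (simp add: square_integrable_def)
      have "(LINT x|I01. cmod (s i x - s j x))
          \<le> (LINT x|I01. e/2 / 2 + (cmod (s i x - s j x))\<^sup>2 / (2 * (e/2)))"
        using square_integrable_imp_integrable[OF sq_diff] int norm_le_Young[OF e]
        by (intro integral_mono) auto
      also have "\<dots> = e/2 / 2 + (norm (X i - X j))\<^sup>2 / (2 * (e/2))"
        using int by (simp add: norm_diff measure_def emeasure_I01[simplified])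
      also have "(norm (X i - X j))\<^sup>2 / (2 * (e/2)) \<le> (e/2)\<^sup>2 / (2 * (e/2))"
        using N[OF that] e by (intro divide_right_mono power_mono) auto
      also have "e/2 / 2 + (e/2)\<^sup>2 / (2 * (e/2)) < e"
        using e by (simp add: power2_eq_square)
      finally show ?thesis
        by simp
    qed
    then show ?thesis
      by blast
  qed
  obtain r where r: "strict_mono r" and AE_Cauchy: "AE x in I01. Cauchy (\<lambda>i. s (r i) x)"
    by (rule cauchy_L1_AE_cauchy_subseq[OF square_integrable_imp_integrable[OF sq] L1])
  define f where "f x = lim (\<lambda>i. s (r i) x)" for x
  have [measurable]: "f \<in> borel_measurable I01"
    unfolding f_def by measurable
  have AE_lim: "AE x in I01. (\<lambda>i. s (r i) x) \<longlonglongrightarrow> f x"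
    using AE_Cauchy unfolding f_def by eventually_elim (simp add: Cauchy_convergent_iff convergent_LIMSEQ_iff)
  \<comment> \<open>Stated with the nonnegative integral because \<open>f\<close> is not yet known
    to be square integrable; finiteness here is what will show it.\<close>
  have Fatou: "(\<integral>\<^sup>+x. ennreal ((cmod (f x - s n x))\<^sup>2) \<partial>I01) \<le> ennreal (e\<^sup>2)"
    if N: "\<And>i j. i \<ge> N \<Longrightarrow> j \<ge> N \<Longrightarrow> norm (X i - X j) < e" and n: "n \<ge> N" for n N e
  proof -
    have "(\<integral>\<^sup>+x. ennreal ((cmod (f x - s n x))\<^sup>2) \<partial>I01)
        = (\<integral>\<^sup>+x. liminf (\<lambda>i. ennreal ((cmod (s (r i) x - s n x))\<^sup>2)) \<partial>I01)"
    proof (rule nn_integral_cong_AE)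
      show "AE x in I01. ennreal ((cmod (f x - s n x))\<^sup>2)
          = liminf (\<lambda>i. ennreal ((cmod (s (r i) x - s n x))\<^sup>2))"
        using AE_lim
      proof eventually_elim
        case (elim x)
        then have "(\<lambda>i. ennreal ((cmod (s (r i) x - s n x))\<^sup>2)) \<longlonglongrightarrow> ennreal ((cmod (f x - s n x))\<^sup>2)"
          by (intro tendsto_ennrealI tendsto_intros)
        then show ?case
          by (rule lim_imp_Liminf[OF sequentially_bot, symmetric])
      qed
    qed
    also have "\<dots> \<le> liminf (\<lambda>i. \<integral>\<^sup>+x. ennreal ((cmod (s (r i) x - s n x))\<^sup>2) \<partial>I01)"
      by (intro nn_integral_liminf) measurable
    also have "\<dots> \<le> liminf (\<lambda>i::nat. ennreal (e\<^sup>2))"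
    proof (rule Liminf_mono, rule eventually_sequentiallyI)
      fix i assume "N \<le> i"
      then have i: "N \<le> r i"
        using seq_suble[OF r, of i] by simp
      have "(\<integral>\<^sup>+x. ennreal ((cmod (s (r i) x - s n x))\<^sup>2) \<partial>I01) = ennreal ((norm (X (r i) - X n))\<^sup>2)"
        unfolding norm_diff using sq_diff by (intro nn_integral_eq_integral) (auto simp: square_integrable_def)
      also have "\<dots> \<le> ennreal (e\<^sup>2)"
        using N[OF i n] by (intro ennreal_leI power_mono) auto
      finally show "(\<integral>\<^sup>+x. ennreal ((cmod (s (r i) x - s n x))\<^sup>2) \<partial>I01) \<le> ennreal (e\<^sup>2)" .
    qed
    also have "\<dots> = ennreal (e\<^sup>2)"
      by (simp add: Liminf_const)
    finally show ?thesis .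
  qed
  have sqf_diff: "square_integrable (\<lambda>x. f x - s n x)"
    if N: "\<And>i j. i \<ge> N \<Longrightarrow> j \<ge> N \<Longrightarrow> norm (X i - X j) < e" and n: "n \<ge> N" for n N e
    unfolding square_integrable_def
  proof
    show "integrable I01 (\<lambda>x. (cmod (f x - s n x))\<^sup>2)"
      using Fatou[OF that] by (intro integrableI_nonneg) (auto simp: le_less_trans)
  qed measurable
  obtain N where N: "\<And>i j. i \<ge> N \<Longrightarrow> j \<ge> N \<Longrightarrow> norm (X i - X j) < 1"
    using CauchyD[OF Cauchy, of 1] by auto
  have "square_integrable (\<lambda>x. (f x - s N x) + s N x)"
    by (rule square_integrable_add[OF sqf_diff[OF N order_refl] sq])
  then obtain u where u: "represents f u"
    using represents_abs by auto
  have "X \<longlonglongrightarrow> u"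
  proof (rule LIMSEQ_I)
    fix e :: real assume "0 < e"
    then obtain N where N: "\<And>i j. i \<ge> N \<Longrightarrow> j \<ge> N \<Longrightarrow> norm (X i - X j) < e / 2"
      using CauchyD[OF Cauchy, of "e/2"] by auto
    have "norm (X n - u) < e" if n: "n \<ge> N" for n
    proof -
      have "ennreal ((norm (u - X n))\<^sup>2) = (\<integral>\<^sup>+x. ennreal ((cmod (f x - s n x))\<^sup>2) \<partial>I01)"
        unfolding represents_norm[OF represents_diff[OF u s]]
        using sqf_diff[OF N n] by (intro nn_integral_eq_integral[symmetric]) (auto simp: square_integrable_def)
      also have "\<dots> \<le> ennreal ((e/2)\<^sup>2)"
        by (rule Fatou[OF N n])
      finally have "(norm (u - X n))\<^sup>2 \<le> (e/2)\<^sup>2"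
        by simp
      then have "norm (u - X n) \<le> e/2"
        by (rule power2_le_imp_le) (use \<open>0 < e\<close> in simp)
      then show ?thesis
        using \<open>0 < e\<close> by (simp add: norm_minus_commute)
    qed
    then show "\<exists>N. \<forall>n\<ge>N. norm (X n - u) < e"
      by blast
  qed
  then show "convergent X"
    by (auto simp: convergent_def)
qed

instance L2 :: banach ..

section \<open>Primitives of integrable functions\<close>

text \<open>Truncating the integrand rather than the domain gives a function on the whole line that
  is constant outside the unit interval.\<close>

definition primitive :: "(real \<Rightarrow> complex) \<Rightarrow> real \<Rightarrow> complex"
  where "primitive g x = (LINT t|I01. (if t \<le> x then g t else 0))"

lemma integrable_truncate:
  fixes g :: "real \<Rightarrow> complex"
  assumes "integrable I01 g"
  shows "integrable I01 (\<lambda>t. if t \<le> x then g t else 0)"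
proof (rule Bochner_Integration.integrable_bound[OF assms])
  have [measurable]: "g \<in> borel_measurable I01"
    using assms by auto
  have [measurable]: "Measurable.pred I01 (\<lambda>t. t \<le> x)"
    by (intro borel_measurable_le measurable_restrict_space1) (auto intro!: measurable_completion)
  show "(\<lambda>t. if t \<le> x then g t else 0) \<in> borel_measurable I01"
    by measurable
qed auto

lemma primitive_nonpos: "x \<le> 0 \<Longrightarrow> primitive g x = 0"
proof -
  assume "x \<le> 0"
  then have "primitive g x = (LINT t|I01. 0)"
    unfolding primitive_def by (intro Bochner_Integration.integral_cong) auto
  then show ?thesis
    by simp
qed

lemma primitive_0 [simp]: "primitive g 0 = 0"
  by (simp add: primitive_nonpos)

lemma primitive_cong:
  assumes "\<And>t. t \<in> {0<..<1} \<Longrightarrow> f t = g t"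
  shows "primitive f x = primitive g x"
  unfolding primitive_def using assms by (intro Bochner_Integration.integral_cong) auto

lemma primitive_ge_1:
  assumes "1 \<le> x"
  shows "primitive g x = (LINT t|I01. g t)"
  using assms unfolding primitive_def by (intro Bochner_Integration.integral_cong) auto

lemma primitive_add:
  assumes "integrable I01 f" "integrable I01 g"
  shows "primitive (\<lambda>t. f t + g t) x = primitive f x + primitive g x"
  unfolding primitive_def Bochner_Integration.integral_add[OF assms[THEN integrable_truncate], symmetric]
  by (intro Bochner_Integration.integral_cong) auto

lemma primitive_mult: "primitive (\<lambda>t. c * f t) x = c * primitive f x"
  unfolding primitive_def integral_mult_right_zero[symmetric]
  by (intro Bochner_Integration.integral_cong) auto

lemma primitive_cnj: "primitive (\<lambda>t. cnj (f t)) x = cnj (primitive f x)"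
  unfolding primitive_def Bochner_Integration.integral_cnj[symmetric]
  by (intro Bochner_Integration.integral_cong) auto

lemma primitive_norm_le:
  assumes "integrable I01 g"
  shows "cmod (primitive g x) \<le> (LINT t|I01. cmod (g t))"
proof -
  have "cmod (primitive g x) \<le> (LINT t|I01. cmod (if t \<le> x then g t else 0))"
    unfolding primitive_def by (rule integral_norm_bound)
  also have "\<dots> \<le> (LINT t|I01. cmod (g t))"
    using integrable_truncate[OF assms] assms by (intro integral_mono) auto
  finally show ?thesis .
qed

lemma AE_I01_neq: "AE t in I01. t \<noteq> x"
proof -
  have "AE t in lebesgue. t \<noteq> x"
    by (rule AE_completion) (rule AE_lborel_singleton)
  then show ?thesis
    by (simp add: AE_restrict_space_iff) (auto elim: eventually_mono)
qed

lemma primitive_continuous: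
  assumes "integrable I01 g"
  shows "continuous_on S (primitive g)"
proof (rule continuous_at_imp_continuous_on, rule ballI)
  fix x
  have [measurable]: "(\<lambda>t. if t \<le> y then g t else 0) \<in> borel_measurable I01" for y
    using integrable_truncate[OF assms] by auto
  show "isCont (primitive g) x"
    unfolding continuous_at_sequentially o_def
  proof (intro allI impI)
    fix y assume y: "y \<longlonglongrightarrow> x"
    show "(\<lambda>n. primitive g (y n)) \<longlonglongrightarrow> primitive g x"
      unfolding primitive_def
    proof (rule integral_dominated_convergence[where w = "\<lambda>t. cmod (g t)"])
      show "AE t in I01. (\<lambda>n. if t \<le> y n then g t else 0) \<longlonglongrightarrow> (if t \<le> x then g t else 0)"
        \<comment> \<open>The truncated integrands may fail to converge only at
          \<open>t = x\<close>, where the cut-off jumps.\<close>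
        using AE_I01_neq[of x]
      proof eventually_elim
        case (elim t)
        then have "\<forall>\<^sub>F n in sequentially. (t \<le> y n) = (t \<le> x)"
        proof (cases "t < x")
          case True
          from order_tendstoD(1)[OF y this] show ?thesis
            by eventually_elim (use True in auto)
        next
          case False
          with elim have "x < t"
            by simp
          from order_tendstoD(2)[OF y this] show ?thesis
            by eventually_elim (use \<open>x < t\<close> in auto)
        qed
        then have "\<forall>\<^sub>F n in sequentially. (if t \<le> y n then g t else 0) = (if t \<le> x then g t else 0)"
          by eventually_elim simp
        then show ?case
          by (rule tendsto_eventually)
      qed
    qed (use assms in auto)
  qed
qed

lemma measurable_I01_continuous:
  fixes f :: "real \<Rightarrow> complex"
  assumes "continuous_on {0..1} f"
  shows "f \<in> borel_measurable I01"
  by (intro continuous_imp_measurable_on_sets_lebesgue continuous_on_subset[OF assms]) auto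

lemma integrable_mult_bounded:
  fixes f h :: "real \<Rightarrow> complex"
  assumes "integrable I01 f" "h \<in> borel_measurable I01" "\<And>x. x \<in> {0<..<1} \<Longrightarrow> cmod (h x) \<le> C"
  shows "integrable I01 (\<lambda>x. f x * h x)"
proof (rule Bochner_Integration.integrable_bound[where f = "\<lambda>x. f x * complex_of_real C"])
  have "cmod (h x) \<le> \<bar>C\<bar>" if "x \<in> {0<..<1}" for x
    using assms(3)[OF that] by simp
  then show "AE x in I01. cmod (f x * h x) \<le> cmod (f x * complex_of_real C)"
    by (intro AE_I2) (auto simp: norm_mult intro!: mult_left_mono)
  have "f \<in> borel_measurable I01"
    using assms(1) by auto
  then show "(\<lambda>x. f x * h x) \<in> borel_measurable I01"
    using assms(2) by (rule borel_measurable_times)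
qed (use assms in auto)

lemma integrable_mult_primitive:
  assumes "integrable I01 f" "integrable I01 g"
  shows "integrable I01 (\<lambda>t. f t * primitive g t)"
  by (rule integrable_mult_bounded[OF assms(1) measurable_I01_continuous primitive_norm_le])
    (use assms in \<open>auto intro: primitive_continuous\<close>)

text \<open>Fubini's theorem on the two triangles below and above the diagonal.\<close>

lemma primitive_mult_primitive:
  assumes f: "integrable I01 f" and g: "integrable I01 g"
  shows "primitive f x * primitive g x = primitive (\<lambda>t. f t * primitive g t + primitive f t * g t) x"
proof -
  interpret pair_sigma_finite I01 I01
    by (simp add: pair_sigma_finite_def I01.sigma_finite_measure_axioms)
  define F G where "F t = (if t \<le> x then f t else 0)" and "G t = (if t \<le> x then g t else 0)" for t
  have F: "integrable I01 F" and G: "integrable I01 G"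
    unfolding F_def G_def by (rule integrable_truncate[OF f] integrable_truncate[OF g])+
  then have [measurable]: "F \<in> borel_measurable I01" "G \<in> borel_measurable I01"
    by auto
  have [measurable]: "(\<lambda>t. t) \<in> borel_measurable I01"
    by (intro measurable_restrict_space1 measurable_completion) simp
  \<comment> \<open>The product on one triangle, both factors cut off at \<open>x\<close>.
    Integrating first in \<open>s\<close> gives \<open>primitive f t * G t\<close>; integrating
    first in \<open>t\<close> gives the whole square minus the other triangle.\<close>
  define H where "H s t = (if s < t then F s * G t else 0)" for s t
  have [measurable]: "(\<lambda>(s, t). H s t) \<in> borel_measurable (I01 \<Otimes>\<^sub>M I01)"
    unfolding H_def by measurable
  have Ht: "integrable I01 (\<lambda>t. H s t)" for s
  proof (rule Bochner_Integration.integrable_bound[where f = "\<lambda>t. F s * G t"])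
    show "(\<lambda>t. H s t) \<in> borel_measurable I01"
      unfolding H_def by measurable
  qed (use G in \<open>auto simp: H_def\<close>)
  have Hs: "integrable I01 (\<lambda>s. H s t)" for t
  proof (rule Bochner_Integration.integrable_bound[where f = "\<lambda>s. F s * G t"])
    show "(\<lambda>s. H s t) \<in> borel_measurable I01"
      unfolding H_def by measurable
  qed (use F in \<open>auto simp: H_def\<close>)
  have "integrable (I01 \<Otimes>\<^sub>M I01) (\<lambda>(s, t). H s t)"
  proof (rule Fubini_integrable)
    show "integrable I01 (\<lambda>s. LINT t|I01. norm (case (s, t) of (s, t) \<Rightarrow> H s t))"
    proof (rule Bochner_Integration.integrable_bound[where f = "\<lambda>s. cmod (F s) * (LINT t|I01. cmod (G t))"])
      show "AE s in I01. norm (LINT t|I01. norm (case (s, t) of (s, t) \<Rightarrow> H s t))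
          \<le> norm (cmod (F s) * (LINT t|I01. cmod (G t)))"
      proof (rule AE_I2)
        fix s
        have "(LINT t|I01. cmod (H s t)) \<le> (LINT t|I01. cmod (F s) * cmod (G t))"
          using Ht G by (intro integral_mono) (auto simp: H_def norm_mult)
        then show "norm (LINT t|I01. norm (case (s, t) of (s, t) \<Rightarrow> H s t))
            \<le> norm (cmod (F s) * (LINT t|I01. cmod (G t)))"
          by (simp add: abs_mult)
      qed
    qed (use F in \<open>auto simp: H_def\<close>)
  qed (use Ht in auto)
  then have swap: "(LINT t|I01. LINT s|I01. H s t) = (LINT s|I01. LINT t|I01. H s t)"
    by (rule Fubini_integral)
  have inner1: "(LINT s|I01. H s t) = primitive f t * G t" for t
  proof -
    have "(LINT s|I01. H s t) = (LINT s|I01. (if s \<le> t then f s else 0) * G t)"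
    proof (rule integral_cong_AE)
      \<comment> \<open>\<open>H\<close> excludes the diagonal, \<open>primitive\<close> includes
        it; for fixed \<open>t\<close> that is a single point.\<close>
      show "AE s in I01. H s t = (if s \<le> t then f s else 0) * G t"
        using AE_I01_neq[of t] by eventually_elim (auto simp: H_def F_def G_def)
    qed (use Hs integrable_truncate[OF f] in auto)
    then show ?thesis
      by (simp add: primitive_def)
  qed
  have inner2: "(LINT t|I01. H s t) = F s * primitive g x - F s * primitive g s" for s
  proof -
    \<comment> \<open>\<open>F s\<close> vanishes unless \<open>s \<le> x\<close>, and then
      \<open>t \<le> s\<close> implies \<open>G t = g t\<close>; so the subtracted term may use
      \<open>g\<close> without its cut-off.\<close>
    have "(LINT t|I01. H s t) = (LINT t|I01. F s * G t - F s * (if t \<le> s then g t else 0))"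
      by (intro Bochner_Integration.integral_cong) (auto simp: H_def F_def G_def)
    also have "\<dots> = F s * (LINT t|I01. G t) - F s * primitive g s"
      unfolding primitive_def using G integrable_truncate[OF g, of s] by simp
    finally show ?thesis
      by (simp add: G_def primitive_def)
  qed
  have int1: "integrable I01 (\<lambda>t. F t * primitive g t)"
    by (intro integrable_mult_primitive F g)
  have int2: "integrable I01 (\<lambda>t. primitive f t * G t)"
    using integrable_mult_primitive[OF G f] by (simp add: mult.commute)
  have "(LINT t|I01. primitive f t * G t) = (LINT s|I01. F s * primitive g x - F s * primitive g s)"
    using swap by (simp only: inner1 inner2)
  also have "\<dots> = primitive f x * primitive g x - (LINT s|I01. F s * primitive g s)"
    using F int1 by (simp add: primitive_def F_def[symmetric])
  finally have "primitive f x * primitive g x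
      = (LINT t|I01. F t * primitive g t + primitive f t * G t)"
    using int1 int2 by simp
  also have "\<dots> = primitive (\<lambda>t. f t * primitive g t + primitive f t * g t) x"
    unfolding primitive_def by (intro Bochner_Integration.integral_cong) (auto simp: F_def G_def)
  finally show ?thesis .
qed

lemma square_integrable_mult_bounded:
  assumes "square_integrable f" "h \<in> borel_measurable I01" "\<And>x. x \<in> {0<..<1} \<Longrightarrow> cmod (h x) \<le> C"
  shows "square_integrable (\<lambda>x. f x * h x)"
  unfolding square_integrable_def
proof
  have [measurable]: "f \<in> borel_measurable I01" "h \<in> borel_measurable I01"
    using assms by (auto simp: square_integrable_def)
  show "(\<lambda>x. f x * h x) \<in> borel_measurable I01"
    by measurable
  show "integrable I01 (\<lambda>x. (cmod (f x * h x))\<^sup>2)"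
  proof (rule Bochner_Integration.integrable_bound[where f = "\<lambda>x. (cmod (f x))\<^sup>2 * C\<^sup>2"])
    show "AE x in I01. norm ((cmod (f x * h x))\<^sup>2) \<le> norm ((cmod (f x))\<^sup>2 * C\<^sup>2)"
      using assms(3) by (intro AE_I2) (auto simp: norm_mult power_mult_distrib intro!: mult_left_mono power_mono)
  qed (use assms in \<open>auto simp: square_integrable_def\<close>)
qed

lemma continuous_bounded_unit:
  fixes f :: "real \<Rightarrow> complex"
  assumes "continuous_on {0..1} f"
  obtains C where "\<And>x. x \<in> {0<..<1} \<Longrightarrow> cmod (f x) \<le> C"
proof -
  have "bounded (f ` {0..1})"
    by (intro compact_imp_bounded compact_continuous_image assms) auto
  then obtain C where C: "\<forall>y\<in>f ` {0..1}. norm y \<le> C"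
    by (auto simp: bounded_iff)
  have "cmod (f x) \<le> C" if "x \<in> {0<..<1}" for x
    using C that by auto
  then show thesis
    by (rule that)
qed

lemma square_integrable_mult_continuous:
  assumes "square_integrable f" "continuous_on {0..1} h"
  shows "square_integrable (\<lambda>x. f x * h x)"
  using continuous_bounded_unit[OF assms(2)]
    square_integrable_mult_bounded[OF assms(1) measurable_I01_continuous[OF assms(2)]] by metis

lemma square_integrable_continuous:
  assumes "continuous_on {0..1} f"
  shows "square_integrable f"
  using square_integrable_mult_continuous[of "\<lambda>_. 1", OF _ assms]
  by (simp add: square_integrable_def)

section \<open>Absolutely continuous functions with square integrable derivative\<close>

text \<open>The concrete form of \<open>H1\<close>. An integral equation is used because
  \<open>g\<close> is meaningful only up to null sets; \<open>f\<close> is constrained on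
  \<open>[0,1]\<close> only.\<close>

definition antiderivative :: "(real \<Rightarrow> complex) \<Rightarrow> (real \<Rightarrow> complex) \<Rightarrow> bool"
  where "antiderivative f g \<longleftrightarrow>
    square_integrable g \<and> (\<forall>x\<in>{0..1}. f x = f 0 + primitive g x)"

lemma antiderivative_eq: "antiderivative f g \<Longrightarrow> x \<in> {0..1} \<Longrightarrow> f x = f 0 + primitive g x"
  unfolding antiderivative_def by blast

lemma antiderivative_integrable: "antiderivative f g \<Longrightarrow> integrable I01 g"
  by (simp add: antiderivative_def square_integrable_imp_integrable)

lemma antiderivative_continuous:
  assumes "antiderivative f g"
  shows "continuous_on {0..1} f"
proof -
  have "continuous_on {0..1} (\<lambda>x. f 0 + primitive g x)"
    by (intro continuous_intros primitive_continuous antiderivative_integrable[OF assms])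
  then show ?thesis
    by (rule continuous_on_eq) (rule antiderivative_eq[OF assms, symmetric])
qed

lemma antiderivative_square_integrable:
  assumes "antiderivative f g"
  shows "square_integrable f" "square_integrable g"
  using assms square_integrable_continuous[OF antiderivative_continuous[OF assms]]
  by (auto simp: antiderivative_def)

lemma antiderivative_primitive:
  assumes "square_integrable g"
  shows "antiderivative (\<lambda>x. c + primitive g x) g"
  using assms by (simp add: antiderivative_def)

lemma antiderivative_add:
  assumes "antiderivative f f'" "antiderivative g g'"
  shows "antiderivative (\<lambda>x. f x + g x) (\<lambda>x. f' x + g' x)"
  unfolding antiderivative_def
proof (intro conjI ballI)
  show "square_integrable (\<lambda>x. f' x + g' x)"
    using assms by (simp add: antiderivative_def square_integrable_add)
  fix x :: real assume "x \<in> {0..1}"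
  then have "f x = f 0 + primitive f' x" "g x = g 0 + primitive g' x"
    by (rule antiderivative_eq[OF assms(1)] antiderivative_eq[OF assms(2)])+
  then show "f x + g x = f 0 + g 0 + primitive (\<lambda>x. f' x + g' x) x"
    by (simp only: primitive_add[OF assms[THEN antiderivative_integrable]] add_ac)
qed

lemma antiderivative_mult:
  assumes "antiderivative f f'"
  shows "antiderivative (\<lambda>x. c * f x) (\<lambda>x. c * f' x)"
  unfolding antiderivative_def
proof (intro conjI ballI)
  show "square_integrable (\<lambda>x. c * f' x)"
    using assms by (simp add: antiderivative_def square_integrable_mult)
  fix x :: real assume "x \<in> {0..1}"
  then have "f x = f 0 + primitive f' x"
    by (rule antiderivative_eq[OF assms])
  then show "c * f x = c * f 0 + primitive (\<lambda>x. c * f' x) x"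
    by (simp only: primitive_mult distrib_left)
qed

lemma square_integrable_cnj: "square_integrable f \<Longrightarrow> square_integrable (\<lambda>x. cnj (f x))"
  unfolding square_integrable_def
  by (auto intro: measurable_compose[OF _ borel_measurable_continuous_onI] continuous_intros)

lemma antiderivative_cnj:
  assumes "antiderivative f f'"
  shows "antiderivative (\<lambda>x. cnj (f x)) (\<lambda>x. cnj (f' x))"
  unfolding antiderivative_def
proof (intro conjI ballI)
  show "square_integrable (\<lambda>x. cnj (f' x))"
    using assms by (simp add: antiderivative_def square_integrable_cnj)
  fix x :: real assume "x \<in> {0..1}"
  then have "f x = f 0 + primitive f' x"
    by (rule antiderivative_eq[OF assms])
  then show "cnj (f x) = cnj (f 0) + primitive (\<lambda>x. cnj (f' x)) x"
    by (simp only: primitive_cnj complex_cnj_add)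
qed

text \<open>Write both functions as initial value plus primitive: the mixed terms are linear, and
  the product of the primitives is \<open>primitive_mult_primitive\<close>.\<close>

lemma antiderivative_product:
  assumes f: "antiderivative f f'" and g: "antiderivative g g'"
  shows "antiderivative (\<lambda>x. f x * g x) (\<lambda>x. f' x * g x + f x * g' x)"
  unfolding antiderivative_def
proof
  show "square_integrable (\<lambda>x. f' x * g x + f x * g' x)"
    using square_integrable_mult_continuous[OF antiderivative_square_integrable(2)[OF f] antiderivative_continuous[OF g]]
      square_integrable_mult_continuous[OF antiderivative_square_integrable(2)[OF g] antiderivative_continuous[OF f]]
    by (simp add: square_integrable_add mult.commute)
  show "\<forall>x\<in>{0..1}. f x * g x = f 0 * g 0 + primitive (\<lambda>x. f' x * g x + f x * g' x) x"
  proof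
    fix x :: real assume x: "x \<in> {0..1}"
    note f' = antiderivative_integrable[OF f] and g' = antiderivative_integrable[OF g]
    let ?F = "primitive f'" and ?G = "primitive g'"
    have FG: "integrable I01 (\<lambda>t. f' t * ?G t)" "integrable I01 (\<lambda>t. ?F t * g' t)"
      using integrable_mult_primitive[OF f' g'] integrable_mult_primitive[OF g' f']
      by (simp_all add: mult.commute)
    have "primitive (\<lambda>x. f' x * g x + f x * g' x) x
        = primitive (\<lambda>t. (g 0 * f' t + f 0 * g' t) + (f' t * ?G t + ?F t * g' t)) x"
    proof (rule primitive_cong)
      fix t :: real assume "t \<in> {0<..<1}"
      then have t: "t \<in> {0..1}"
        by simp
      have "f t = f 0 + ?F t" "g t = g 0 + ?G t"
        by (rule antiderivative_eq[OF f t] antiderivative_eq[OF g t])+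
      then show "f' t * g t + f t * g' t = (g 0 * f' t + f 0 * g' t) + (f' t * ?G t + ?F t * g' t)"
        by (simp only:) (simp add: algebra_simps)
    qed
    also have "\<dots> = (g 0 * ?F x + f 0 * ?G x) + ?F x * ?G x"
      using f' g' FG by (simp add: primitive_add primitive_mult primitive_mult_primitive[OF f' g'])
    also have "\<dots> = f x * g x - f 0 * g 0"
    proof -
      have "f x = f 0 + ?F x" "g x = g 0 + ?G x"
        by (rule antiderivative_eq[OF f x] antiderivative_eq[OF g x])+
      then show ?thesis
        by (simp only:) (simp add: algebra_simps)
    qed
    finally show "f x * g x = f 0 * g 0 + primitive (\<lambda>x. f' x * g x + f x * g' x) x"
      by simp
  qed
qed

lemma integral_by_parts:
  assumes "antiderivative f f'" "antiderivative g g'"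
  shows "(LINT x|I01. f' x * g x) + (LINT x|I01. f x * g' x) = f 1 * g 1 - f 0 * g 0"
proof -
  note f' = antiderivative_square_integrable[OF assms(1)]
    and g' = antiderivative_square_integrable[OF assms(2)]
  have "integrable I01 (\<lambda>x. f' x * g x)" "integrable I01 (\<lambda>x. f x * g' x)"
    using integrable_mult_cnj[OF f'(2) square_integrable_cnj[OF g'(1)]]
      integrable_mult_cnj[OF f'(1) square_integrable_cnj[OF g'(2)]] by simp_all
  moreover have "f 1 * g 1 = f 0 * g 0 + primitive (\<lambda>x. f' x * g x + f x * g' x) 1"
    using antiderivative_eq[OF antiderivative_product[OF assms], of 1] by simp
  ultimately show ?thesis
    by (simp add: primitive_ge_1)
qed

lemma antiderivative_C1:
  assumes "\<And>x. x \<in> {0..1} \<Longrightarrow> (f has_vector_derivative f' x) (at x)" "continuous_on {0..1} f'"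
  shows "antiderivative f f'"
  unfolding antiderivative_def
proof (intro conjI ballI)
  show "square_integrable f'"
    by (rule square_integrable_continuous[OF assms(2)])
  then have int: "integrable I01 f'"
    by (rule square_integrable_imp_integrable)
  fix x :: real assume x: "x \<in> {0..1}"
  have "primitive f' x = integral {0<..<1} (\<lambda>t. if t \<le> x then f' t else 0)"
    unfolding primitive_def by (intro lebesgue_integral_eq_integral integrable_truncate int) auto
  also have "\<dots> = integral {0..1} (\<lambda>t. if t \<le> x then f' t else 0)"
    by (simp add: integral_open_interval_real)
  also have "\<dots> = integral {0..1} (\<lambda>t. if t \<in> {0..x} then f' t else 0)"
    by (intro integral_cong) auto
  also have "\<dots> = integral {0..x} f'"
    using x by (subst integral_restrict_Int) (simp add: Int_absorb2)
  also have "\<dots> = f x - f 0"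
    using x assms(1) by (intro integral_unique fundamental_theorem_of_calculus)
      (auto intro: has_vector_derivative_at_within)
  finally show "f x = f 0 + primitive f' x"
    by simp
qed

section \<open>Test functions\<close>

text \<open>A class closed under differentiation contains all iterated derivatives of its members;
  no formula for the higher derivatives has to be found.\<close>

lemma smooth_coinduct:
  assumes "f \<in> F"
    and step: "\<And>g. g \<in> F \<Longrightarrow> \<exists>g'\<in>F. \<forall>x. (g has_vector_derivative g' x) (at x)"
  shows "smooth f"
  unfolding smooth_def
proof (intro allI)
  fix n x
  have "((\<lambda>\<psi> y. vector_derivative \<psi> (at y)) ^^ n) f \<in> F"
  proof (induction n)
    case (Suc n)
    then obtain g' where g': "g' \<in> F"
        "\<And>x. (((\<lambda>\<psi> y. vector_derivative \<psi> (at y)) ^^ n) f has_vector_derivative g' x) (at x)"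
      using step by blast
    then have "((\<lambda>\<psi> y. vector_derivative \<psi> (at y)) ^^ Suc n) f = g'"
      by (auto simp: vector_derivative_at)
    then show ?case
      using g' by simp
  qed (use assms in simp)
  then show "((\<lambda>\<psi> y. vector_derivative \<psi> (at y)) ^^ n) f differentiable (at x)"
    using step differentiableI_vector by blast
qed

lemma smooth_vector_derivative:
  assumes "smooth f"
  shows "(f has_vector_derivative vector_derivative f (at x)) (at x)"
    "smooth (\<lambda>x. vector_derivative f (at x))"
proof -
  have *: "((\<lambda>\<psi> y. vector_derivative \<psi> (at y)) ^^ n) f differentiable (at x)" for n x
    using assms by (auto simp: smooth_def)
  from *[of 0] show "(f has_vector_derivative vector_derivative f (at x)) (at x)"
    by (simp add: vector_derivative_works)
  from *[of "Suc _"] show "smooth (\<lambda>x. vector_derivative f (at x))"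
    unfolding smooth_def funpow_Suc_right by simp
qed

lemma smooth_add_mult:
  assumes "smooth f" "smooth g"
  shows "smooth (\<lambda>x. f x + c * g x)"
proof (rule smooth_coinduct[where F = "{\<lambda>x. f x + c * g x | f g. smooth f \<and> smooth g}"])
  fix h assume "h \<in> {\<lambda>x. f x + c * g x | f g. smooth f \<and> smooth g}"
  then obtain f g where h: "h = (\<lambda>x. f x + c * g x)" and "smooth f" "smooth g"
    by blast
  then show "\<exists>g'\<in>{\<lambda>x. f x + c * g x | f g. smooth f \<and> smooth g}.
      \<forall>x. (h has_vector_derivative g' x) (at x)"
    unfolding h
    by (intro bexI[of _ "\<lambda>x. vector_derivative f (at x) + c * vector_derivative g (at x)"] allI CollectI
        has_vector_derivative_add has_vector_derivative_mult_right smooth_vector_derivative(1) exI conjI)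
      (rule refl smooth_vector_derivative(2) | assumption)+
qed (use assms in blast)

lemma smooth_antiderivative:
  assumes "\<And>x. (f has_vector_derivative g x) (at x)" "smooth g"
  shows "smooth f"
proof (rule smooth_coinduct[where F = "insert f {g. smooth g}"])
  fix h assume "h \<in> insert f {g. smooth g}"
  then show "\<exists>g'\<in>insert f {g. smooth g}. \<forall>x. (h has_vector_derivative g' x) (at x)"
  proof
    assume "h = f"
    then show ?thesis
      using assms by (intro bexI[of _ g]) auto
  next
    assume "h \<in> {g. smooth g}"
    then show ?thesis
      using smooth_vector_derivative[of h]
      by (intro bexI[of _ "\<lambda>x. vector_derivative h (at x)"]) auto
  qed
qed simp

text \<open>The functions \<open>p(x) q(x)\<^sup>-\<^sup>k exp(-c/q(x))\<close> on \<open>(a,b)\<close>, where \<open>q(x) = (x-a)(b-x)\<close> and \<open>p\<close> is a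
  polynomial, extended by zero, form a class that is closed under differentiation.\<close>

definition bump :: "real \<Rightarrow> real \<Rightarrow> real \<Rightarrow> real poly \<Rightarrow> nat \<Rightarrow> real \<Rightarrow> real"
  where "bump a b c p k x =
    (if a < x \<and> x < b then poly p x * (1 / ((x - a) * (b - x))) ^ k * exp (- c / ((x - a) * (b - x))) else 0)"

text \<open>Follows from \<open>(1 + c y / n)^n \<le> exp (c y)\<close>. With \<open>y = 1/q\<close>
  it controls the pole of the bump functions at the ends of their interval.\<close>

lemma power_mult_exp_le:
  fixes y c :: real
  assumes "0 < c" "0 \<le> y" "0 < n"
  shows "y ^ n * exp (- c * y) \<le> (real n / c) ^ n"
proof -
  have "(c * y / real n) ^ n \<le> (1 + c * y / real n) ^ n"
    using assms by (intro power_mono) auto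
  also have "\<dots> \<le> exp (c * y)"
    using assms by (intro exp_ge_one_plus_x_over_n_power_n) (auto intro: order_trans[of _ 0])
  finally have "(c * y / real n) ^ n * exp (- c * y) \<le> exp (c * y) * exp (- c * y)"
    by (intro mult_right_mono) auto
  then have "(c / real n) ^ n * (y ^ n * exp (- c * y)) \<le> 1"
    by (simp add: power_mult_distrib power_divide flip: exp_add)
  then have "(real n / c) ^ n * ((c / real n) ^ n * (y ^ n * exp (- c * y))) \<le> (real n / c) ^ n * 1"
    using assms by (intro mult_left_mono) auto
  then show ?thesis
    using assms by (simp add: power_divide)
qed

text \<open>Quadratic decay at both endpoints is what lets the pieces join with derivative 0. The
  exponential absorbs two powers of \<open>1/q\<close> more than present, which frees a factor
  \<open>q^2\<close>; and \<open>q\<close> is at most \<open>b - a\<close> times the distance from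
  \<open>z\<close>.\<close>

lemma bump_bound:
  assumes "0 < c" "a < b"
  obtains M where "\<And>x z. z = a \<or> z = b \<Longrightarrow> \<bar>bump a b c p k x\<bar> \<le> M * (x - z)\<^sup>2"
proof -
  have "bounded (poly p ` {a..b})"
    by (intro compact_imp_bounded compact_continuous_image continuous_intros) auto
  then obtain P where "0 < P" and P: "\<forall>x\<in>{a..b}. \<bar>poly p x\<bar> \<le> P"
    by (auto simp: bounded_pos)
  define C where "C = (real (k + 2) / c) ^ (k + 2)"
  have "0 \<le> C"
    using assms by (simp add: C_def)
  have "\<bar>bump a b c p k x\<bar> \<le> P * C * (b - a)\<^sup>2 * (x - z)\<^sup>2" if z: "z = a \<or> z = b" for x z
  proof (cases "a < x \<and> x < b")
    case True
    define q where "q = (x - a) * (b - x)"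
    have q: "0 < q"
      using True by (simp add: q_def)
    have "q \<le> (b - a) * \<bar>x - z\<bar>"
      using z
    proof
      assume "z = a"
      then show ?thesis
        using True mult_right_mono[of "b - x" "b - a" "x - a"] by (simp add: q_def mult.commute)
    next
      assume "z = b"
      then show ?thesis
        using True mult_right_mono[of "x - a" "b - a" "b - x"] by (simp add: q_def)
    qed
    then have "q\<^sup>2 \<le> ((b - a) * \<bar>x - z\<bar>)\<^sup>2"
      using q by (intro power_mono) auto
    then have q2: "q\<^sup>2 \<le> (b - a)\<^sup>2 * (x - z)\<^sup>2"
      by (simp add: power_mult_distrib)
    have "\<bar>bump a b c p k x\<bar> = \<bar>poly p x\<bar> * ((1 / q) ^ k * exp (- c * (1 / q)))"
      using True q by (simp add: bump_def q_def[symmetric] abs_mult)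
    also have "(1 / q) ^ k * exp (- c * (1 / q)) = q\<^sup>2 * ((1 / q) ^ (k + 2) * exp (- c * (1 / q)))"
      using q by (simp add: power_add power_divide power2_eq_square)
    also have "\<bar>poly p x\<bar> * (q\<^sup>2 * ((1 / q) ^ (k + 2) * exp (- c * (1 / q)))) \<le> \<bar>poly p x\<bar> * (q\<^sup>2 * C)"
      unfolding C_def using assms q by (intro mult_left_mono power_mult_exp_le) auto
    also have "\<bar>poly p x\<bar> * (q\<^sup>2 * C) \<le> P * (((b - a)\<^sup>2 * (x - z)\<^sup>2) * C)"
      using P True q2 \<open>0 \<le> C\<close> \<open>0 < P\<close> by (intro mult_mono) auto
    finally show ?thesis
      by (simp only: mult_ac)
  next
    case False
    then show ?thesis
      using \<open>0 < P\<close> \<open>0 \<le> C\<close> by (auto simp: bump_def)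
  qed
  then show thesis
    by (rule that)
qed

lemma DERIV_quadratic_bound:
  fixes f :: "real \<Rightarrow> real"
  assumes "\<And>x. \<bar>f x\<bar> \<le> M * (x - z)\<^sup>2"
  shows "(f has_real_derivative 0) (at z)"
proof -
  have "f z = 0"
    using assms[of z] by simp
  have "norm ((f (z + h) - f z) / h) \<le> M * \<bar>h\<bar>" if "h \<noteq> 0" for h
  proof -
    have "\<bar>f (z + h)\<bar> \<le> M * \<bar>h\<bar> * \<bar>h\<bar>"
      using assms[of "z + h"] by (simp add: power2_eq_square)
    then show ?thesis
      using that by (simp add: \<open>f z = 0\<close> pos_divide_le_eq)
  qed
  then have "\<forall>\<^sub>F h in at 0. norm ((f (z + h) - f z) / h) \<le> M * \<bar>h\<bar>"
    by (auto simp: eventually_at_filter)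
  moreover have "((\<lambda>h. M * \<bar>h\<bar>) \<longlongrightarrow> 0) (at 0)"
    by (auto intro!: tendsto_eq_intros)
  ultimately show ?thesis
    unfolding DERIV_def by (rule Lim_null_comparison)
qed

lemma bump_DERIV:
  assumes "0 < c" "a < b"
  shows "\<exists>p' k'. \<forall>x. (bump a b c p k has_real_derivative bump a b c p' k' x) (at x)"
proof -
  define Q where "Q = [:- a, 1:] * [:b, - 1:]"
  \<comment> \<open>Numerator of the derivative of \<open>p Q^-k exp (- c / Q)\<close> over
    \<open>Q^(k + 2)\<close>; the summands come from \<open>p\<close>, from the power and from the
    exponential.\<close>
  define p' where "p' = pderiv p * Q\<^sup>2 - of_nat k * p * Q * pderiv Q + [:c:] * (p * pderiv Q)"
  have Q: "poly Q x = (x - a) * (b - x)" for x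
    by (simp add: Q_def algebra_simps)
  have "(bump a b c p k has_real_derivative bump a b c p' (k + 2) x) (at x)" for x
  proof -
    consider "x < a" | "b < x" | "x = a \<or> x = b" | "a < x" "x < b"
      by linarith
    then show ?thesis
    proof cases
      case 1
      have "((\<lambda>_. 0) has_real_derivative 0) (at x)"
        by simp
      then have "(bump a b c p k has_real_derivative 0) (at x)"
        by (rule has_field_derivative_transform_within_open[where S = "{..<a}"]) (use 1 in \<open>auto simp: bump_def\<close>)
      then show ?thesis
        using 1 by (simp add: bump_def)
    next
      case 2
      have "((\<lambda>_. 0) has_real_derivative 0) (at x)"
        by simp
      then have "(bump a b c p k has_real_derivative 0) (at x)"
        by (rule has_field_derivative_transform_within_open[where S = "{b<..}"]) (use 2 in \<open>auto simp: bump_def\<close>)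
      then show ?thesis
        using 2 by (simp add: bump_def)
    next
      case 3
      obtain M where "\<And>x z. z = a \<or> z = b \<Longrightarrow> \<bar>bump a b c p k x\<bar> \<le> M * (x - z)\<^sup>2"
        using bump_bound[OF assms] by metis
      then have "(bump a b c p k has_real_derivative 0) (at x)"
        using 3 DERIV_quadratic_bound by metis
      then show ?thesis
        using 3 by (auto simp: bump_def)
    next
      case 4
      define q where "q = poly Q x"
      have q: "0 < q"
        using 4 by (simp add: q_def Q)
      then have "poly Q x \<noteq> 0"
        by (simp add: q_def)
      then have "((\<lambda>x. poly p x * (1 / poly Q x) ^ k * exp (- c / poly Q x)) has_real_derivative
          (poly (pderiv p) x * (1 / q) ^ k
            + poly p x * (real k * (1 / q) ^ (k - 1) * (- (poly (pderiv Q) x / q\<^sup>2)))) * exp (- c / q)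
          + poly p x * (1 / q) ^ k * (exp (- c / q) * (c * poly (pderiv Q) x / q\<^sup>2))) (at x)"
        unfolding q_def
        by (auto intro!: derivative_eq_intros simp: power2_eq_square algebra_simps)
      also have "(poly (pderiv p) x * (1 / q) ^ k
            + poly p x * (real k * (1 / q) ^ (k - 1) * (- (poly (pderiv Q) x / q\<^sup>2)))) * exp (- c / q)
          + poly p x * (1 / q) ^ k * (exp (- c / q) * (c * poly (pderiv Q) x / q\<^sup>2))
          = poly p' x * (1 / q) ^ (k + 2) * exp (- c / q)"
      proof -
        \<comment> \<open>At \<open>k = 0\<close> the exponent \<open>k - 1\<close> is cut off at 0,
          but both sides vanish.\<close>
        have k: "real k * (1 / q) ^ (k - 1) = real k * q * (1 / q) ^ k"
          using q by (cases k) auto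
        have k2: "(1 / q) ^ (k + 2) = (1 / q) ^ k / q\<^sup>2"
          using q by (simp add: power_add power_divide power2_eq_square)
        have p'x: "poly p' x = poly (pderiv p) x * q\<^sup>2 - real k * poly p x * q * poly (pderiv Q) x
            + c * (poly p x * poly (pderiv Q) x)"
          by (simp add: p'_def q_def of_nat_poly power2_eq_square)
        show ?thesis
          unfolding k k2 p'x using q by (simp add: field_simps power2_eq_square)
      qed
      finally have "((\<lambda>x. poly p x * (1 / poly Q x) ^ k * exp (- c / poly Q x)) has_real_derivative
          bump a b c p' (k + 2) x) (at x)"
        using 4 by (simp add: bump_def q_def Q)
      then show ?thesis
        by (rule has_field_derivative_transform_within_open[where S = "{a<..<b}"])
          (use 4 in \<open>auto simp: bump_def Q\<close>)
    qed
  qed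
  then show ?thesis
    by blast
qed

lemma smooth_bump:
  assumes "0 < c" "a < b"
  shows "smooth (\<lambda>x. complex_of_real (bump a b c p k x))"
proof (rule smooth_coinduct[where F = "{\<lambda>x. complex_of_real (bump a b c p k x) | p k. True}"])
  fix g assume "g \<in> {\<lambda>x. complex_of_real (bump a b c p k x) | p k. True}"
  then obtain p k where g: "g = (\<lambda>x. complex_of_real (bump a b c p k x))"
    by blast
  obtain p' k' where "\<And>x. (bump a b c p k has_real_derivative bump a b c p' k' x) (at x)"
    using bump_DERIV[OF assms] by blast
  then have "\<forall>x. (g has_vector_derivative complex_of_real (bump a b c p' k' x)) (at x)"
    unfolding g by (auto intro!: has_vector_derivative_of_real
        simp: has_real_derivative_iff_has_vector_derivative)
  then show "\<exists>g'\<in>{\<lambda>x. complex_of_real (bump a b c p k x) | p k. True}.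
      \<forall>x. (g has_vector_derivative g' x) (at x)"
    by (intro bexI[of _ "\<lambda>x. complex_of_real (bump a b c p' k' x)"]) auto
qed blast

lemma test_function_bump:
  assumes "0 < c" "0 < a" "a < b" "b < 1"
  shows "test_function (\<lambda>x. complex_of_real (bump a b c p k x))"
  unfolding test_function_def using smooth_bump[OF assms(1,3)] assms
  by (intro conjI exI[of _ a] exI[of _ b]) (auto simp: bump_def split: if_splits)

lemma test_function_add_mult:
  assumes "test_function f" "test_function g"
  shows "test_function (\<lambda>x. f x + c * g x)"
proof -
  obtain a b a' b' where
    "0 < a" "b < 1" "0 < a'" "b' < 1" and f: "\<And>x. f x \<noteq> 0 \<Longrightarrow> x \<in> {a..b}"
    and g: "\<And>x. g x \<noteq> 0 \<Longrightarrow> x \<in> {a'..b'}"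
    using assms unfolding test_function_def by metis
  have "x \<in> {min a a'..max b b'}" if "f x + c * g x \<noteq> 0" for x
  proof -
    have "f x \<noteq> 0 \<or> g x \<noteq> 0"
      using that by auto
    then show ?thesis
      using f[of x] g[of x] by auto
  qed
  then show ?thesis
    unfolding test_function_def using assms \<open>0 < a\<close> \<open>b < 1\<close> \<open>0 < a'\<close> \<open>b' < 1\<close>
    by (intro conjI smooth_add_mult exI[of _ "min a a'"] exI[of _ "max b b'"])
      (auto simp: test_function_def)
qed

text \<open>The primitive from 0 vanishes to the left of the support of \<open>g\<close> by itself,
  and to the right of it because the integral of \<open>g\<close> is 0.\<close>

lemma test_function_antiderivative:
  assumes "test_function g" "(LINT x|I01. g x) = 0"
  obtains f where "test_function f" "\<And>x. vector_derivative f (at x) = g x"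
proof -
  obtain a b where ab: "0 < a" "b < 1" and g: "\<And>x. g x \<noteq> 0 \<Longrightarrow> x \<in> {a..b}"
    using assms unfolding test_function_def by metis
  have cont: "continuous_on S g" for S
    using test_function_continuous(1)[OF assms(1)] by (rule continuous_on_subset) simp
  define f where "f x = integral {0..x} g" for x
  have f_low: "f x = 0" if "x < a" for x
  proof -
    have "f x = integral {0..x} (\<lambda>_. 0)"
      unfolding f_def using g that by (intro integral_cong) force
    then show ?thesis
      by simp
  qed
  have f_high: "f x = 0" if "b < x" for x
  proof -
    have *: "(LINT x|I01. g x) = integral {0..1} g"
      using square_integrable_imp_integrable[OF square_integrable_continuous[OF cont]]
      by (simp add: lebesgue_integral_eq_integral integral_open_interval_real)
    \<comment> \<open>\<open>b\<close> may be negative, in which case \<open>g\<close> is 0; the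
      splitting of the interval needs a point that is at least 0.\<close>
    define m where "m = max b 0"
    have "integral {m..y} g = 0" if "m \<le> y" for y
    proof -
      have "integral {m..y} g = integral {m..y} (\<lambda>_. 0)"
      proof (rule integral_spike[where S = "{m}"])
        show "0 = g x" if "x \<in> {m..y} - {m}" for x
          using g[of x] that by (force simp: m_def)
      qed auto
      then show ?thesis
        by simp
    qed
    then have "integral {0..y} g = integral {0..m} g" if "m \<le> y" for y
      using Henstock_Kurzweil_Integration.integral_combine[of 0 m y g] that
        integrable_continuous_interval[OF cont, of 0 y] by (simp add: m_def)
    from this[of 1] this[of x] have "f x = integral {0..1} g" if "0 \<le> x"
      using that \<open>b < x\<close> ab by (simp add: m_def f_def)
    then show ?thesis
      using f_low[of x] * assms(2) ab by (cases "0 \<le> x") auto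
  qed
  have deriv: "(f has_vector_derivative g x) (at x)" for x
  proof (cases "x < a")
    case True
    have "((\<lambda>_. 0) has_vector_derivative 0) (at x)"
      by simp
    then have "(f has_vector_derivative 0) (at x)"
      by (rule has_vector_derivative_transform_within_open[where S = "{..<a}"])
        (use True f_low in auto)
    moreover have "g x = 0"
      using g[of x] True by auto
    ultimately show ?thesis
      by simp
  next
    case False
    \<comment> \<open>From \<open>x \<ge> a > 0\<close> the point is interior to
      \<open>{0..x + 1}\<close>, so the derivative within this interval is the full one.\<close>
    have "(f has_vector_derivative g x) (at x within {0..x + 1})"
      unfolding f_def using False ab by (intro integral_has_vector_derivative cont) auto
    moreover have "x \<in> interior {0..x + 1}"
      using False ab by simp
    ultimately show ?thesis
      by (simp only: at_within_interior)
  qed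
  have "test_function f"
    unfolding test_function_def
  proof (intro conjI exI allI impI)
    show "smooth f"
      using smooth_antiderivative[OF deriv] assms(1) by (simp add: test_function_def)
    show "x \<in> {a..b}" if "f x \<noteq> 0" for x
      using that f_low[of x] f_high[of x] by force
  qed (use ab in auto)
  moreover have "vector_derivative f (at x) = g x" for x
    using deriv by (rule vector_derivative_at)
  ultimately show thesis
    by (rule that)
qed

section \<open>Weak derivatives\<close>

text \<open>Half-lines generate the Borel sets and are stable under intersection, so the integral of
  \<open>w\<close> vanishes over every Borel set, and over every Lebesgue set since these differ
  from Borel sets by null sets. Then \<open>w\<close> itself vanishes almost everywhere.\<close>

lemma primitive_zero_imp_AE_zero:
  assumes w: "integrable I01 w" and zero: "\<And>x. x \<in> {0..1} \<Longrightarrow> primitive w x = 0"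
  shows "AE x in I01. w x = 0"
proof (rule I01.density_zero[OF w])
  define I where "I = {0<..<1::real}"
  have setI: "A \<inter> I \<in> sets I01" if "A \<in> sets borel" for A
    unfolding I_def using that by (subst sets_restrict_space_iff) auto
  have int: "set_integrable I01 (A \<inter> I) w" if "A \<in> sets borel" for A
    unfolding set_integrable_def using setI[OF that] w by (rule integrable_mult_indicator)
  have primitive: "(LINT x:{..y} \<inter> I|I01. w x) = primitive w y" for y
    unfolding primitive_def set_lebesgue_integral_def
    by (intro Bochner_Integration.integral_cong) (auto simp: I_def indicator_def)
  have primitive_zero: "primitive w y = 0" for y
  proof -
    consider "y < 0" | "y \<in> {0..1}" | "1 < y"
      by fastforce
    then show ?thesis
      using zero[of y] zero[of 1] primitive_ge_1[of 1 w] primitive_ge_1[of y w] primitive_nonpos[of y w]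
      by cases auto
  qed
  have borel: "(LINT x:A \<inter> I|I01. w x) = 0" if "A \<in> sets borel" for A
  proof -
    have "Int_stable (range (\<lambda>a::real. {..a}))" "range (\<lambda>a::real. {..a}) \<subseteq> Pow UNIV"
      by (auto simp: Int_stable_def)
    moreover have "A \<in> sigma_sets UNIV (range (\<lambda>a::real. {..a}))"
      using that unfolding borel_eq_atMost by simp
    ultimately show ?thesis
    proof (induction rule: sigma_sets_induct_disjoint)
      case (basic A)
      then show ?case
        using primitive primitive_zero by auto
    next
      case empty
      then show ?case
        by (simp add: set_lebesgue_integral_def)
    next
      case (compl A)
      then have A: "A \<in> sets borel"
        unfolding borel_eq_atMost by simp
      have "(LINT x:(A \<inter> I) \<union> ((UNIV - A) \<inter> I)|I01. w x)
          = (LINT x:A \<inter> I|I01. w x) + (LINT x:(UNIV - A) \<inter> I|I01. w x)"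
        using A by (intro set_integral_Un int) auto
      moreover have "(A \<inter> I) \<union> ((UNIV - A) \<inter> I) = {..1} \<inter> I"
        by (auto simp: I_def)
      ultimately show ?case
        using primitive[of 1] primitive_zero compl by simp
    next
      case (union A)
      have A: "A i \<in> sets borel" for i
        using union(2) unfolding borel_eq_atMost by auto
      have "(LINT x:(\<Union>i. A i \<inter> I)|I01. w x) = (\<Sum>i. (LINT x:A i \<inter> I|I01. w x))"
      proof (rule lebesgue_integral_countable_add)
        show "A i \<inter> I \<in> sets I01" for i
          by (rule setI[OF A])
        show "(A i \<inter> I) \<inter> (A j \<inter> I) = {}" if "i \<noteq> j" for i j
          using union(1) that by (auto simp: disjoint_family_on_def)
        have "set_integrable I01 ((\<Union>i. A i) \<inter> I) w"
          using A by (intro int) auto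
        then show "set_integrable I01 (\<Union>i. A i \<inter> I) w"
          by simp
      qed
      then show ?case
        using union(3) by simp
    qed
  qed
  fix A assume "A \<in> sets I01"
  then have A: "A \<in> sets lebesgue" "A \<subseteq> I"
    unfolding I_def by (subst (asm) sets_restrict_space_iff; simp)+
  obtain S N N' where S: "A = S \<union> N" "N \<subseteq> N'" "N' \<in> null_sets lborel" "S \<in> sets lborel"
    by (rule sets_completionE[OF A(1)])
  have "AE x in lebesgue. x \<notin> N'"
    by (intro AE_completion AE_not_in S)
  then have "AE x in I01. x \<notin> N'"
    by (simp add: AE_restrict_space_iff) (auto elim: eventually_mono)
  then have "AE x in I01. indicat_real A x *\<^sub>R w x = indicat_real (S \<inter> I) x *\<^sub>R w x"
    by eventually_elim (use S A in \<open>auto simp: indicator_def\<close>)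
  moreover have "S \<in> sets borel"
    using S by simp
  ultimately have "(LINT x:A|I01. w x) = (LINT x:S \<inter> I|I01. w x)"
    unfolding set_lebesgue_integral_def
    using integrable_mult_indicator[OF \<open>A \<in> sets I01\<close> w] int[unfolded set_integrable_def, of S]
    by (intro integral_cong_AE) auto
  then show "(LINT x:A|I01. w x) = 0"
    using borel \<open>S \<in> sets borel\<close> by simp
qed

lemma integrable_mult_test_function:
  assumes "integrable I01 w" "test_function \<eta>"
  shows "integrable I01 (\<lambda>x. w x * \<eta> x)"
proof -
  have cont: "continuous_on {0..1} \<eta>"
    using test_function_continuous(1)[OF assms(2)] by (rule continuous_on_subset) simp
  obtain C where "\<And>x. x \<in> {0<..<1} \<Longrightarrow> cmod (\<eta> x) \<le> C"
    using continuous_bounded_unit[OF cont] by blast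
  then show ?thesis
    by (rule integrable_mult_bounded[OF assms(1) measurable_I01_continuous[OF cont]])
qed

text \<open>As \<open>c \<rightarrow> 0\<close>, the test functions \<open>exp(-c/((x-a)(b-x)))\<close> increase to the indicator of \<open>(a,b)\<close>.\<close>

lemma test_functions_total:
  assumes w: "integrable I01 w"
    and zero: "\<And>\<eta>. test_function \<eta> \<Longrightarrow> (LINT x|I01. w x * \<eta> x) = 0"
  shows "AE x in I01. w x = 0"
proof (rule primitive_zero_imp_AE_zero[OF w])
  have eq: "primitive w b = primitive w a" if ab: "0 < a" "a < b" "b < 1" for a b
  proof -
    define \<eta> where "\<eta> n x = complex_of_real (bump a b (1 / real (Suc n)) 1 0 x)" for n x
    have \<eta>: "test_function (\<eta> n)" for n
      unfolding \<eta>_def using ab by (intro test_function_bump) auto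
    define h where "h x = (if x \<le> b then w x else 0) - (if x \<le> a then w x else 0)" for x
    have h: "integrable I01 h"
      unfolding h_def by (intro Bochner_Integration.integrable_diff integrable_truncate w)
    have "(\<lambda>n. LINT x|I01. w x * \<eta> n x) \<longlonglongrightarrow> (LINT x|I01. h x)"
    proof (rule integral_dominated_convergence[where w = "\<lambda>x. cmod (w x)"])
      show "AE x in I01. (\<lambda>n. w x * \<eta> n x) \<longlonglongrightarrow> h x"
        \<comment> \<open>\<open>h\<close> is \<open>w\<close> on the half-open interval from
          \<open>a\<close> to \<open>b\<close>, including \<open>b\<close>, whereas every
          \<open>\<eta> n\<close> vanishes at \<open>b\<close>.\<close>
        using AE_I01_neq[of b]
      proof eventually_elim
        case (elim x)
        show ?case
        proof (cases "a < x \<and> x < b")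
          case True
          have "(\<lambda>n. inverse (real (Suc n)) * (- 1 / ((x - a) * (b - x)))) \<longlonglongrightarrow> 0 * (- 1 / ((x - a) * (b - x)))"
            by (intro tendsto_intros LIMSEQ_inverse_real_of_nat)
          then have "(\<lambda>n. complex_of_real (exp (inverse (real (Suc n)) * (- 1 / ((x - a) * (b - x)))))) \<longlonglongrightarrow> complex_of_real (exp 0)"
            by (intro tendsto_of_real tendsto_exp) simp
          moreover have "\<eta> n x = complex_of_real (exp (inverse (real (Suc n)) * (- 1 / ((x - a) * (b - x)))))" for n
            using True by (simp add: \<eta>_def bump_def field_simps)
          ultimately have "(\<lambda>n. w x * \<eta> n x) \<longlonglongrightarrow> w x * 1"
            by (intro tendsto_intros) simp
          then show ?thesis
            using True by (simp add: h_def)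
        next
          case False
          then have "\<eta> n x = 0" for n
            by (auto simp: \<eta>_def bump_def)
          moreover have "h x = 0"
            using False elim ab by (auto simp: h_def)
          ultimately show ?thesis
            by simp
        qed
      qed
      show "AE x in I01. norm (w x * \<eta> n x) \<le> cmod (w x)" for n
      proof (rule AE_I2)
        fix x
        have "\<bar>bump a b (1 / real (Suc n)) 1 0 x\<bar> \<le> 1"
          by (auto simp: bump_def divide_nonneg_pos)
        then have "cmod (\<eta> n x) \<le> 1"
          by (simp add: \<eta>_def)
        then show "norm (w x * \<eta> n x) \<le> cmod (w x)"
          by (simp add: norm_mult mult_left_le)
      qed
      show "(\<lambda>x. w x * \<eta> n x) \<in> borel_measurable I01" for n
        using integrable_mult_test_function[OF w \<eta>] by auto
    qed (use w h in auto)
    then have "(LINT x|I01. h x) = 0"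
      using zero[OF \<eta>] by (simp add: LIMSEQ_const_iff)
    then show ?thesis
      unfolding h_def primitive_def using integrable_truncate[OF w] by simp
  qed
  \<comment> \<open>The primitive is constant on the open interval, by continuity also on the closed
    one, and its value at 0 is 0.\<close>
  define c where "c = primitive w (1/2)"
  have "primitive w x = c" if "x \<in> {0<..<1}" for x
  proof (cases x "1/2 :: real" rule: linorder_cases)
    case equal
    then show ?thesis
      by (simp only: c_def)
  qed (use eq[of x "1/2"] eq[of "1/2" x] that in \<open>auto simp: c_def\<close>)
  then have const: "primitive w x = c" if "x \<in> {0..1}" for x
    using continuous_constant_on_closure[of "{0<..<1}" "primitive w" c x] primitive_continuous[OF w] that
    by auto
  show "primitive w x = 0" if "x \<in> {0..1}" for x
    using const[OF that] const[of 0] by simp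
qed

lemma not_AE_I01_False: "\<not> (AE x in I01. False)"
  by (simp only: eventually_False ae_filter_eq_bot_iff emeasure_I01 one_neq_zero not_False_eq_True)

text \<open>Subtracting a multiple of one fixed test function makes any test function the derivative of
  another one.\<close>

lemma du_Bois_Reymond:
  assumes w: "integrable I01 w"
    and zero: "\<And>\<phi>. test_function \<phi> \<Longrightarrow> (LINT x|I01. w x * vector_derivative \<phi> (at x)) = 0"
  obtains c where "AE x in I01. w x = c"
proof -
  have one: "integrable I01 (\<lambda>_. 1 :: complex)"
    by simp
  \<comment> \<open>Otherwise the constant 1 would vanish almost everywhere.\<close>
  have "\<exists>\<eta>0. test_function \<eta>0 \<and> (LINT x|I01. \<eta>0 x) \<noteq> 0"
    using test_functions_total[OF one] not_AE_I01_False by auto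
  then obtain \<eta>0 where \<eta>0: "test_function \<eta>0" "(LINT x|I01. \<eta>0 x) \<noteq> 0"
    by blast
  \<comment> \<open>The only candidate: integrate \<open>w = c\<close> against
    \<open>\<eta>0\<close>.\<close>
  define c where "c = (LINT x|I01. w x * \<eta>0 x) / (LINT x|I01. \<eta>0 x)"
  have "AE x in I01. w x - c = 0"
  proof (rule test_functions_total)
    show "integrable I01 (\<lambda>x. w x - c)"
      using w by simp
    fix \<eta> assume \<eta>: "test_function \<eta>"
    note int = integrable_mult_test_function[OF w] integrable_mult_test_function[OF one, simplified]
    \<comment> \<open>Makes the integral of \<open>\<eta> + d \<eta>0\<close> vanish, as
      \<open>test_function_antiderivative\<close> requires.\<close>
    define d where "d = - (LINT x|I01. \<eta> x) / (LINT x|I01. \<eta>0 x)"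
    have "(LINT x|I01. \<eta> x + d * \<eta>0 x) = 0"
      using int(2)[OF \<eta>] int(2)[OF \<eta>0(1)] \<eta>0(2) by (simp add: d_def)
    then obtain \<phi> where \<phi>: "test_function \<phi>" "\<And>x. vector_derivative \<phi> (at x) = \<eta> x + d * \<eta>0 x"
      using test_function_antiderivative[OF test_function_add_mult[OF \<eta> \<eta>0(1), of d]] by blast
    have "(LINT x|I01. w x * \<eta> x + d * (w x * \<eta>0 x)) = 0"
      using zero[OF \<phi>(1)] unfolding \<phi>(2) by (simp add: algebra_simps)
    then have "(LINT x|I01. w x * \<eta> x) = - d * (LINT x|I01. w x * \<eta>0 x)"
      using int(1)[OF \<eta>] int(1)[OF \<eta>0(1)] by (simp add: add_eq_0_iff)
    also have "\<dots> = c * (LINT x|I01. \<eta> x)"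
      by (simp add: c_def d_def)
    finally show "(LINT x|I01. (w x - c) * \<eta> x) = 0"
      using int(1)[OF \<eta>] int(2)[OF \<eta>] by (simp add: left_diff_distrib)
  qed
  then show thesis
    by (intro that[of c]) simp
qed

lemma has_weak_derivative_iff:
  assumes "represents f u" "represents g v"
  shows "has_weak_derivative u v \<longleftrightarrow> (\<forall>\<phi>. test_function \<phi> \<longrightarrow>
    (LINT x|I01. f x * vector_derivative \<phi> (at x)) = - (LINT x|I01. g x * \<phi> x))"
  using assms
proof transfer
  fix f g f' g' :: "real \<Rightarrow> complex"
  assume "square_integrable f' \<and> square_integrable f' \<and> (AE x in I01. f' x = f' x)"
    and "square_integrable g' \<and> square_integrable g' \<and> (AE x in I01. g' x = g' x)"
    and "square_integrable f \<and> (AE x in I01. f x = f' x)"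
    and "square_integrable g \<and> (AE x in I01. g x = g' x)"
  then have "(LINT x|I01. f' x * vector_derivative \<phi> (at x)) = (LINT x|I01. f x * vector_derivative \<phi> (at x))"
    "(LINT x|I01. g' x * \<phi> x) = (LINT x|I01. g x * \<phi> x)" if "test_function \<phi>" for \<phi>
    using integral_mult_cong_AE[OF _ _ _ test_function_continuous(2)[OF that], of f f']
      integral_mult_cong_AE[OF _ _ _ test_function_continuous(1)[OF that], of g g'] by auto
  then show "(\<forall>\<phi>. test_function \<phi> \<longrightarrow>
      (LINT x|I01. f' x * vector_derivative \<phi> (at x)) = - (LINT x|I01. g' x * \<phi> x)) \<longleftrightarrow>
    (\<forall>\<phi>. test_function \<phi> \<longrightarrow>
      (LINT x|I01. f x * vector_derivative \<phi> (at x)) = - (LINT x|I01. g x * \<phi> x))"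
    by (simp cong: imp_cong)
qed

lemma integral_by_parts_test_function:
  assumes "antiderivative f g" "test_function \<phi>"
  shows "(LINT x|I01. f x * vector_derivative \<phi> (at x)) = - (LINT x|I01. g x * \<phi> x)"
proof -
  have "antiderivative \<phi> (\<lambda>x. vector_derivative \<phi> (at x))"
    using assms(2) test_function_continuous(2)[OF assms(2)]
    by (intro antiderivative_C1 smooth_vector_derivative(1))
      (auto simp: test_function_def intro: continuous_on_subset)
  then have "(LINT x|I01. g x * \<phi> x) + (LINT x|I01. f x * vector_derivative \<phi> (at x))
      = f 1 * \<phi> 1 - f 0 * \<phi> 0"
    by (rule integral_by_parts[OF assms(1)])
  moreover have "\<phi> 0 = 0" "\<phi> 1 = 0"
    using assms(2) unfolding test_function_def by force+
  ultimately show ?thesis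
    by (simp add: eq_neg_iff_add_eq_0 add.commute)
qed

lemma has_weak_derivative_antiderivative:
  assumes "antiderivative f g" "represents f u" "represents g v"
  shows "has_weak_derivative u v"
  unfolding has_weak_derivative_iff[OF assms(2,3)] using integral_by_parts_test_function[OF assms(1)] by blast

lemma has_weak_derivative_unique:
  assumes "has_weak_derivative u v" "has_weak_derivative u v'"
  shows "v = v'"
proof -
  obtain f where f: "represents f u"
    by (rule represents_exists)
  obtain g where g: "represents g v"
    by (rule represents_exists)
  obtain g' where g': "represents g' v'"
    by (rule represents_exists)
  have int: "integrable I01 g" "integrable I01 g'"
    using g g' by (auto intro: square_integrable_imp_integrable represents_square_integrable)
  have "AE x in I01. g x - g' x = 0"
  proof (rule test_functions_total)
    show "integrable I01 (\<lambda>x. g x - g' x)"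
      using int by simp
    fix \<phi> assume \<phi>: "test_function \<phi>"
    then have "(LINT x|I01. g x * \<phi> x) = (LINT x|I01. g' x * \<phi> x)"
      using assms unfolding has_weak_derivative_iff[OF f g] has_weak_derivative_iff[OF f g'] by auto
    then show "(LINT x|I01. (g x - g' x) * \<phi> x) = 0"
      using integrable_mult_test_function[OF _ \<phi>] int by (simp add: left_diff_distrib)
  qed
  then show ?thesis
    unfolding represents_AE_eq[OF g g'] by simp
qed

text \<open>\<open>f\<close> and \<open>primitive g\<close> have the same integrals against
  derivatives of test functions, so they differ by a constant \<open>c\<close>; then
  \<open>c + primitive g\<close> is the representative sought.\<close>

lemma has_weak_derivative_obtain:
  assumes "has_weak_derivative u v"
  obtains f g where "antiderivative f g" "represents f u" "represents g v"
proof -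
  obtain f where f: "represents f u"
    by (rule represents_exists)
  obtain g where g: "represents g v"
    by (rule represents_exists)
  have "square_integrable g"
    using g by (rule represents_square_integrable)
  then have anti: "antiderivative (\<lambda>x. c + primitive g x) g" for c
    by (rule antiderivative_primitive)
  have int: "integrable I01 f" "integrable I01 (primitive g)"
    using represents_square_integrable[OF f] antiderivative_square_integrable(1)[OF anti[of 0]]
    by (auto intro: square_integrable_imp_integrable)
  obtain c where c: "AE x in I01. f x - primitive g x = c"
  proof (rule du_Bois_Reymond)
    show "integrable I01 (\<lambda>x. f x - primitive g x)"
      using int by simp
    fix \<phi> assume \<phi>: "test_function \<phi>"
    have cont: "continuous_on {0..1} (\<lambda>x. vector_derivative \<phi> (at x))"
      using test_function_continuous(2)[OF \<phi>] by (rule continuous_on_subset) simp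
    have "integrable I01 (\<lambda>x. h x * vector_derivative \<phi> (at x))" if "square_integrable h" for h
      by (intro square_integrable_imp_integrable square_integrable_mult_continuous that cont)
    moreover have "(LINT x|I01. f x * vector_derivative \<phi> (at x))
        = (LINT x|I01. primitive g x * vector_derivative \<phi> (at x))"
      using assms \<phi> integral_by_parts_test_function[OF anti[of 0] \<phi>]
      unfolding has_weak_derivative_iff[OF f g] by simp
    ultimately show "(LINT x|I01. (f x - primitive g x) * vector_derivative \<phi> (at x)) = 0"
      using represents_square_integrable[OF f] antiderivative_square_integrable(1)[OF anti[of 0]]
      by (simp add: left_diff_distrib)
  qed
  have "represents (\<lambda>x. c + primitive g x) u"
    using f antiderivative_square_integrable(1)[OF anti]
  proof (rule represents_cong_AE)
    show "AE x in I01. f x = c + primitive g x"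
      using c by eventually_elim (simp add: diff_eq_eq)
  qed
  with anti g show thesis
    by (intro that)
qed

lemma weak_derivative_eq: "has_weak_derivative u v \<Longrightarrow> weak_derivative u = v"
  unfolding weak_derivative_def using has_weak_derivative_unique by blast

lemma antiderivative_weak_derivative:
  assumes "antiderivative f g" "represents f u"
  shows "u \<in> H1" "represents g (weak_derivative u)"
proof -
  obtain v where v: "represents g v"
    using represents_abs[OF antiderivative_square_integrable(2)[OF assms(1)]] .
  have "has_weak_derivative u v"
    by (rule has_weak_derivative_antiderivative[OF assms v])
  then show "u \<in> H1" "represents g (weak_derivative u)"
    using v weak_derivative_eq by (auto simp: H1_def)
qed

lemma antiderivative_point_value:
  assumes "antiderivative f g" "represents f u" "x \<in> {0..1}"
  shows "point_value u x = f x"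
proof -
  have "continuous_representative u f"
    using assms(2) antiderivative_continuous[OF assms(1)] by transfer (auto elim: AE_conv2)
  then show ?thesis
    using assms(3) by (rule point_value_eq)
qed

lemma H1_obtain:
  assumes "u \<in> H1"
  obtains f g where "antiderivative f g" "represents f u" "represents g (weak_derivative u)"
proof -
  obtain v where v: "has_weak_derivative u v"
    using assms by (auto simp: H1_def)
  from has_weak_derivative_obtain[OF v] show thesis
    using that unfolding weak_derivative_eq[OF v] by blast
qed

lemma primitive_cong_AE:
  assumes "integrable I01 f" "integrable I01 g" "AE x in I01. f x = g x"
  shows "primitive f x = primitive g x"
  unfolding primitive_def
proof (rule integral_cong_AE)
  show "AE t in I01. (if t \<le> x then f t else 0) = (if t \<le> x then g t else 0)"
    using assms(3) by eventually_elim simp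
qed (use assms integrable_truncate in auto)

lemma antiderivative_cong_AE:
  assumes "antiderivative f g" "square_integrable h" "AE x in I01. g x = h x"
  shows "antiderivative f h"
  unfolding antiderivative_def
proof (intro conjI ballI)
  fix x :: real assume "x \<in> {0..1}"
  then have "f x = f 0 + primitive g x"
    by (rule antiderivative_eq[OF assms(1)])
  also have "primitive g x = primitive h x"
    by (rule primitive_cong_AE[OF antiderivative_integrable[OF assms(1)]
          square_integrable_imp_integrable[OF assms(2)] assms(3)])
  finally show "f x = f 0 + primitive h x" .
qed (rule assms)

text \<open>The derivative that \<open>H1_obtain\<close> yields for \<open>u\<close> is just some
  representative; it is exchanged for the continuous one of \<open>weak_derivative u\<close>, so
  that the same \<open>g\<close> is the derivative of \<open>f\<close> and has boundary
  values.\<close>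

lemma H2_obtain:
  assumes "u \<in> H2"
  obtains f g k where "antiderivative f g" "antiderivative g k" "represents f u"
proof -
  have "u \<in> H1" "weak_derivative u \<in> H1"
    using assms by (auto simp: H2_def)
  obtain f g where f: "antiderivative f g" "represents f u" "represents g (weak_derivative u)"
    by (rule H1_obtain[OF \<open>u \<in> H1\<close>])
  obtain h k where h: "antiderivative h k" "represents h (weak_derivative u)"
    and "represents k (weak_derivative (weak_derivative u))"
    by (rule H1_obtain[OF \<open>weak_derivative u \<in> H1\<close>])
  have "AE x in I01. g x = h x"
    using represents_AE_eq[OF f(3) h(2)] by simp
  then have "antiderivative f h"
    by (rule antiderivative_cong_AE[OF f(1) antiderivative_square_integrable(1)[OF h(1)]])
  then show thesis
    using h(1) f(2) by (rule that)
qed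

section \<open>The system operator\<close>

lemma represents_unique: "represents f u \<Longrightarrow> represents f v \<Longrightarrow> u = v"
  by (simp add: represents_AE_eq)

text \<open>The graph of the operator, expressed by representatives: boundary conditions become
  equations between values, and sums, multiples and conjugates can be formed pointwise. The minus
  sign at \<open>k3\<close> reflects that the third component of the image is
  \<open>- u3'\<close>.\<close>

definition system_graph :: "L2 \<times> L2 \<times> L2 \<Rightarrow> L2 \<times> L2 \<times> L2 \<Rightarrow> bool"
  where "system_graph = (\<lambda>(u1, u2, u3) (v1, v2, v3). \<exists>f1 g1 k1 f2 g2 k2 f3 k3.
    antiderivative f1 g1 \<and> antiderivative g1 k1 \<and> antiderivative f2 g2 \<and> antiderivative g2 k2 \<and>
    antiderivative f3 (\<lambda>x. - k3 x) \<and>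
    g1 1 = f3 0 \<and> g1 1 = f1 1 \<and> - g2 0 = f3 1 \<and> g1 0 = 0 \<and> g2 1 = 0 \<and>
    represents f1 u1 \<and> represents f2 u2 \<and> represents f3 u3 \<and>
    represents k1 v1 \<and> represents k2 v2 \<and> represents k3 v3)"

lemma system_graphE:
  assumes "system_graph (u1, u2, u3) (v1, v2, v3)"
  obtains f1 g1 k1 f2 g2 k2 f3 k3 where "antiderivative f1 g1" "antiderivative g1 k1"
    "antiderivative f2 g2" "antiderivative g2 k2" "antiderivative f3 (\<lambda>x. - k3 x)"
    "g1 1 = f3 0" "g1 1 = f1 1" "- g2 0 = f3 1" "g1 0 = 0" "g2 1 = 0"
    "represents f1 u1" "represents f2 u2" "represents f3 u3"
    "represents k1 v1" "represents k2 v2" "represents k3 v3"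
proof -
  from assms obtain f1 g1 k1 f2 g2 k2 f3 k3 where
    "antiderivative f1 g1 \<and> antiderivative g1 k1 \<and> antiderivative f2 g2 \<and> antiderivative g2 k2 \<and>
    antiderivative f3 (\<lambda>x. - k3 x) \<and>
    g1 1 = f3 0 \<and> g1 1 = f1 1 \<and> - g2 0 = f3 1 \<and> g1 0 = 0 \<and> g2 1 = 0 \<and>
    represents f1 u1 \<and> represents f2 u2 \<and> represents f3 u3 \<and>
    represents k1 v1 \<and> represents k2 v2 \<and> represents k3 v3"
    unfolding system_graph_def prod.case by (elim exE) (rule that)
  then show thesis
    by (intro that[of f1 g1 k1 f2 g2 k2 f3 k3]) (elim conjE, assumption)+
qed

lemma system_graphI:
  assumes "antiderivative f1 g1" "antiderivative g1 k1"
    "antiderivative f2 g2" "antiderivative g2 k2" "antiderivative f3 (\<lambda>x. - k3 x)"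
    "g1 1 = f3 0" "g1 1 = f1 1" "- g2 0 = f3 1" "g1 0 = 0" "g2 1 = 0"
    "represents f1 u1" "represents f2 u2" "represents f3 u3"
    "represents k1 v1" "represents k2 v2" "represents k3 v3"
  shows "system_graph (u1, u2, u3) (v1, v2, v3)"
  unfolding system_graph_def prod.case
  by (rule exI[of _ f1], rule exI[of _ g1], rule exI[of _ k1], rule exI[of _ f2], rule exI[of _ g2],
      rule exI[of _ k2], rule exI[of _ f3], rule exI[of _ k3], intro conjI assms)

lemma system_graph_operator:
  assumes "system_graph U V"
  shows "U \<in> system_domain" "system_operator U = V"
proof -
  obtain u1 u2 u3 v1 v2 v3 where U: "U = (u1, u2, u3)" and V: "V = (v1, v2, v3)"
    by (metis prod_cases3)
  obtain f1 g1 k1 f2 g2 k2 f3 k3 where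
    a: "antiderivative f1 g1" "antiderivative g1 k1" "antiderivative f2 g2" "antiderivative g2 k2"
      "antiderivative f3 (\<lambda>x. - k3 x)"
    and bc: "g1 1 = f3 0" "g1 1 = f1 1" "- g2 0 = f3 1" "g1 0 = 0" "g2 1 = 0"
    and r: "represents f1 u1" "represents f2 u2" "represents f3 u3"
      "represents k1 v1" "represents k2 v2" "represents k3 v3"
    by (rule system_graphE[OF assms[unfolded U V]])
  note d = antiderivative_weak_derivative[OF a(1) r(1)] antiderivative_weak_derivative[OF a(3) r(2)]
    antiderivative_weak_derivative[OF a(5) r(3)]
  note dd = antiderivative_weak_derivative[OF a(2) d(2)] antiderivative_weak_derivative[OF a(4) d(4)]
  have I: "0 \<in> {0..1::real}" "1 \<in> {0..1::real}"
    by auto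
  show "U \<in> system_domain"
    using d dd bc antiderivative_point_value[OF a(1) r(1)] antiderivative_point_value[OF a(2) d(2)]
      antiderivative_point_value[OF a(4) d(4)] antiderivative_point_value[OF a(5) r(3)] I
    by (simp add: U system_domain_def H2_def)
  have "- weak_derivative u3 = v3"
    using represents_minus[OF d(6)] r(6) by (intro represents_unique) auto
  moreover have "weak_derivative (weak_derivative u1) = v1" "weak_derivative (weak_derivative u2) = v2"
    by (rule represents_unique[OF dd(2) r(4)] represents_unique[OF dd(4) r(5)])+
  ultimately show "system_operator U = V"
    by (simp add: U V)
qed

lemma system_domain_graph:
  assumes "U \<in> system_domain"
  shows "system_graph U (system_operator U)"
proof -
  obtain u1 u2 u3 where U: "U = (u1, u2, u3)"
    by (metis prod_cases3)
  have H: "u1 \<in> H2" "u2 \<in> H2" "u3 \<in> H1"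
    using assms by (auto simp: U system_domain_def)
  obtain f1 g1 k1 where 1: "antiderivative f1 g1" "antiderivative g1 k1" "represents f1 u1"
    by (rule H2_obtain[OF H(1)])
  obtain f2 g2 k2 where 2: "antiderivative f2 g2" "antiderivative g2 k2" "represents f2 u2"
    by (rule H2_obtain[OF H(2)])
  obtain f3 g3 where 3: "antiderivative f3 g3" "represents f3 u3" "represents g3 (weak_derivative u3)"
    by (rule H1_obtain[OF H(3)])
  note d1 = antiderivative_weak_derivative(2)[OF 1(1,3)]
  note d2 = antiderivative_weak_derivative(2)[OF 2(1,3)]
  note dd1 = antiderivative_weak_derivative(2)[OF 1(2) d1]
  note dd2 = antiderivative_weak_derivative(2)[OF 2(2) d2]
  have I: "0 \<in> {0..1::real}" "1 \<in> {0..1::real}"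
    by auto
  have bc: "g1 1 = f3 0" "g1 1 = f1 1" "- g2 0 = f3 1" "g1 0 = 0" "g2 1 = 0"
    using assms antiderivative_point_value[OF 1(1,3)] antiderivative_point_value[OF 1(2) d1]
      antiderivative_point_value[OF 2(2) d2] antiderivative_point_value[OF 3(1,2)] I
    by (auto simp: U system_domain_def)
  have neg: "antiderivative f3 (\<lambda>x. - (- g3 x))"
    using 3(1) by simp
  show ?thesis
    unfolding U system_operator.simps
    by (rule system_graphI[OF 1(1,2) 2(1,2) neg bc 1(3) 2(3) 3(2) dd1 dd2 represents_minus[OF 3(3)]])
qed

lemma antiderivative_neg_add:
  assumes "antiderivative f (\<lambda>x. - k x)" "antiderivative f' (\<lambda>x. - k' x)"
  shows "antiderivative (\<lambda>x. f x + f' x) (\<lambda>x. - (k x + k' x))"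
  using antiderivative_add[OF assms] by (simp add: algebra_simps)

lemma system_graph_add:
  assumes "system_graph U V" "system_graph U' V'"
  shows "system_graph (U + U') (V + V')"
proof -
  obtain u1 u2 u3 v1 v2 v3 where UV: "U = (u1, u2, u3)" "V = (v1, v2, v3)"
    by (metis prod_cases3)
  obtain u1' u2' u3' v1' v2' v3' where UV': "U' = (u1', u2', u3')" "V' = (v1', v2', v3')"
    by (metis prod_cases3)
  obtain f1 g1 k1 f2 g2 k2 f3 k3 where
    a: "antiderivative f1 g1" "antiderivative g1 k1" "antiderivative f2 g2" "antiderivative g2 k2"
      "antiderivative f3 (\<lambda>x. - k3 x)"
    and bc: "g1 1 = f3 0" "g1 1 = f1 1" "- g2 0 = f3 1" "g1 0 = 0" "g2 1 = 0"
    and r: "represents f1 u1" "represents f2 u2" "represents f3 u3"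
      "represents k1 v1" "represents k2 v2" "represents k3 v3"
    by (rule system_graphE[OF assms(1)[unfolded UV]])
  obtain f1' g1' k1' f2' g2' k2' f3' k3' where
    a': "antiderivative f1' g1'" "antiderivative g1' k1'" "antiderivative f2' g2'" "antiderivative g2' k2'"
      "antiderivative f3' (\<lambda>x. - k3' x)"
    and bc': "g1' 1 = f3' 0" "g1' 1 = f1' 1" "- g2' 0 = f3' 1" "g1' 0 = 0" "g2' 1 = 0"
    and r': "represents f1' u1'" "represents f2' u2'" "represents f3' u3'"
      "represents k1' v1'" "represents k2' v2'" "represents k3' v3'"
    by (rule system_graphE[OF assms(2)[unfolded UV']])
  show ?thesis
    unfolding UV UV' add_Pair
    by (rule system_graphI[OF antiderivative_add[OF a(1) a'(1)] antiderivative_add[OF a(2) a'(2)]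
          antiderivative_add[OF a(3) a'(3)] antiderivative_add[OF a(4) a'(4)]
          antiderivative_neg_add[OF a(5) a'(5)] _ _ _ _ _
          represents_add[OF r(1) r'(1)] represents_add[OF r(2) r'(2)] represents_add[OF r(3) r'(3)]
          represents_add[OF r(4) r'(4)] represents_add[OF r(5) r'(5)] represents_add[OF r(6) r'(6)]])
      (simp_all add: bc(4,5) bc'(4,5) bc(1-3)[symmetric] bc'(1-3)[symmetric])
qed

lemma system_graph_scaleC:
  assumes "system_graph U V"
  shows "system_graph (c *\<^sub>C U) (c *\<^sub>C V)"
proof -
  obtain u1 u2 u3 v1 v2 v3 where UV: "U = (u1, u2, u3)" "V = (v1, v2, v3)"
    by (metis prod_cases3)
  obtain f1 g1 k1 f2 g2 k2 f3 k3 where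
    a: "antiderivative f1 g1" "antiderivative g1 k1" "antiderivative f2 g2" "antiderivative g2 k2"
      "antiderivative f3 (\<lambda>x. - k3 x)"
    and bc: "g1 1 = f3 0" "g1 1 = f1 1" "- g2 0 = f3 1" "g1 0 = 0" "g2 1 = 0"
    and r: "represents f1 u1" "represents f2 u2" "represents f3 u3"
      "represents k1 v1" "represents k2 v2" "represents k3 v3"
    by (rule system_graphE[OF assms[unfolded UV]])
  have a5: "antiderivative (\<lambda>x. c * f3 x) (\<lambda>x. - (c * k3 x))"
    using antiderivative_mult[OF a(5), of c] by simp
  show ?thesis
    unfolding UV scaleC_prod_def fst_conv snd_conv
    by (rule system_graphI[OF a(1-4)[THEN antiderivative_mult] a5 _ _ _ _ _ r[THEN represents_scaleC]])
      (simp_all add: bc(4,5) bc(1-3)[symmetric])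
qed

section \<open>Complex conjugation of states\<close>

lift_definition conj_L2 :: "L2 \<Rightarrow> L2" is "\<lambda>f x. cnj (f x)"
  by (auto intro: square_integrable_cnj)

definition conj3 :: "L2 \<times> L2 \<times> L2 \<Rightarrow> L2 \<times> L2 \<times> L2"
  where "conj3 U = (conj_L2 (fst U), conj_L2 (fst (snd U)), conj_L2 (snd (snd U)))"

lemma represents_conj: "represents f u \<Longrightarrow> represents (\<lambda>x. cnj (f x)) (conj_L2 u)"
  by transfer (auto intro: square_integrable_cnj)

lemma bounded_linear_conj_L2: "bounded_linear conj_L2"
proof (rule bounded_linear_intro[where K = 1])
  fix u v :: L2 and r :: real
  obtain f where f: "represents f u"
    by (rule represents_exists)
  obtain g where g: "represents g v"
    by (rule represents_exists)
  show "conj_L2 (u + v) = conj_L2 u + conj_L2 v"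
    using represents_conj[OF represents_add[OF f g]] represents_add[OF represents_conj[OF f] represents_conj[OF g]]
    by (intro represents_unique) auto
  show "conj_L2 (r *\<^sub>R u) = r *\<^sub>R conj_L2 u"
    using represents_conj[OF represents_scaleR[OF f, of r]] represents_scaleR[OF represents_conj[OF f], of r]
    by (intro represents_unique) auto
  have "(norm (conj_L2 u))\<^sup>2 = (norm u)\<^sup>2"
    unfolding represents_norm[OF represents_conj[OF f]] represents_norm[OF f] by simp
  then show "norm (conj_L2 u) \<le> norm u * 1"
    by simp
qed

lemma bounded_linear_conj3: "bounded_linear conj3"
  unfolding conj3_def[abs_def]
  by (intro bounded_linear_Pair bounded_linear_compose[OF bounded_linear_conj_L2] bounded_linear_fst
      bounded_linear_snd bounded_linear_compose[OF bounded_linear_fst] bounded_linear_compose[OF bounded_linear_snd])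

lemma real_valued_conj: "real_valued u \<longleftrightarrow> conj_L2 u = u"
  by transfer (auto simp: Reals_cnj_iff square_integrable_cnj)

text \<open>Reduces reality of the semigroup to commutation with \<open>conj3\<close>.\<close>

lemma real_valued3_conj3: "real_valued3 U \<longleftrightarrow> conj3 U = U"
  by (cases U) (auto simp: real_valued3_def conj3_def real_valued_conj)

lemma system_graph_conj3:
  assumes "system_graph U V"
  shows "system_graph (conj3 U) (conj3 V)"
proof -
  obtain u1 u2 u3 v1 v2 v3 where UV: "U = (u1, u2, u3)" "V = (v1, v2, v3)"
    by (metis prod_cases3)
  obtain f1 g1 k1 f2 g2 k2 f3 k3 where
    a: "antiderivative f1 g1" "antiderivative g1 k1" "antiderivative f2 g2" "antiderivative g2 k2"
      "antiderivative f3 (\<lambda>x. - k3 x)"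
    and bc: "g1 1 = f3 0" "g1 1 = f1 1" "- g2 0 = f3 1" "g1 0 = 0" "g2 1 = 0"
    and r: "represents f1 u1" "represents f2 u2" "represents f3 u3"
      "represents k1 v1" "represents k2 v2" "represents k3 v3"
    by (rule system_graphE[OF assms[unfolded UV]])
  have a5: "antiderivative (\<lambda>x. cnj (f3 x)) (\<lambda>x. - (cnj (k3 x)))"
    using antiderivative_cnj[OF a(5)] by simp
  show ?thesis
    unfolding UV conj3_def fst_conv snd_conv
    by (rule system_graphI[OF a(1-4)[THEN antiderivative_cnj] a5 _ _ _ _ _ r[THEN represents_conj]])
      (simp_all add: bc(4,5) bc(1-3)[symmetric])
qed

subsection \<open>Energy estimate\<close>

lemma integral_mult_cnj_self: "(LINT x|I01. g x * cnj (g x)) = complex_of_real (LINT x|I01. (cmod (g x))\<^sup>2)"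
  by (simp add: complex_norm_square[symmetric] del: of_real_power)

lemma Re_mult_cnj_self: "Re (z * cnj z) = (cmod z)\<^sup>2"
  by (simp only: complex_norm_square[symmetric] Re_complex_of_real)

lemma energy_second_derivative:
  assumes "antiderivative f g" "antiderivative g k"
  shows "Re (LINT x|I01. k x * cnj (f x))
    = Re (g 1 * cnj (f 1)) - Re (g 0 * cnj (f 0)) - (LINT x|I01. (cmod (g x))\<^sup>2)"
  using arg_cong[OF integral_by_parts[OF assms(2) antiderivative_cnj[OF assms(1)]], of Re]
  by (simp add: integral_mult_cnj_self)

text \<open>Integration by parts of \<open>f\<close> against its conjugate produces the integral and
  its complex conjugate, so only boundary values remain.\<close>

lemma energy_first_derivative:
  assumes "antiderivative f g"
  shows "2 * Re (LINT x|I01. g x * cnj (f x)) = (cmod (f 1))\<^sup>2 - (cmod (f 0))\<^sup>2"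
proof -
  have "(LINT x|I01. f x * cnj (g x)) = cnj (LINT x|I01. g x * cnj (f x))"
    unfolding Bochner_Integration.integral_cnj[symmetric] by (simp add: mult.commute)
  then have "Re (LINT x|I01. g x * cnj (f x)) + Re (cnj (LINT x|I01. g x * cnj (f x)))
      = Re (f 1 * cnj (f 1)) - Re (f 0 * cnj (f 0))"
    using arg_cong[OF integral_by_parts[OF assms antiderivative_cnj[OF assms]], of Re]
    by (simp only: plus_complex.sel minus_complex.sel)
  then show ?thesis
    unfolding Re_mult_cnj_self by simp
qed

text \<open>Obtained by integrating the derivative of \<open>(x - a) |f|\<^sup>2\<close> over \<open>(0,1)\<close>.\<close>

lemma trace_inequality:
  assumes f: "antiderivative f g" and a: "0 \<le> a" "a \<le> 1" and e: "0 < e"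
  shows "(1 - a) * (cmod (f 1))\<^sup>2 + a * (cmod (f 0))\<^sup>2
    \<le> (1 + 1 / e) * (LINT x|I01. (cmod (f x))\<^sup>2) + e * (LINT x|I01. (cmod (g x))\<^sup>2)"
proof -
  \<comment> \<open>The weight has slope 1 and modulus at most 1; \<open>a = 0\<close> isolates the
    boundary value at 1, and \<open>a = 1\<close> the one at 0.\<close>
  let ?w = "\<lambda>x. complex_of_real (x - a)"
  have "antiderivative ?w (\<lambda>_. 1)"
    by (rule antiderivative_C1) (auto intro!: derivative_eq_intros has_vector_derivative_of_real continuous_intros)
  then have wf: "antiderivative (\<lambda>x. ?w x * f x) (\<lambda>x. 1 * f x + ?w x * g x)"
    by (rule antiderivative_product[OF _ f])
  note sq = antiderivative_square_integrable[OF f] antiderivative_square_integrable[OF wf]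
  have int: "integrable I01 (\<lambda>x. (1 * f x + ?w x * g x) * cnj (f x))"
    "integrable I01 (\<lambda>x. ?w x * f x * cnj (g x))"
    by (intro integrable_mult_cnj sq)+
  have "(1 - a) * (cmod (f 1))\<^sup>2 + a * (cmod (f 0))\<^sup>2
      = Re (?w 1 * f 1 * cnj (f 1) - ?w 0 * f 0 * cnj (f 0))"
    by (simp only: mult.assoc complex_norm_square[symmetric] of_real_mult[symmetric]
        of_real_diff[symmetric] Re_complex_of_real) (simp add: algebra_simps)
  also have "\<dots> = Re (LINT x|I01. (1 * f x + ?w x * g x) * cnj (f x) + ?w x * f x * cnj (g x))"
    using integral_by_parts[OF wf antiderivative_cnj[OF f]] int by simp
  also have "\<dots> = (LINT x|I01. Re ((1 * f x + ?w x * g x) * cnj (f x) + ?w x * f x * cnj (g x)))"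
    by (rule integral_Re[symmetric]) (intro Bochner_Integration.integrable_add int)
  also have "\<dots> \<le> (LINT x|I01. (1 + 1 / e) * (cmod (f x))\<^sup>2 + e * (cmod (g x))\<^sup>2)"
  proof (rule integral_mono)
    show "integrable I01 (\<lambda>x. Re ((1 * f x + ?w x * g x) * cnj (f x) + ?w x * f x * cnj (g x)))"
      by (intro integrable_Re Bochner_Integration.integrable_add int)
    show "integrable I01 (\<lambda>x. (1 + 1 / e) * (cmod (f x))\<^sup>2 + e * (cmod (g x))\<^sup>2)"
      using sq by (auto simp: square_integrable_def)
    fix x assume "x \<in> space I01"
    then have x: "\<bar>x - a\<bar> \<le> 1"
      using a by auto
    have "Re ((1 * f x + ?w x * g x) * cnj (f x) + ?w x * f x * cnj (g x))
        = Re (f x * cnj (f x)) + 2 * ((x - a) * Re (g x * cnj (f x)))"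
      by (simp add: algebra_simps)
    moreover have "(x - a) * Re (g x * cnj (f x)) \<le> cmod (g x) * cmod (f x)"
    proof -
      have "(x - a) * Re (g x * cnj (f x)) \<le> \<bar>x - a\<bar> * \<bar>Re (g x * cnj (f x))\<bar>"
        by (metis abs_ge_self abs_mult)
      also have "\<dots> \<le> 1 * cmod (g x * cnj (f x))"
        using x by (intro mult_mono abs_Re_le_cmod) auto
      finally show ?thesis
        by (simp add: norm_mult)
    qed
    moreover have "2 * (cmod (g x) * cmod (f x)) \<le> e * (cmod (g x))\<^sup>2 + (cmod (f x))\<^sup>2 / e"
    proof -
      have "2 * (e * cmod (g x)) * cmod (f x) \<le> (e * cmod (g x))\<^sup>2 + (cmod (f x))\<^sup>2"
        by (rule sum_squares_bound)
      then have "(2 * (e * cmod (g x)) * cmod (f x)) / e \<le> ((e * cmod (g x))\<^sup>2 + (cmod (f x))\<^sup>2) / e"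
        using e by (intro divide_right_mono) auto
      then show ?thesis
        using e by (simp add: power2_eq_square add_divide_distrib ac_simps)
    qed
    ultimately show "Re ((1 * f x + ?w x * g x) * cnj (f x) + ?w x * f x * cnj (g x))
        \<le> (1 + 1 / e) * (cmod (f x))\<^sup>2 + e * (cmod (g x))\<^sup>2"
      unfolding Re_mult_cnj_self by (simp add: distrib_right)
  qed
  also have "\<dots> = (1 + 1 / e) * (LINT x|I01. (cmod (f x))\<^sup>2) + e * (LINT x|I01. (cmod (g x))\<^sup>2)"
    using sq by (simp add: square_integrable_def)
  finally show ?thesis .
qed

lemma system_graph_dissipative:
  assumes "system_graph U V"
  shows "V \<bullet> U \<le> 5 * (norm U)\<^sup>2"
proof -
  obtain u1 u2 u3 v1 v2 v3 where UV: "U = (u1, u2, u3)" "V = (v1, v2, v3)"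
    by (metis prod_cases3)
  obtain f1 g1 k1 f2 g2 k2 f3 k3 where
    a: "antiderivative f1 g1" "antiderivative g1 k1" "antiderivative f2 g2" "antiderivative g2 k2"
      "antiderivative f3 (\<lambda>x. - k3 x)"
    and bc: "g1 1 = f3 0" "g1 1 = f1 1" "- g2 0 = f3 1" "g1 0 = 0" "g2 1 = 0"
    and r: "represents f1 u1" "represents f2 u2" "represents f3 u3"
      "represents k1 v1" "represents k2 v2" "represents k3 v3"
    by (rule system_graphE[OF assms[unfolded UV]])
  define N1 N2 where "N1 = (LINT x|I01. (cmod (g1 x))\<^sup>2)" and "N2 = (LINT x|I01. (cmod (g2 x))\<^sup>2)"
  have n: "(norm u1)\<^sup>2 = (LINT x|I01. (cmod (f1 x))\<^sup>2)" "(norm u2)\<^sup>2 = (LINT x|I01. (cmod (f2 x))\<^sup>2)"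
    by (rule represents_norm[OF r(1)] represents_norm[OF r(2)])+
  have "v1 \<bullet> u1 = Re (f1 1 * cnj (f1 1)) - N1"
    unfolding represents_inner[OF r(4,1)] energy_second_derivative[OF a(1,2)] bc(2) bc(4) N1_def by simp
  then have 1: "v1 \<bullet> u1 = (cmod (f1 1))\<^sup>2 - N1"
    unfolding Re_mult_cnj_self .
  have "v2 \<bullet> u2 = Re (f3 1 * cnj (f2 0)) - N2"
    unfolding represents_inner[OF r(5,2)] energy_second_derivative[OF a(3,4)] bc(5) bc(3)[symmetric] N2_def
    by simp
  moreover have "Re (f3 1 * cnj (f2 0)) \<le> cmod (f3 1) * cmod (f2 0)"
    using complex_Re_le_cmod[of "f3 1 * cnj (f2 0)"] by (simp add: norm_mult)
  moreover have "2 * cmod (f3 1) * cmod (f2 0) \<le> (cmod (f3 1))\<^sup>2 + (cmod (f2 0))\<^sup>2"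
    by (rule sum_squares_bound)
  ultimately have 2: "v2 \<bullet> u2 \<le> (cmod (f3 1))\<^sup>2 / 2 + (cmod (f2 0))\<^sup>2 / 2 - N2"
    by linarith
  have "f3 0 = f1 1"
    using bc by simp
  then have 3: "v3 \<bullet> u3 = (cmod (f1 1))\<^sup>2 / 2 - (cmod (f3 1))\<^sup>2 / 2"
    using energy_first_derivative[OF a(5)] unfolding represents_inner[OF r(6,3)] by simp
  \<comment> \<open>The boundary term enters the energy with factor 3/2; \<open>e = 2/3\<close> then
    uses up exactly \<open>N1\<close> and leaves the coefficient 15/4.\<close>
  have t1: "(cmod (f1 1))\<^sup>2 \<le> 5 / 2 * (norm u1)\<^sup>2 + 2 / 3 * N1"
    using trace_inequality[OF a(1), of 0 "2/3"] by (simp add: n N1_def)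
  \<comment> \<open>This term enters with factor 1/2, so \<open>e = 1\<close> uses up only half of
    \<open>N2\<close>. The terms in \<open>f3 1\<close> cancel in the sum of \<open>2\<close> and
    \<open>3\<close>.\<close>
  have t2: "(cmod (f2 0))\<^sup>2 \<le> 2 * (norm u2)\<^sup>2 + N2"
    using trace_inequality[OF a(3), of 1 1] by (simp add: n N2_def)
  have "0 \<le> N2"
    unfolding N2_def by simp
  have "V \<bullet> U = v1 \<bullet> u1 + v2 \<bullet> u2 + v3 \<bullet> u3"
    by (simp add: UV)
  also have "\<dots> \<le> 15 / 4 * (norm u1)\<^sup>2 + (norm u2)\<^sup>2"
    using 1 2 3 t1 t2 \<open>0 \<le> N2\<close> by (simp add: field_simps)
  also have "\<dots> \<le> 5 * ((norm u1)\<^sup>2 + (norm u2)\<^sup>2 + (norm u3)\<^sup>2)"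
    by (simp add: add_mono)
  also have "\<dots> = 5 * (norm U)\<^sup>2"
    by (simp add: UV power2_norm_eq_inner)
  finally show ?thesis .
qed

subsection \<open>The resolvent equation\<close>

text \<open>Variation of constants. The product rule for \<open>antiderivative\<close> verifies the
  solution even though \<open>h\<close> is only square integrable.\<close>

lemma first_order_ode:
  assumes "square_integrable h"
  obtains f where "f 0 = \<alpha>" "antiderivative f (\<lambda>x. complex_of_real \<mu> * f x + h x)"
proof -
  let ?e = "\<lambda>x. complex_of_real (exp (\<mu> * x))"
  define F where "F x = \<alpha> + primitive (\<lambda>s. h s * complex_of_real (exp (- \<mu> * s))) x" for x
  have "antiderivative F (\<lambda>s. h s * complex_of_real (exp (- \<mu> * s)))"
    unfolding F_def
    by (intro antiderivative_primitive square_integrable_mult_continuous assms continuous_intros)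
  moreover have "antiderivative ?e (\<lambda>x. complex_of_real (exp (\<mu> * x) * \<mu>))"
    by (intro antiderivative_C1 has_vector_derivative_of_real continuous_intros)
      (auto intro!: derivative_eq_intros simp flip: has_real_derivative_iff_has_vector_derivative)
  ultimately have "antiderivative (\<lambda>x. ?e x * F x)
      (\<lambda>x. complex_of_real (exp (\<mu> * x) * \<mu>) * F x + ?e x * (h x * complex_of_real (exp (- \<mu> * x))))"
    by (rule antiderivative_product[rotated])
  also have "(\<lambda>x. complex_of_real (exp (\<mu> * x) * \<mu>) * F x + ?e x * (h x * complex_of_real (exp (- \<mu> * x))))
      = (\<lambda>x. complex_of_real \<mu> * (?e x * F x) + h x)"
  proof
    fix x
    have "?e x * (h x * complex_of_real (exp (- \<mu> * x))) = h x * complex_of_real (exp (\<mu> * x) * exp (- \<mu> * x))"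
      by simp
    also have "exp (\<mu> * x) * exp (- \<mu> * x) = 1"
      by (simp flip: exp_add)
    finally show "complex_of_real (exp (\<mu> * x) * \<mu>) * F x + ?e x * (h x * complex_of_real (exp (- \<mu> * x)))
        = complex_of_real \<mu> * (?e x * F x) + h x"
      by simp
  qed
  finally show thesis
    by (intro that) (auto simp: F_def)
qed

text \<open>Factorization of \<open>\<mu>\<^sup>2 - d\<^sup>2/dx\<^sup>2\<close> into \<open>(\<mu> - d/dx)(\<mu> + d/dx)\<close>.\<close>

lemma second_order_ode:
  assumes "square_integrable h"
  obtains f g where "f 0 = \<alpha>" "g 0 = \<beta>" "antiderivative f g"
    "antiderivative g (\<lambda>x. complex_of_real (\<mu>\<^sup>2) * f x - h x)"
proof -
  let ?\<mu> = "complex_of_real \<mu>"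
  have "square_integrable (\<lambda>x. - h x)"
    using square_integrable_mult[OF assms, of "-1"] by simp
  \<comment> \<open>\<open>w\<close> stands for \<open>f' + \<mu> f\<close>, which dictates its
    initial value and the equation \<open>w' = \<mu> w - h\<close>.\<close>
  then obtain w where w: "w 0 = \<beta> + ?\<mu> * \<alpha>" "antiderivative w (\<lambda>x. ?\<mu> * w x + - h x)"
    by (rule first_order_ode)
  obtain f where f: "f 0 = \<alpha>" "antiderivative f (\<lambda>x. complex_of_real (- \<mu>) * f x + w x)"
    by (rule first_order_ode[OF antiderivative_square_integrable(1)[OF w(2)]])
  define g where "g x = complex_of_real (- \<mu>) * f x + w x" for x
  have "antiderivative g (\<lambda>x. complex_of_real (- \<mu>) * (complex_of_real (- \<mu>) * f x + w x) + (?\<mu> * w x + - h x))"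
    unfolding g_def by (intro antiderivative_add antiderivative_mult f w)
  also have "(\<lambda>x. complex_of_real (- \<mu>) * (complex_of_real (- \<mu>) * f x + w x) + (?\<mu> * w x + - h x))
      = (\<lambda>x. complex_of_real (\<mu>\<^sup>2) * f x - h x)"
    by (auto simp: power2_eq_square algebra_simps)
  finally have g: "antiderivative g (\<lambda>x. complex_of_real (\<mu>\<^sup>2) * f x - h x)" .
  show thesis
  proof (rule that)
    show "antiderivative f g"
      using f(2) by (simp add: g_def[abs_def])
    show "g 0 = \<beta>"
      by (simp add: g_def f w)
  qed (fact f g)+
qed

text \<open>The homogeneous solution with slope 0 at 0: its multiples adjust the condition at 1
  without disturbing the slope at 0.\<close>

lemma antiderivative_cosh_sinh:
  "antiderivative (\<lambda>x. complex_of_real (cosh (\<mu> * x))) (\<lambda>x. complex_of_real (\<mu> * sinh (\<mu> * x)))"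
  "antiderivative (\<lambda>x. complex_of_real (\<mu> * sinh (\<mu> * x))) (\<lambda>x. complex_of_real (\<mu>\<^sup>2 * cosh (\<mu> * x)))"
  by (intro antiderivative_C1 has_vector_derivative_of_real continuous_intros;
      auto intro!: derivative_eq_intros simp: power2_eq_square
        simp flip: has_real_derivative_iff_has_vector_derivative)+

text \<open>Otherwise \<open>cosh (\<mu> x)\<close> would satisfy \<open>u'(0) = 0\<close> and
  \<open>u'(1) = u(1)\<close>, and the equation for \<open>u1\<close> would be singular. In
  exponentials, equality reads \<open>(\<mu> - 1) exp \<mu> = (\<mu> + 1) exp (- \<mu>)\<close>, and
  \<open>\<mu> + 1\<close> separates the two sides.\<close>

lemma sinh_cosh_noneq:
  fixes \<mu> :: real
  assumes "2 \<le> \<mu>"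
  shows "\<mu> * sinh \<mu> \<noteq> cosh \<mu>"
proof
  assume "\<mu> * sinh \<mu> = cosh \<mu>"
  then have "(\<mu> - 1) * exp \<mu> = (\<mu> + 1) * exp (- \<mu>)"
    by (simp add: sinh_field_def cosh_field_def field_simps)
  moreover have "(\<mu> + 1) * exp (- \<mu>) < (\<mu> + 1) * 1"
    using assms by (intro mult_strict_left_mono) auto
  moreover have "1 * (1 + \<mu>) \<le> (\<mu> - 1) * exp \<mu>"
    using assms exp_ge_add_one_self[of \<mu>] by (intro mult_mono) auto
  ultimately show False
    by simp
qed

lemma system_resolvent:
  assumes l: "5 < l"
  shows "\<exists>U V. system_graph U V \<and> l *\<^sub>R U - V = Y"
proof -
  obtain y1 y2 y3 where Y: "Y = (y1, y2, y3)"
    by (metis prod_cases3)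
  obtain h1 where h1: "represents h1 y1"
    by (rule represents_exists)
  obtain h2 where h2: "represents h2 y2"
    by (rule represents_exists)
  obtain h3 where h3: "represents h3 y3"
    by (rule represents_exists)
  define \<mu> where "\<mu> = sqrt l"
  have \<mu>: "\<mu>\<^sup>2 = l" "2 \<le> \<mu>"
    using l by (auto simp: \<mu>_def intro: real_le_rsqrt)
  let ?c = "\<lambda>x. complex_of_real (cosh (\<mu> * x))" and ?s = "\<lambda>x. complex_of_real (\<mu> * sinh (\<mu> * x))"
  let ?l = "complex_of_real l"
  have combine: "antiderivative (\<lambda>x. f x + \<gamma> * ?c x) (\<lambda>x. g x + \<gamma> * ?s x)"
    "antiderivative (\<lambda>x. g x + \<gamma> * ?s x) (\<lambda>x. ?l * (f x + \<gamma> * ?c x) - h x)"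
    if "antiderivative f g" "antiderivative g (\<lambda>x. complex_of_real (\<mu>\<^sup>2) * f x - h x)" for f g h \<gamma>
  proof -
    show "antiderivative (\<lambda>x. f x + \<gamma> * ?c x) (\<lambda>x. g x + \<gamma> * ?s x)"
      by (intro antiderivative_add antiderivative_mult antiderivative_cosh_sinh that)
    have "antiderivative (\<lambda>x. g x + \<gamma> * ?s x)
        (\<lambda>x. (complex_of_real (\<mu>\<^sup>2) * f x - h x) + \<gamma> * complex_of_real (\<mu>\<^sup>2 * cosh (\<mu> * x)))"
      by (intro antiderivative_add antiderivative_mult antiderivative_cosh_sinh that)
    then show "antiderivative (\<lambda>x. g x + \<gamma> * ?s x) (\<lambda>x. ?l * (f x + \<gamma> * ?c x) - h x)"
      by (simp add: \<mu> algebra_simps)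
  qed
  \<comment> \<open>A particular solution with zero data already satisfies
    \<open>u1'(0) = 0\<close>.\<close>
  obtain p1 q1 where p1: "p1 0 = 0" "q1 0 = 0" "antiderivative p1 q1"
      "antiderivative q1 (\<lambda>x. complex_of_real (\<mu>\<^sup>2) * p1 x - h1 x)"
    by (rule second_order_ode[OF represents_square_integrable[OF h1]])
  have "complex_of_real (\<mu> * sinh (\<mu> * 1) - cosh (\<mu> * 1)) \<noteq> 0"
    using sinh_cosh_noneq[OF \<mu>(2)] by (simp only: of_real_eq_0_iff) simp
  then have "?s 1 - ?c 1 \<noteq> 0"
    by (simp only: of_real_diff not_False_eq_True)
  \<comment> \<open>Solves \<open>q1 1 + \<alpha> * ?s 1 = p1 1 + \<alpha> * ?c 1\<close>, the
    condition \<open>u1'(1) = u1(1)\<close>.\<close>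
  define \<alpha> where "\<alpha> = (p1 1 - q1 1) / (?s 1 - ?c 1)"
  have \<alpha>: "\<alpha> * ?s 1 - \<alpha> * ?c 1 = p1 1 - q1 1"
    using \<open>?s 1 - ?c 1 \<noteq> 0\<close> unfolding \<alpha>_def right_diff_distrib[symmetric] by simp
  define f1 g1 where "f1 x = p1 x + \<alpha> * ?c x" and "g1 x = q1 x + \<alpha> * ?s x" for x
  have 1: "antiderivative f1 g1" "antiderivative g1 (\<lambda>x. ?l * f1 x - h1 x)"
    unfolding f1_def g1_def by (rule combine[OF p1(3,4)])+
  have bc1: "g1 0 = 0" "g1 1 = f1 1"
    using \<alpha> p1(2) by (simp_all add: f1_def g1_def) (simp add: algebra_simps)?
  obtain f3 where f3: "f3 0 = f1 1" "antiderivative f3 (\<lambda>x. complex_of_real (- l) * f3 x + h3 x)"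
    by (rule first_order_ode[OF represents_square_integrable[OF h3]])
  \<comment> \<open>The initial slope carries the coupling \<open>- u2'(0) = u_del(1)\<close>;
    \<open>\<beta>\<close> below cancels the slope at 1 and keeps the one at 0, where
    \<open>sinh\<close> vanishes.\<close>
  obtain p2 q2 where p2: "p2 0 = 0" "q2 0 = - f3 1" "antiderivative p2 q2"
      "antiderivative q2 (\<lambda>x. complex_of_real (\<mu>\<^sup>2) * p2 x - h2 x)"
    by (rule second_order_ode[OF represents_square_integrable[OF h2]])
  have "?s 1 \<noteq> 0"
    using \<mu>(2) by simp
  define \<beta> where "\<beta> = - q2 1 / ?s 1"
  define f2 g2 where "f2 x = p2 x + \<beta> * ?c x" and "g2 x = q2 x + \<beta> * ?s x" for x
  have 2: "antiderivative f2 g2" "antiderivative g2 (\<lambda>x. ?l * f2 x - h2 x)"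
    unfolding f2_def g2_def by (rule combine[OF p2(3,4)])+
  have bc2: "- g2 0 = f3 1" "g2 1 = 0"
    unfolding g2_def \<beta>_def using \<open>?s 1 \<noteq> 0\<close> p2(2) by simp_all
  have 3: "antiderivative f3 (\<lambda>x. - (?l * f3 x - h3 x))"
    using f3(2) by (simp add: algebra_simps)
  obtain u1 where u1: "represents f1 u1"
    by (rule represents_abs[OF antiderivative_square_integrable(1)[OF 1(1)]])
  obtain u2 where u2: "represents f2 u2"
    by (rule represents_abs[OF antiderivative_square_integrable(1)[OF 2(1)]])
  obtain u3 where u3: "represents f3 u3"
    by (rule represents_abs[OF antiderivative_square_integrable(1)[OF f3(2)]])
  have "system_graph (u1, u2, u3) (l *\<^sub>R u1 - y1, l *\<^sub>R u2 - y2, l *\<^sub>R u3 - y3)"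
    using bc1 bc2 f3(1)
    by (intro system_graphI[OF 1 2 3] u1 u2 u3 represents_diff represents_scaleR h1 h2 h3) auto
  then show ?thesis
    by (intro exI conjI) (auto simp: Y)
qed

theorem proposition4p3:
  shows "\<exists>T :: real \<Rightarrow> L2 \<times> L2 \<times> L2 \<Rightarrow> L2 \<times> L2 \<times> L2.
    generates system_domain system_operator T \<and> real_semigroup T"
proof -
  have zero: "0 *\<^sub>C U = 0" for U :: "L2 \<times> L2 \<times> L2"
    using scaleR_eq_scaleC[of 0 U] by simp
  \<comment> \<open>Some element of the domain, to be multiplied by 0 in order to see that the
    domain contains 0; any number above 5 would do in place of 6.\<close>
  obtain U0 V0 where "system_graph U0 V0"
    using system_resolvent[of 6 0] by auto
  then have "U0 \<in> system_domain"
    by (rule system_graph_operator(1))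
  note graph = system_domain_graph and operator = system_graph_operator
  have dom_add: "U + V \<in> system_domain" if "U \<in> system_domain" "V \<in> system_domain" for U V
    by (rule operator(1)[OF system_graph_add[OF graph graph]]) (fact that)+
  have dom_scale: "c *\<^sub>C U \<in> system_domain" if "U \<in> system_domain" for c U
    by (rule operator(1)[OF system_graph_scaleC[OF graph[OF that]]])
  have op_add: "system_operator (U + V) = system_operator U + system_operator V"
    if "U \<in> system_domain" "V \<in> system_domain" for U V
    by (rule operator(2)[OF system_graph_add[OF graph graph]]) (fact that)+
  have op_scale: "system_operator (c *\<^sub>C U) = c *\<^sub>C system_operator U" if "U \<in> system_domain" for c U
    by (rule operator(2)[OF system_graph_scaleC[OF graph[OF that]]])
  have dissipative: "system_operator U \<bullet> U \<le> 5 * (norm U)\<^sup>2" if "U \<in> system_domain" for U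
    by (rule system_graph_dissipative[OF graph[OF that]])
  have range: "\<exists>U\<in>system_domain. l *\<^sub>R U - system_operator U = Y" if "5 < l" for l Y
    using system_resolvent[OF that, of Y] operator by blast
  have dom_zero: "0 \<in> system_domain"
    using dom_scale[OF \<open>U0 \<in> system_domain\<close>, of 0] by (simp add: zero)
  obtain T where T: "generates system_domain system_operator T"
    and commute: "\<And>C t x. \<lbrakk>bounded_linear C; \<And>x. x \<in> system_domain \<Longrightarrow> C x \<in> system_domain;
        \<And>x. x \<in> system_domain \<Longrightarrow> system_operator (C x) = C (system_operator x); 0 \<le> t\<rbrakk>
      \<Longrightarrow> T t (C x) = C (T t x)"
    by (rule quasi_m_dissipative_generates[OF dom_zero dom_add dom_scale op_add op_scale dissipative range]) blast+
  \<comment> \<open>Conjugation preserves the graph since equations and boundary conditions have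
    real coefficients. A real state is a fixed point of \<open>conj3\<close>, hence so is its image
    under \<open>T t\<close>.\<close>
  have "T t (conj3 U) = conj3 (T t U)" if "0 \<le> t" for t U
    using operator[OF system_graph_conj3[OF graph]] by (intro commute bounded_linear_conj3 that) auto
  then have "real_semigroup T"
    unfolding real_semigroup_def real_valued3_conj3 by metis
  with T show ?thesis
    by blast
qed

end
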